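(* Let $n\in\mathbb Z$, let $q,a,b,c,d,e,f$ be non-zero complex numbers with $|q|<1$ and $|q^2a^2|<|bcdef|$, and assume there are no vanishing denominator factors. Then $${}_8W_7\!\left(a;b,c,d,e,f;q,\frac{q^2a^2}{bcdef}\right)=\frac{(qa,\frac{qa}{bc};q)_\infty}{\vartheta(\frac{q^{n+2}a^2}{bcdef},\frac{q^{n+1}a}{bc};q)\,(\frac{qa}b,\frac{qa}c,\frac{qa}d,\frac{qa}e,\frac{qa}f;q)_\infty}\Big(F(d;e,f)+F(e;d,f)+F(f;e,d)\Big),$$ where $$F(d;e,f):=\frac{\vartheta(\frac{q^{n+2}a^2}{bcef},\frac{q^{n+1}a}{bcd};q)(\frac{qa}{bd},\frac{qa}{cd},\frac{qa}{de},\frac{qa}{df},e,f;q)_\infty}{(\frac{qa}{bcd},\frac ed,\frac fd;q)_\infty}\,{}_4\phi_3\!\left(\tfrac{qa}{ef},\tfrac{bd}a,\tfrac{cd}a,d;\tfrac{bcd}a,\tfrac{qd}e,\tfrac{qd}f;q,q\right).$$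
   Context: Notation. $(a;q)_k=\prod_{j=0}^{k-1}(1-aq^j)$, $(a;q)_\infty=\prod_{j\ge0}(1-aq^j)$, $(a_1,\dots,a_r;q)_k=\prod_j(a_j;q)_k$ for $k\in\mathbb N_0\cup\{\infty\}$. In a list, $\pm x$ stands for the two entries $x,-x$. The symbol $e$ is a parameter, not Euler's number. $\vartheta(x;q)=(x,q/x;q)_\infty$ for $x\ne0$, $\vartheta(x_1,\dots,x_k;q)=\prod_j\vartheta(x_j;q)$. ${}_{r+1}\phi_r(a_1,\dots,a_{r+1};b_1,\dots,b_r;q,z)=\sum_{k\ge0}\frac{(a_1,\dots,a_{r+1};q)_k}{(q,b_1,\dots,b_r;q)_k}z^k$ for $|z|<1$, and $${}_8W_7(a;b,c,d,e,f;q,z)={}_8\phi_7\!\left(a,\pm q\sqrt a,b,c,d,e,f;\pm\sqrt a,\tfrac{qa}b,\tfrac{qa}c,\tfrac{qa}d,\tfrac{qa}e,\tfrac{qa}f;q,z\right).$$ $F(e;d,f)$ and $F(f;e,d)$ are obtained from $F(d;e,f)$ by interchanging $d$ with $e$, respectively $d$ with $f$. Convention "no vanishing denominator factors": every infinite $q$-shifted factorial and every theta function appearing in a denominator is non-zero, and no denominator parameter of any series lies in $\{q^{-k}:k\in\mathbb N_0\}$. *)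

theory Defs
  imports "HOL-Analysis.Analysis"
begin

definition qpoch :: "complex \<Rightarrow> complex \<Rightarrow> nat \<Rightarrow> complex" where
  "qpoch a q k = (\<Prod>j<k. 1 - a * q ^ j)"

definition qpoch_inf :: "complex \<Rightarrow> complex \<Rightarrow> complex" where
  "qpoch_inf a q = (\<Prod>j. 1 - a * q ^ j)"

text \<open>The multi-parameter versions \<open>(a\<^sub>1,\<dots>,a\<^sub>r;q)\<^sub>k\<close>, \<open>(a\<^sub>1,\<dots>,a\<^sub>r;q)\<^sub>\<infinity>\<close> and \<open>\<theta>(x\<^sub>1,\<dots>,x\<^sub>k;q)\<close>
  take the parameters as a list.\<close>

definition qpochs :: "complex list \<Rightarrow> complex \<Rightarrow> nat \<Rightarrow> complex" where
  "qpochs as q k = (\<Prod>a\<leftarrow>as. qpoch a q k)"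

definition qpochs_inf :: "complex list \<Rightarrow> complex \<Rightarrow> complex" where
  "qpochs_inf as q = (\<Prod>a\<leftarrow>as. qpoch_inf a q)"

definition theta :: "complex \<Rightarrow> complex \<Rightarrow> complex" where
  "theta x q = qpochs_inf [x, q / x] q"

definition thetas :: "complex list \<Rightarrow> complex \<Rightarrow> complex" where
  "thetas xs q = (\<Prod>x\<leftarrow>xs. theta x q)"

text \<open>The series \<open>\<^sub>r\<^sub>+\<^sub>1\<phi>\<^sub>r\<close>, meant for \<open>length as = length bs + 1\<close> and \<open>\<bar>z\<bar> < 1\<close>.  There is no
  sign/power correction factor as in the general \<open>\<^sub>r\<phi>\<^sub>s\<close>.\<close>

definition phi :: "complex list \<Rightarrow> complex list \<Rightarrow> complex \<Rightarrow> complex \<Rightarrow> complex" where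
  "phi as bs q z = (\<Sum>k. qpochs as q k / qpochs (q # bs) q k * z ^ k)"

text \<open>No parameter in the list lies in \<open>{q\<^sup>-\<^sup>k : k \<in> \<nat>}\<close>.\<close>

definition no_pole_params :: "complex list \<Rightarrow> complex \<Rightarrow> bool" where
  "no_pole_params bs q \<longleftrightarrow> (\<forall>\<beta>\<in>set bs. \<forall>k::nat. \<beta> \<noteq> q powi (- int k))"

text \<open>Both square roots of \<open>a\<close> occur symmetrically, so the choice of branch is immaterial.\<close>

definition W87_lower ::
  "complex \<Rightarrow> complex \<Rightarrow> complex \<Rightarrow> complex \<Rightarrow> complex \<Rightarrow> complex \<Rightarrow> complex \<Rightarrow> complex list" where
  "W87_lower a b c d e f q =
     [csqrt a, - csqrt a, q * a / b, q * a / c, q * a / d, q * a / e, q * a / f]"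

definition W87 ::
  "complex \<Rightarrow> complex \<Rightarrow> complex \<Rightarrow> complex \<Rightarrow> complex \<Rightarrow> complex \<Rightarrow> complex \<Rightarrow> complex \<Rightarrow> complex" where
  "W87 a b c d e f q z =
     phi [a, q * csqrt a, - (q * csqrt a), b, c, d, e, f] (W87_lower a b c d e f q) q z"

text \<open>\<open>F n q a b c d e f\<close> is \<open>F(d;e,f)\<close>; \<open>F_den\<close> is its denominator in front of the series and
  \<open>F_lower\<close> the list of lower parameters of its \<open>\<^sub>4\<phi>\<^sub>3\<close>.\<close>

definition F_den ::
  "complex \<Rightarrow> complex \<Rightarrow> complex \<Rightarrow> complex \<Rightarrow> complex \<Rightarrow> complex \<Rightarrow> complex \<Rightarrow> complex" where
  "F_den q a b c d e f = qpochs_inf [q * a / (b * c * d), e / d, f / d] q"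

definition F_lower ::
  "complex \<Rightarrow> complex \<Rightarrow> complex \<Rightarrow> complex \<Rightarrow> complex \<Rightarrow> complex \<Rightarrow> complex \<Rightarrow> complex list" where
  "F_lower q a b c d e f = [b * c * d / a, q * d / e, q * d / f]"

definition F ::
  "int \<Rightarrow> complex \<Rightarrow> complex \<Rightarrow> complex \<Rightarrow> complex \<Rightarrow> complex \<Rightarrow> complex \<Rightarrow> complex \<Rightarrow> complex" where
  "F n q a b c d e f =
     thetas [q powi (n + 2) * a\<^sup>2 / (b * c * e * f), q powi (n + 1) * a / (b * c * d)] q *
     qpochs_inf [q * a / (b * d), q * a / (c * d), q * a / (d * e), q * a / (d * f), e, f] q /
     F_den q a b c d e f *
     phi [q * a / (e * f), b * d / a, c * d / a, d] (F_lower q a b c d e f) q q"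

end

theory Submission
  imports Defs
begin

text \<open>The series \<open>\<^sub>8W\<^sub>7(a; b, c, d, e, f)\<close> is symmetric in six parameters, and each of them can serve as the base
  point. (i) The nonterminating very-well-poised \<open>\<^sub>6\<phi>\<^sub>5\<close> sum and the nonterminating \<open>q\<close>-Saalschuetz sum are proved
  by two-term recursions; expanding by the first and summing by the second expresses the series based at \<open>d\<close> as
  the difference of the \<open>q\<close>-sums of one function \<open>w\<close> over the lattices \<open>g q\<^sup>j\<close> and \<open>d q\<^sup>j\<close>, where
  \<open>g = qa/(bc)\<close>; \<open>w\<close> is symmetric in \<open>d, e, f\<close>, and its sum over \<open>d q\<^sup>j\<close> is the \<open>\<^sub>4\<phi>\<^sub>3\<close> in \<open>F(d; e, f)\<close>.
  (ii) By partial fractions, the series based at \<open>a, d, e\<close> are linearly dependent, and so are those based at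
  \<open>a, d, f\<close>. (iii) A combination of these two relations in which the sum over \<open>g q\<^sup>j\<close> cancels is the claim; the
  coefficients are matched by the three-term theta identity, which is the statement that the \<open>q\<close>-integrals of one
  function over three lattices, taken pairwise, add up to zero. (iv) The steps divide by theta values that may
  vanish for special parameters; these are reached by continuity. The integer \<open>n\<close> is immaterial since the theta
  quotients involved are invariant under replacing \<open>n\<close> by \<open>n + 1\<close>.\<close>

section \<open>Infinite shifted factorials and theta functions\<close>

text \<open>The integrand \<open>w\<close> belongs to the splitting of the six parameters into the
  triples a, b, c and d, e, f. The base points d, e, f all lead to it, each paired with the common
  lattice g q^j; the base point a lies in the other triple, and its series is tied to these sums
  through (ii). One relation of (ii) involves two of the three differences of sums. Two relations
  reach all three, and the freedom left in combining them removes the common lattice. Series are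
  carried cleared of denominators: \<open>P (x * q ^ k)\<close> replaces 1/(x;q)_k, from which it
  differs by the constant factor \<open>P x\<close>. The series are then continuous in the
  parameters, so that (iv) is a limit on both sides of one identity. Limits and interchanges of
  infinite sums rest on dominated convergence with geometric majorants. The relations of (ii) begin
  as finite identities: a divided difference vanishes when the degree is at least two below the
  number of nodes, and only then does the number of nodes grow.\<close>

lemma qpoch_0 [simp]: "qpoch a q 0 = 1"
  by (simp add: qpoch_def)

lemma qpoch_Suc: "qpoch a q (Suc n) = qpoch a q n * (1 - a * q ^ n)"
  by (simp add: qpoch_def)

lemma qpoch_add: "qpoch a q (m + n) = qpoch a q m * qpoch (a * q ^ m) q n"
  by (induction n) (simp_all add: qpoch_Suc power_add mult_ac)

lemma qpoch_Suc_shift: "qpoch a q (Suc n) = (1 - a) * qpoch (a * q) q n"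
  using qpoch_add[of a q 1 n] by (simp add: qpoch_Suc)

lemma qpoch_zero_left [simp]: "qpoch 0 q n = 1"
  by (simp add: qpoch_def)

locale qbase =
  fixes q :: complex
  assumes q_nz [simp]: "q \<noteq> 0" and q_less_1: "norm q < 1"
begin

abbreviation P :: "complex \<Rightarrow> complex" where "P x \<equiv> qpoch_inf x q"
abbreviation pn :: "complex \<Rightarrow> nat \<Rightarrow> complex" where "pn x k \<equiv> qpoch x q k"
abbreviation th :: "complex \<Rightarrow> complex" where "th x \<equiv> theta x q"

text \<open>Common bound for all finite and infinite factorials with |a| \<le> r: the product of the
  factors 1 + r |q|^j is at most the exponential of a geometric series. Its independence of the
  length is what the dominated limits use.\<close>

definition pbound :: "real \<Rightarrow> real" where "pbound r = exp (r / (1 - norm q))"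

lemma pbound_pos [simp]: "pbound r > 0" and pbound_nonneg [simp]: "pbound r \<ge> 0"
  by (auto simp: pbound_def)

lemma q_power_less_1: "norm (q ^ Suc n) < 1"
  using q_less_1 by (metis norm_power norm_ge_zero power_Suc_less_one power_less_one_iff zero_less_Suc)

lemma one_minus_q_power_nz [simp]: "1 - q ^ Suc n \<noteq> 0"
  using q_power_less_1[of n] by auto

lemma tendsto_q_power: "(\<lambda>n. q ^ n) \<longlonglongrightarrow> 0"
  by (rule LIMSEQ_power_zero) (use q_less_1 in auto)

lemma norm_q_power_le_1: "norm q ^ n \<le> 1"
  using q_less_1 by (simp add: power_le_one)

lemma summable_q_power: "summable (\<lambda>n. norm q ^ n)"
  using q_less_1 by (intro summable_geometric) auto

lemma prod_one_plus_le_pbound: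
  assumes "r \<ge> 0"
  shows "(\<Prod>j<n. 1 + r * norm q ^ j) \<le> pbound r"
proof -
  have "(\<Prod>j<n. 1 + r * norm q ^ j) \<le> exp (\<Sum>j<n. r * norm q ^ j)"
    using assms by (intro prod_le_exp_sum) auto
  also have "(\<Sum>j<n. r * norm q ^ j) = r * (\<Sum>j<n. norm q ^ j)"
    by (simp add: sum_distrib_left)
  also have "(\<Sum>j<n. norm q ^ j) \<le> (\<Sum>j. norm q ^ j)"
    by (rule sum_le_suminf[OF summable_q_power]) auto
  also have "(\<Sum>j. norm q ^ j) = 1 / (1 - norm q)"
    using q_less_1 by (intro suminf_geometric) auto
  finally show ?thesis
    using assms by (simp add: pbound_def mult_left_mono)
qed

lemma norm_qpoch_le:
  assumes "norm a \<le> r"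
  shows "norm (pn a n) \<le> pbound r"
proof -
  have r: "r \<ge> 0" using assms norm_ge_zero order_trans by blast
  have "norm (pn a n) = (\<Prod>j<n. norm (1 - a * q ^ j))"
    by (simp add: qpoch_def prod_norm)
  also have "\<dots> \<le> (\<Prod>j<n. 1 + r * norm q ^ j)"
  proof (intro prod_mono conjI norm_ge_zero)
    fix j
    have "norm (1 - a * q ^ j) \<le> norm (1::complex) + norm (a * q ^ j)"
      by (rule norm_triangle_ineq4)
    also have "\<dots> \<le> 1 + r * norm q ^ j"
      using assms by (simp add: norm_mult norm_power mult_right_mono)
    finally show "norm (1 - a * q ^ j) \<le> 1 + r * norm q ^ j" .
  qed
  also have "\<dots> \<le> pbound r" by (rule prod_one_plus_le_pbound[OF r])
  finally show ?thesis .
qed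

lemma convergent_prod_q: "convergent_prod (\<lambda>j. 1 - a * q ^ j)"
proof -
  have "summable (\<lambda>j. norm (1 - a * q ^ j - 1))"
    using summable_mult[OF summable_q_power, of "norm a"] by (simp add: norm_mult norm_power)
  then show ?thesis
    by (intro abs_convergent_prod_imp_convergent_prod summable_imp_abs_convergent_prod)
qed

lemma qpoch_LIMSEQ: "(\<lambda>n. pn a n) \<longlonglongrightarrow> P a"
  using convergent_prod_LIMSEQ[OF convergent_prod_q[of a]]
  unfolding qpoch_def qpoch_inf_def by (subst LIMSEQ_lessThan_iff_atMost)

lemma norm_qpoch_inf_le: "norm a \<le> r \<Longrightarrow> norm (P a) \<le> pbound r"
  by (rule Lim_bounded[OF tendsto_norm[OF qpoch_LIMSEQ[of a]], of 0]) (auto intro: norm_qpoch_le)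

lemma qpoch_inf_split: "P a = pn a n * P (a * q ^ n)"
proof (rule LIMSEQ_unique)
  show "(\<lambda>m. pn a (m + n)) \<longlonglongrightarrow> P a"
    by (rule LIMSEQ_ignore_initial_segment[OF qpoch_LIMSEQ])
  have "(\<lambda>m. pn a n * pn (a * q ^ n) m) \<longlonglongrightarrow> pn a n * P (a * q ^ n)"
    by (intro tendsto_intros qpoch_LIMSEQ)
  then show "(\<lambda>m. pn a (m + n)) \<longlonglongrightarrow> pn a n * P (a * q ^ n)"
    by (simp add: qpoch_add add.commute[of _ n])
qed

lemma qpoch_inf_Suc: "P a = (1 - a) * P (a * q)"
  using qpoch_inf_split[of a 1] by (simp add: qpoch_Suc)

lemma qpoch_inf_zero [simp]: "P 0 = 1"
  by (rule LIMSEQ_unique[OF qpoch_LIMSEQ]) simp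

lemma qpoch_inf_one [simp]: "P 1 = 0"
  using qpoch_inf_Suc[of 1] by simp

lemma qpoch_inf_eq_0_iff: "P a = 0 \<longleftrightarrow> (\<exists>k. a * q ^ k = 1)"
proof
  assume "P a = 0"
  then have "\<exists>k. 1 - a * q ^ k = 0"
    unfolding qpoch_inf_def using prodinf_nonzero[OF convergent_prod_q[of a]] by metis
  then show "\<exists>k. a * q ^ k = 1" by (metis eq_iff_diff_eq_0)
next
  assume "\<exists>k. a * q ^ k = 1"
  then obtain k where "a * q ^ k = 1" by blast
  then show "P a = 0" using qpoch_inf_split[of a k] by simp
qed

lemma qpoch_nz: "P a \<noteq> 0 \<Longrightarrow> pn a n \<noteq> 0"
  using qpoch_inf_split[of a n] by auto

lemma qpoch_inf_shift_nz: "P a \<noteq> 0 \<Longrightarrow> P (a * q ^ n) \<noteq> 0"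
  using qpoch_inf_split[of a n] by auto

lemma qpoch_inf_q_nz [simp]: "P q \<noteq> 0"
proof
  assume "P q = 0"
  then obtain k where "q * q ^ k = 1" using qpoch_inf_eq_0_iff by blast
  then show False using one_minus_q_power_nz[of k] by (simp add: mult.commute)
qed

lemma qpoch_inf_small_nz: "norm a < 1 \<Longrightarrow> P a \<noteq> 0"
proof
  assume a: "norm a < 1" and "P a = 0"
  then obtain k where k: "a * q ^ k = 1" using qpoch_inf_eq_0_iff by blast
  have "norm a * norm q ^ k \<le> norm a * 1"
    by (intro mult_left_mono norm_q_power_le_1) auto
  moreover have "norm a * norm q ^ k = 1"
    using arg_cong[OF k, of norm] by (simp add: norm_mult norm_power)
  ultimately show False using a by simp
qed

text \<open>The partial products converge uniformly on the disc of radius |x| + 1 by the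
  M-test.\<close>

lemma isCont_qpoch_inf: "isCont P x"
proof -
  define r where "r = norm x + 1"
  have unif: "uniformly_convergent_on (cball 0 r) (\<lambda>N y. \<Prod>n<N. 1 - y * q ^ n)"
  proof (rule uniformly_convergent_on_prod')
    show "continuous_on (cball 0 r) (\<lambda>y. 1 - y * q ^ n)" for n
      by (intro continuous_intros)
    show "compact (cball (0::complex) r)" by simp
    show "uniformly_convergent_on (cball 0 r) (\<lambda>N y. \<Sum>n<N. norm (1 - y * q ^ n - 1))"
    proof (rule Weierstrass_m_test')
      show "summable (\<lambda>n. r * norm q ^ n)"
        by (intro summable_mult summable_q_power)
    qed (auto simp: norm_mult norm_power intro!: mult_right_mono)
  qed
  then obtain l where l: "uniform_limit (cball 0 r) (\<lambda>N y. pn y N) l sequentially"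
    unfolding uniformly_convergent_on_def qpoch_def by blast
  have "l y = P y" if "y \<in> cball 0 r" for y
    using tendsto_uniform_limitI[OF l that] qpoch_LIMSEQ[of y] LIMSEQ_unique by blast
  moreover have "continuous_on (cball 0 r) l"
    by (rule uniform_limit_theorem[OF _ l]) (auto simp: qpoch_def intro!: always_eventually continuous_intros)
  ultimately have "continuous_on (cball 0 r) P"
    using continuous_on_cong[of "cball 0 r" "cball 0 r" l P] by blast
  moreover have "x \<in> interior (cball 0 r)"
    by (simp add: r_def)
  ultimately show ?thesis
    by (rule continuous_on_interior)
qed

lemma tendsto_qpoch_inf [tendsto_intros]: "(f \<longlongrightarrow> x) net \<Longrightarrow> ((\<lambda>n. P (f n)) \<longlongrightarrow> P x) net"
  using isCont_tendsto_compose[OF isCont_qpoch_inf] .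

lemma tendsto_qpoch [tendsto_intros]: "(f \<longlongrightarrow> x) net \<Longrightarrow> ((\<lambda>n. pn (f n) k) \<longlongrightarrow> pn x k) net"
  unfolding qpoch_def by (intro tendsto_intros)

lemma tendsto_qpoch_inf_shift: "(\<lambda>n. P (x * q ^ n)) \<longlonglongrightarrow> 1"
  using tendsto_qpoch_inf[OF tendsto_mult[OF tendsto_const tendsto_q_power], of x] by simp

lemma qpoch_inverse_bounded:
  assumes "P a \<noteq> 0"
  obtains C where "C > 0" "\<And>n. norm (inverse (pn a n)) \<le> C"
proof -
  have "(\<lambda>n. inverse (pn a n)) \<longlonglongrightarrow> inverse (P a)"
    by (intro tendsto_intros qpoch_LIMSEQ assms)
  then have "Bseq (\<lambda>n. inverse (pn a n))"
    by (meson convergentI convergent_imp_Bseq)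
  then show ?thesis using that by (auto elim: BseqE)
qed

text \<open>Since 1/P (a q^n) = (a;q)_n / P a, a lower bound for \<open>P\<close> along the lattice
  is turned into the upper bound for finite factorials.\<close>

lemma qpoch_inf_inverse_bounded:
  assumes "P a \<noteq> 0"
  obtains C where "C > 0" "\<And>n. norm (inverse (P (a * q ^ n))) \<le> C"
proof
  show "pbound (norm a) / norm (P a) > 0" using assms by simp
  fix n
  have "inverse (P (a * q ^ n)) = pn a n / P a"
    using qpoch_inf_split[of a n] assms by (auto simp: field_simps)
  then show "norm (inverse (P (a * q ^ n))) \<le> pbound (norm a) / norm (P a)"
    by (simp add: norm_divide divide_right_mono norm_qpoch_le)
qed

section \<open>Theta functions and their quasi-periodicity\<close>

lemma theta_eq: "th x = P x * P (q / x)"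
  by (simp add: theta_def qpochs_inf_def)

lemma theta_inverse:
  assumes "x \<noteq> 0"
  shows "th (1 / x) = - th x / x"
proof -
  have 1: "P (1 / x) = (1 - 1 / x) * P (q / x)" and 2: "P x = (1 - x) * P (q * x)"
    using qpoch_inf_Suc[of x] qpoch_inf_Suc[of "1 / x"] by (simp_all add: mult.commute)
  show ?thesis
    unfolding theta_eq 1 2 using assms by (simp add: field_simps)
qed

lemma theta_flip: "x \<noteq> 0 \<Longrightarrow> y \<noteq> 0 \<Longrightarrow> th (x / y) = - (x / y) * th (y / x)"
  using theta_inverse[of "y / x"] by (simp add: field_simps)

lemma theta_q_mult:
  assumes "x \<noteq> 0"
  shows "th (q * x) = - th x / x"
proof -
  have 1: "P (1 / x) = (1 - 1 / x) * P (q / x)" and 2: "P x = (1 - x) * P (q * x)"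
    using qpoch_inf_Suc[of x] qpoch_inf_Suc[of "1 / x"] by (simp_all add: mult.commute)
  have "q / (q * x) = 1 / x"
    using assms by (simp add: field_simps)
  then show ?thesis
    unfolding theta_eq 2 using assms by (simp add: 1 field_simps)
qed

text \<open>The product of the q^i is q^(k(k-1)/2); as a product it gains one factor per induction
  step. It is later absorbed by the equal product in \<open>lprod_times_qpoch_inf\<close>.\<close>

lemma theta_q_power_mult:
  assumes "x \<noteq> 0"
  shows "th (q ^ k * x) * (\<Prod>i<k. q ^ i) = (- 1 / x) ^ k * th x"
proof (induction k)
  case (Suc k)
  have "th (q ^ Suc k * x) * (\<Prod>i<Suc k. q ^ i) = (th (q * (q ^ k * x)) * q ^ k) * (\<Prod>i<k. q ^ i)"
    by (simp add: mult_ac)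
  also have "th (q * (q ^ k * x)) * q ^ k = (- 1 / x) * th (q ^ k * x)"
    using assms by (subst theta_q_mult) (auto simp: field_simps)
  also have "\<dots> * (\<Prod>i<k. q ^ i) = (- 1 / x) * ((- 1 / x) ^ k * th x)"
    by (simp only: mult.assoc Suc.IH)
  finally show ?case by simp
qed simp

lemma theta_nz_iff: "th x \<noteq> 0 \<longleftrightarrow> P x \<noteq> 0 \<and> P (q / x) \<noteq> 0"
  by (simp add: theta_eq)

end

section \<open>The nonterminating q-Saalschuetz sum and the three-term theta identity\<close>

context qbase
begin

text \<open>Jackson's q-integral of g from 0 to x without the factor 1 - q.\<close>

definition qsum :: "(complex \<Rightarrow> complex) \<Rightarrow> complex \<Rightarrow> complex" where
  "qsum g x = (\<Sum>j. x * q ^ j * g (x * q ^ j))"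

lemma norm_lattice_term_le:
  assumes "norm y \<le> C"
  shows "norm (x * q ^ j * y) \<le> norm x * C * norm q ^ j"
proof -
  have "norm x * norm q ^ j * norm y \<le> norm x * norm q ^ j * C"
    by (intro mult_left_mono assms) auto
  then show ?thesis by (simp add: norm_mult norm_power mult_ac)
qed

lemma summable_qsum:
  assumes "\<And>j. norm (g (x * q ^ j)) \<le> C"
  shows "summable (\<lambda>j. x * q ^ j * g (x * q ^ j))"
proof (rule summable_comparison_test'[OF summable_mult[OF summable_q_power, of "norm x * C"], of 0])
  fix j :: nat
  show "norm (x * q ^ j * g (x * q ^ j)) \<le> norm x * C * norm q ^ j"
    by (rule norm_lattice_term_le[OF assms])
qed

text \<open>Integrand of the nonterminating q-Saalschuetz sum in q-integral form. The argument x1 x2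
  d e f t of the third numerator factor expresses balancing; the first two factors vanish at the
  points x1 q^(-m) and x2 q^(-m), m \<ge> 1, that precede the two lattices.\<close>

definition bint :: "complex \<Rightarrow> complex \<Rightarrow> complex \<Rightarrow> complex \<Rightarrow> complex \<Rightarrow> complex \<Rightarrow> complex" where
  "bint x1 x2 d e f t =
     P (q * t / x1) * P (q * t / x2) * P (x1 * x2 * d * e * f * t) / (P (d * t) * P (e * t) * P (f * t))"

definition qbeta :: "complex \<Rightarrow> complex \<Rightarrow> complex \<Rightarrow> complex \<Rightarrow> complex \<Rightarrow> complex" where
  "qbeta x1 x2 d e f = qsum (bint x1 x2 d e f) x2 - qsum (bint x1 x2 d e f) x1"

lemma bint_swap: "bint x1 x2 d e f = bint x1 x2 e d f" "bint x1 x2 d e f = bint x1 x2 f e d"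
  by (auto simp: bint_def mult_ac)

lemma qbeta_swap: "qbeta x1 x2 d e f = qbeta x1 x2 e d f" "qbeta x1 x2 d e f = qbeta x1 x2 f e d"
  using bint_swap[of x1 x2 d e f] by (simp_all add: qbeta_def)

lemma norm_qpoch_inf_lattice_le: "norm (P (y * (x * q ^ j))) \<le> pbound (norm (y * x))"
proof (rule norm_qpoch_inf_le)
  have "norm (y * x) * norm q ^ j \<le> norm (y * x) * 1"
    by (intro mult_left_mono norm_q_power_le_1) auto
  then show "norm (y * (x * q ^ j)) \<le> norm (y * x)"
    by (simp add: norm_mult norm_power mult_ac)
qed

text \<open>The bound is uniform along d q^n as well, because the limit d q^n -> 0 is later taken
  inside the lattice sum.\<close>

lemma bint_bounded:
  assumes "P (d * x) \<noteq> 0" "P (e * x) \<noteq> 0" "P (f * x) \<noteq> 0"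
  obtains C where "\<And>n j. norm (bint x1 x2 (d * q ^ n) e f (x * q ^ j)) \<le> C"
proof -
  obtain Cd where Cd: "Cd > 0" "\<And>n. norm (inverse (P (d * x * q ^ n))) \<le> Cd"
    using qpoch_inf_inverse_bounded[OF assms(1)] by blast
  obtain Ce where Ce: "Ce > 0" "\<And>n. norm (inverse (P (e * x * q ^ n))) \<le> Ce"
    using qpoch_inf_inverse_bounded[OF assms(2)] by blast
  obtain Cf where Cf: "Cf > 0" "\<And>n. norm (inverse (P (f * x * q ^ n))) \<le> Cf"
    using qpoch_inf_inverse_bounded[OF assms(3)] by blast
  define k1 where "k1 = pbound (norm (q / x1 * x))"
  define k2 where "k2 = pbound (norm (q / x2 * x))"
  define k3 where "k3 = pbound (norm (x1 * x2 * d * e * f * x))"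
  show ?thesis
  proof (rule that)
    fix n j
    let ?t = "x * q ^ j"
    have a1: "norm (P (q * ?t / x1)) \<le> k1"
      using norm_qpoch_inf_lattice_le[of "q / x1" x j] by (simp add: k1_def)
    have a2: "norm (P (q * ?t / x2)) \<le> k2"
      using norm_qpoch_inf_lattice_le[of "q / x2" x j] by (simp add: k2_def)
    have a3: "norm (P (x1 * x2 * (d * q ^ n) * e * f * ?t)) \<le> k3"
      using norm_qpoch_inf_lattice_le[of "x1 * x2 * d * e * f" x "n + j"]
      by (simp add: k3_def power_add mult_ac)
    have b1: "norm (inverse (P (d * q ^ n * ?t))) \<le> Cd"
      using Cd(2)[of "n + j"] by (simp add: power_add mult_ac)
    have b2: "norm (inverse (P (e * ?t))) \<le> Ce"
      using Ce(2)[of j] by (simp add: mult_ac)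
    have b3: "norm (inverse (P (f * ?t))) \<le> Cf"
      using Cf(2)[of j] by (simp add: mult_ac)
    have "norm (bint x1 x2 (d * q ^ n) e f ?t) =
        norm (P (q * ?t / x1)) * norm (P (q * ?t / x2)) * norm (P (x1 * x2 * (d * q ^ n) * e * f * ?t)) *
        norm (inverse (P (d * q ^ n * ?t))) * norm (inverse (P (e * ?t))) * norm (inverse (P (f * ?t)))"
      by (simp add: bint_def divide_inverse norm_mult mult_ac)
    also have "\<dots> \<le> k1 * k2 * k3 * Cd * Ce * Cf"
      using Cd(1) Ce(1) Cf(1)
      by (intro mult_mono a1 a2 a3 b1 b2 b3 mult_nonneg_nonneg norm_ge_zero) (auto simp: k1_def k2_def k3_def)
    finally show "norm (bint x1 x2 (d * q ^ n) e f ?t) \<le> k1 * k2 * k3 * Cd * Ce * Cf" .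
  qed
qed

lemma summable_bint:
  assumes "P (d * x) \<noteq> 0" "P (e * x) \<noteq> 0" "P (f * x) \<noteq> 0"
  shows "summable (\<lambda>j. x * q ^ j * bint x1 x2 d e f (x * q ^ j))"
proof -
  obtain C where "\<And>n j. norm (bint x1 x2 (d * q ^ n) e f (x * q ^ j)) \<le> C"
    using bint_bounded[OF assms] by metis
  from this[of 0] show ?thesis by (intro summable_qsum) auto
qed

text \<open>The factor multiplying \<open>qsum (bint x1 x2 d e f)\<close> and its shift are chosen so that the combined
  summand is a \<open>q\<close>-difference; its boundary value does not depend on the lattice.\<close>

lemma qsum_bint_step:
  assumes x: "x \<in> {x1, x2}" and nz: "x1 \<noteq> 0" "x2 \<noteq> 0"
    and Pnz: "P (d * x) \<noteq> 0" "P (e * x) \<noteq> 0" "P (f * x) \<noteq> 0"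
  shows "(1 - x1 * d) * (1 - x2 * d) * qsum (bint x1 x2 d e f) x -
         (1 - x1 * x2 * d * f) * (1 - x1 * x2 * d * e) * qsum (bint x1 x2 (d * q) e f) x = - (x1 * x2 * d)"
proof -
  define c where "c = x1 * x2 * d * e * f"
  define h where "h t = x1 * x2 * d * (P (t / x1) * P (t / x2) * P (c * t) / (P (d * t) * P (e * t) * P (f * t)))" for t
  let ?A = "(1 - x1 * d) * (1 - x2 * d)" and ?B = "(1 - x1 * x2 * d * f) * (1 - x1 * x2 * d * e)"
  have tele: "?A * (t * bint x1 x2 d e f t) - ?B * (t * bint x1 x2 (d * q) e f t) = h t - h (t * q)"
    if "t = x * q ^ j" for t j
  proof -
    have n: "P (d * t) \<noteq> 0" "P (e * t) \<noteq> 0" "P (f * t) \<noteq> 0"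
      using Pnz[THEN qpoch_inf_shift_nz, of j] by (auto simp: that mult_ac)
    define M where "M = P (q * t / x1) * P (q * t / x2) * P (c * (t * q)) / (P (d * t) * P (e * t) * P (f * t))"
    have e1: "P (t / x1) = (1 - t / x1) * P (q * t / x1)" "P (t / x2) = (1 - t / x2) * P (q * t / x2)"
      "P (c * t) = (1 - c * t) * P (c * (t * q))"
      using qpoch_inf_Suc[of "t / x1"] qpoch_inf_Suc[of "t / x2"] qpoch_inf_Suc[of "c * t"] by (simp_all add: mult_ac)
    have e2: "1 / P (y * (t * q)) = (1 - y * t) / P (y * t)" if "P (y * t) \<noteq> 0" for y
    proof -
      have "P (y * t) = (1 - y * t) * P (y * (t * q))"
        using qpoch_inf_Suc[of "y * t"] by (simp add: mult_ac)
      then show ?thesis using that by simp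
    qed
    have h1: "h t = x1 * x2 * d * ((1 - t / x1) * (1 - t / x2) * (1 - c * t)) * M"
      by (simp add: h_def M_def e1)
    have "h (t * q) = x1 * x2 * d * (P (q * t / x1) * P (q * t / x2) * P (c * (t * q)) *
       (1 / P (d * (t * q))) * (1 / P (e * (t * q))) * (1 / P (f * (t * q))))"
      by (simp add: h_def mult_ac)
    also have "\<dots> = x1 * x2 * d * ((1 - d * t) * (1 - e * t) * (1 - f * t)) * M"
      by (simp only: e2 n M_def not_False_eq_True) (simp add: mult_ac)
    finally have h2: "h (t * q) = x1 * x2 * d * ((1 - d * t) * (1 - e * t) * (1 - f * t)) * M" .
    have b1: "bint x1 x2 d e f t = (1 - c * t) * M"
      using e1(3) by (simp add: bint_def M_def c_def)
    have "bint x1 x2 (d * q) e f t = P (q * t / x1) * P (q * t / x2) * P (c * (t * q)) *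
       (1 / P (d * (t * q))) * (1 / P (e * t)) * (1 / P (f * t))"
      by (simp add: bint_def c_def mult_ac)
    also have "\<dots> = (1 - d * t) * M"
      by (simp only: e2 n M_def not_False_eq_True) (simp add: mult_ac)
    finally have b2: "bint x1 x2 (d * q) e f t = (1 - d * t) * M" .
    \<comment> \<open>On the right the constant terms cancel and, as c = x1 x2 d e f, so do the
      cubic ones. What is left is t times a linear polynomial; its values at t = 1/d and t = 1/c
      determine \<open>?A\<close> and \<open>?B\<close>.\<close>
    have poly: "t * (?A * (1 - c * t) - ?B * (1 - d * t)) =
        x1 * x2 * d * ((1 - t / x1) * (1 - t / x2) * (1 - c * t)) - x1 * x2 * d * ((1 - d * t) * (1 - e * t) * (1 - f * t))"
      using nz unfolding c_def by (simp add: field_simps)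
    have "?A * (t * bint x1 x2 d e f t) - ?B * (t * bint x1 x2 (d * q) e f t) = t * (?A * (1 - c * t) - ?B * (1 - d * t)) * M"
      unfolding b1 b2 by (simp add: algebra_simps)
    then show ?thesis
      unfolding h1 h2 poly by (simp add: algebra_simps)
  qed
  have hlim: "(\<lambda>j. h (x * q ^ j)) \<longlonglongrightarrow> x1 * x2 * d"
  proof -
    have "(\<lambda>j. P (y * (x * q ^ j))) \<longlonglongrightarrow> 1" for y
      using tendsto_qpoch_inf_shift[of "y * x"] by (simp add: mult_ac)
    from this[of "1 / x1"] this[of "1 / x2"] this[of c] this[of d] this[of e] this[of f]
    have "(\<lambda>j. h (x * q ^ j)) \<longlonglongrightarrow> x1 * x2 * d * (1 * 1 * 1 / (1 * 1 * 1))"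
      unfolding h_def by (intro tendsto_intros) auto
    then show ?thesis by simp
  qed
  have dq: "P (d * q * x) \<noteq> 0"
    using Pnz(1)[THEN qpoch_inf_shift_nz, of 1] by (simp add: mult_ac)
  have s1: "(\<lambda>j. x * q ^ j * bint x1 x2 d e f (x * q ^ j)) sums qsum (bint x1 x2 d e f) x"
    unfolding qsum_def by (intro summable_sums summable_bint Pnz)
  have s2: "(\<lambda>j. x * q ^ j * bint x1 x2 (d * q) e f (x * q ^ j)) sums qsum (bint x1 x2 (d * q) e f) x"
    unfolding qsum_def by (intro summable_sums summable_bint Pnz dq)
  have "(\<lambda>j. h (x * q ^ j) - h (x * q ^ Suc j)) sums (h (x * q ^ 0) - x1 * x2 * d)"
    by (rule telescope_sums'[OF hlim])
  \<comment> \<open>At t = x one of the factors P (t/x1), P (t/x2) is P 1 = 0. This is why x must be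
    one of x1, x2.\<close>
  moreover have "h (x * q ^ 0) = 0"
    using x nz by (auto simp: h_def)
  moreover have "h (x * q ^ j) - h (x * q ^ Suc j) =
      ?A * (x * q ^ j * bint x1 x2 d e f (x * q ^ j)) - ?B * (x * q ^ j * bint x1 x2 (d * q) e f (x * q ^ j))" for j
    using tele[of "x * q ^ j" j] by (simp add: mult_ac)
  ultimately have "(\<lambda>j. ?A * (x * q ^ j * bint x1 x2 d e f (x * q ^ j)) - ?B * (x * q ^ j * bint x1 x2 (d * q) e f (x * q ^ j)))
      sums (- (x1 * x2 * d))" by simp
  moreover have "(\<lambda>j. ?A * (x * q ^ j * bint x1 x2 d e f (x * q ^ j)) - ?B * (x * q ^ j * bint x1 x2 (d * q) e f (x * q ^ j)))
      sums (?A * qsum (bint x1 x2 d e f) x - ?B * qsum (bint x1 x2 (d * q) e f) x)"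
    by (intro sums_diff sums_mult s1 s2)
  ultimately show ?thesis by (rule sums_unique2[symmetric])
qed

text \<open>The inhomogeneous term -(x1 x2 d) is the same on both lattices and drops out of their
  difference, so the recursion d -> d q becomes homogeneous.\<close>

lemma qbeta_iterate:
  assumes nz: "x1 \<noteq> 0" "x2 \<noteq> 0"
    and Pnz: "P (d * x1) \<noteq> 0" "P (e * x1) \<noteq> 0" "P (f * x1) \<noteq> 0" "P (d * x2) \<noteq> 0" "P (e * x2) \<noteq> 0" "P (f * x2) \<noteq> 0"
  shows "pn (x1 * d) n * pn (x2 * d) n * qbeta x1 x2 d e f =
    pn (x1 * x2 * d * f) n * pn (x1 * x2 * d * e) n * qbeta x1 x2 (d * q ^ n) e f"
proof (induction n)
  case (Suc n)
  let ?D = "d * q ^ n"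
  have D: "P (?D * x1) \<noteq> 0" "P (?D * x2) \<noteq> 0"
    using Pnz(1,4)[THEN qpoch_inf_shift_nz, of n] by (auto simp: mult_ac)
  have lin: "A * (u - v) = B * (u' - v')" if "A * u - B * u' = r" "A * v - B * v' = r" for A B u u' v v' r :: complex
    using that by (simp add: algebra_simps)
  have step: "(1 - x1 * ?D) * (1 - x2 * ?D) * qbeta x1 x2 ?D e f =
      (1 - x1 * x2 * ?D * f) * (1 - x1 * x2 * ?D * e) * qbeta x1 x2 (?D * q) e f"
    unfolding qbeta_def
    by (rule lin[OF qsum_bint_step[OF _ nz D(2) Pnz(5,6)] qsum_bint_step[OF _ nz D(1) Pnz(2,3)]]) auto
  have "pn (x1 * d) (Suc n) * pn (x2 * d) (Suc n) * qbeta x1 x2 d e f =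
      (pn (x1 * d) n * pn (x2 * d) n * qbeta x1 x2 d e f) * ((1 - x1 * ?D) * (1 - x2 * ?D))"
    by (simp add: qpoch_Suc mult_ac)
  also have "\<dots> = pn (x1 * x2 * d * f) n * pn (x1 * x2 * d * e) n * ((1 - x1 * ?D) * (1 - x2 * ?D) * qbeta x1 x2 ?D e f)"
    unfolding Suc.IH by (simp add: mult_ac)
  also have "\<dots> = pn (x1 * x2 * d * f) (Suc n) * pn (x1 * x2 * d * e) (Suc n) * qbeta x1 x2 (d * q ^ Suc n) e f"
    unfolding step by (simp add: qpoch_Suc mult_ac)
  finally show ?case .
qed simp

lemma qsum_bint_tendsto:
  assumes Pnz: "P (d * x) \<noteq> 0" "P (e * x) \<noteq> 0" "P (f * x) \<noteq> 0"
  shows "(\<lambda>n. qsum (bint x1 x2 (d * q ^ n) e f) x) \<longlonglongrightarrow> qsum (bint x1 x2 0 e f) x"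
proof -
  obtain C where C: "\<And>n j. norm (bint x1 x2 (d * q ^ n) e f (x * q ^ j)) \<le> C"
    using bint_bounded[OF Pnz] by metis
  have lim: "(\<lambda>n. x * q ^ j * bint x1 x2 (d * q ^ n) e f (x * q ^ j)) \<longlonglongrightarrow> x * q ^ j * bint x1 x2 0 e f (x * q ^ j)" for j
  proof -
    have nz: "P (e * (x * q ^ j)) \<noteq> 0" "P (f * (x * q ^ j)) \<noteq> 0"
      using Pnz(2,3)[THEN qpoch_inf_shift_nz, of j] by (auto simp: mult_ac)
    have "(\<lambda>n. d * q ^ n) \<longlonglongrightarrow> 0"
      using tendsto_mult[OF tendsto_const tendsto_q_power, of d] by simp
    then show ?thesis
      unfolding bint_def using nz by (intro tendsto_intros) auto
  qed
  have "\<forall>\<^sub>F (j, n) in sequentially \<times>\<^sub>F sequentially.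
      norm (x * q ^ j * bint x1 x2 (d * q ^ n) e f (x * q ^ j)) \<le> norm x * C * norm q ^ j"
  proof (intro always_eventually allI, clarify)
    fix j n
    show "norm (x * q ^ j * bint x1 x2 (d * q ^ n) e f (x * q ^ j)) \<le> norm x * C * norm q ^ j"
      by (rule norm_lattice_term_le[OF C])
  qed
  from tannerys_theorem[OF lim this summable_mult[OF summable_q_power]]
  show ?thesis unfolding qsum_def by simp
qed

lemma qbeta_remove:
  assumes nz: "x1 \<noteq> 0" "x2 \<noteq> 0"
    and Pnz: "P (d * x1) \<noteq> 0" "P (e * x1) \<noteq> 0" "P (f * x1) \<noteq> 0" "P (d * x2) \<noteq> 0" "P (e * x2) \<noteq> 0" "P (f * x2) \<noteq> 0"
  shows "P (x1 * d) * P (x2 * d) * qbeta x1 x2 d e f =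
    P (x1 * x2 * d * f) * P (x1 * x2 * d * e) * qbeta x1 x2 0 e f"
proof (rule LIMSEQ_unique)
  have "(\<lambda>n. qbeta x1 x2 (d * q ^ n) e f) \<longlonglongrightarrow> qbeta x1 x2 0 e f"
    unfolding qbeta_def by (intro tendsto_diff qsum_bint_tendsto Pnz)
  then show "(\<lambda>n. pn (x1 * d) n * pn (x2 * d) n * qbeta x1 x2 d e f) \<longlonglongrightarrow> P (x1 * x2 * d * f) * P (x1 * x2 * d * e) * qbeta x1 x2 0 e f"
    unfolding qbeta_iterate[OF nz Pnz] by (intro tendsto_intros qpoch_LIMSEQ)
  show "(\<lambda>n. pn (x1 * d) n * pn (x2 * d) n * qbeta x1 x2 d e f) \<longlonglongrightarrow> P (x1 * d) * P (x2 * d) * qbeta x1 x2 d e f"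
    by (intro tendsto_intros qpoch_LIMSEQ)
qed

text \<open>The parameters are sent to 0 one at a time; the symmetry of \<open>bint\<close> brings a
  surviving parameter to the front each time. After the first removal the balancing factor is P 0 =
  1.\<close>

lemma qbeta_reduce:
  assumes nz: "x1 \<noteq> 0" "x2 \<noteq> 0"
    and Pnz: "P (d * x1) \<noteq> 0" "P (e * x1) \<noteq> 0" "P (f * x1) \<noteq> 0" "P (d * x2) \<noteq> 0" "P (e * x2) \<noteq> 0" "P (f * x2) \<noteq> 0"
  shows "P (x1 * d) * P (x2 * d) * P (x1 * e) * P (x2 * e) * P (x1 * f) * P (x2 * f) * qbeta x1 x2 d e f =
    P (x1 * x2 * d * f) * P (x1 * x2 * d * e) * P (x1 * x2 * e * f) * qbeta x1 x2 0 0 0"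
proof -
  have 1: "P (x1 * d) * P (x2 * d) * qbeta x1 x2 d e f =
    P (x1 * x2 * d * f) * P (x1 * x2 * d * e) * qbeta x1 x2 e 0 f"
    using qbeta_remove[OF nz Pnz] by (simp add: qbeta_swap(1)[of x1 x2 e 0 f])
  have 2: "P (x1 * e) * P (x2 * e) * qbeta x1 x2 e 0 f = P (x1 * x2 * e * f) * qbeta x1 x2 f 0 0"
    using qbeta_remove[OF nz, of e 0 f] Pnz by (simp add: qbeta_swap(2)[of x1 x2 f 0 0])
  have 3: "P (x1 * f) * P (x2 * f) * qbeta x1 x2 f 0 0 = qbeta x1 x2 0 0 0"
    using qbeta_remove[OF nz, of f 0 0] Pnz by simp
  have "P (x1 * d) * P (x2 * d) * P (x1 * e) * P (x2 * e) * P (x1 * f) * P (x2 * f) * qbeta x1 x2 d e f =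
     (P (x1 * f) * P (x2 * f)) * ((P (x1 * e) * P (x2 * e)) * (P (x1 * d) * P (x2 * d) * qbeta x1 x2 d e f))"
    by (simp only: mult_ac)
  also have "\<dots> = P (x1 * x2 * d * f) * P (x1 * x2 * d * e) * ((P (x1 * f) * P (x2 * f)) * (P (x1 * e) * P (x2 * e) * qbeta x1 x2 e 0 f))"
    unfolding 1 by (simp only: mult_ac)
  also have "\<dots> = P (x1 * x2 * d * f) * P (x1 * x2 * d * e) * P (x1 * x2 * e * f) * (P (x1 * f) * P (x2 * f) * qbeta x1 x2 f 0 0)"
    unfolding 2 by (simp only: mult_ac)
  finally show ?thesis unfolding 3 .
qed

text \<open>For \<open>d = 0\<close>, \<open>e = q/x\<^sub>2\<close>, \<open>f = q/x\<^sub>1\<close> the summand is constant.\<close>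

lemma qbeta_zero:
  assumes nz: "x1 \<noteq> 0" "x2 \<noteq> 0" and Pnz: "P (q * x1 / x2) \<noteq> 0" "P (q * x2 / x1) \<noteq> 0"
  shows "qbeta x1 x2 0 0 0 = x2 * P q * th (x1 / x2)"
proof -
  let ?e = "q / x2" and ?f = "q / x1"
  have nn: "P (?e * x) \<noteq> 0" "P (?f * x) \<noteq> 0" if "x \<in> {x1, x2}" for x
    using that Pnz nz by auto
  have q2: "P q = (1 - q) * P (q * q)" by (rule qpoch_inf_Suc)
  have q1: "1 - q \<noteq> 0" using one_minus_q_power_nz[of 0] by simp
  have one: "qsum (bint x1 x2 0 ?e ?f) x = x / (1 - q)" if "x \<in> {x1, x2}" for x
  proof -
    have "bint x1 x2 0 ?e ?f (x * q ^ j) = 1" for j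
      using nn[OF that, THEN qpoch_inf_shift_nz, of j] by (simp add: bint_def mult_ac)
    then show ?thesis
      using q_less_1 by (simp add: qsum_def suminf_mult suminf_geometric summable_geometric)
  qed
  have "qbeta x1 x2 0 ?e ?f = (x2 - x1) / (1 - q)"
    by (simp add: qbeta_def one diff_divide_distrib)
  then have "P (q * q) * qbeta x1 x2 0 0 0 = P (q * x1 / x2) * P q * P q * P (q * x2 / x1) * ((x2 - x1) / (1 - q))"
    using qbeta_reduce[OF nz, of 0 ?e ?f] nn[of x1] nn[of x2] nz by (simp add: mult_ac)
  also have "\<dots> = P (q * x1 / x2) * P q * P (q * x2 / x1) * ((x2 - x1) / (1 - q) * P q)"
    by (simp only: mult_ac)
  also have "(x2 - x1) / (1 - q) * P q = (x2 - x1) * P (q * q)"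
    unfolding q2 using q1 by simp
  finally have "qbeta x1 x2 0 0 0 * P (q * q) = (x2 - x1) * P q * P (q * x1 / x2) * P (q * x2 / x1) * P (q * q)"
    by (simp only: mult_ac)
  moreover have "P (q * q) \<noteq> 0" using q2 qpoch_inf_q_nz by auto
  ultimately have "qbeta x1 x2 0 0 0 = (x2 - x1) * P q * P (q * x1 / x2) * P (q * x2 / x1)"
    by simp
  moreover have "th (x1 / x2) = (1 - x1 / x2) * P (q * x1 / x2) * P (q * x2 / x1)"
    using qpoch_inf_Suc[of "x1 / x2"] by (simp add: theta_eq mult_ac)
  moreover have "x2 * (1 - x1 / x2) = x2 - x1" using nz by (simp add: field_simps)
  ultimately show ?thesis by (metis mult.assoc mult.commute)
qed

theorem nonterminating_saalschuetz:
  assumes nz: "x1 \<noteq> 0" "x2 \<noteq> 0" and r: "P (q * x1 / x2) \<noteq> 0" "P (q * x2 / x1) \<noteq> 0"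
    and Pnz: "P (d * x1) \<noteq> 0" "P (e * x1) \<noteq> 0" "P (f * x1) \<noteq> 0" "P (d * x2) \<noteq> 0" "P (e * x2) \<noteq> 0" "P (f * x2) \<noteq> 0"
  shows "P (x1 * d) * P (x2 * d) * P (x1 * e) * P (x2 * e) * P (x1 * f) * P (x2 * f) *
      (qsum (bint x1 x2 d e f) x2 - qsum (bint x1 x2 d e f) x1) =
    x2 * P q * th (x1 / x2) * P (x1 * x2 * d * f) * P (x1 * x2 * d * e) * P (x1 * x2 * e * f)"
  using qbeta_reduce[OF nz Pnz] unfolding qbeta_zero[OF nz r] by (simp add: qbeta_def mult_ac)

text \<open>The three-term theta identity expresses that the integrals of one integrand over the three pairs of
  lattices add up to zero.\<close>

lemma theta_three_term:
  assumes nz: "x1 \<noteq> 0" "x2 \<noteq> 0" "x3 \<noteq> 0" "d \<noteq> 0" "e \<noteq> 0" "f \<noteq> 0"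
    and prod: "x1 * x2 * x3 * d * e * f = q"
    and r: "th (x1 / x2) \<noteq> 0" "th (x2 / x3) \<noteq> 0" "th (x3 / x1) \<noteq> 0"
    and Pnz: "\<And>x y. x \<in> {x1, x2, x3} \<Longrightarrow> y \<in> {d, e, f} \<Longrightarrow> P (y * x) \<noteq> 0"
  shows "x2 * th (x1 / x2) * (th (x3 * d) * th (x3 * e) * th (x3 * f)) +
         x3 * th (x2 / x3) * (th (x1 * d) * th (x1 * e) * th (x1 * f)) +
         x1 * th (x3 / x1) * (th (x2 * d) * th (x2 * e) * th (x2 * f)) = 0"
proof -
  \<comment> \<open>As x1 x2 x3 d e f = q, the balancing factor P (x1 x2 d e f t) is P (q t/x3).
    Hence \<open>g\<close> is the integrand \<open>bint\<close> for each of the three pairs.\<close>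
  define g where "g t = P (q * t / x1) * P (q * t / x2) * P (q * t / x3) / (P (d * t) * P (e * t) * P (f * t))" for t
  define D where "D x = P (x * d) * P (x * e) * P (x * f)" for x
  define T where "T x = th (x * d) * th (x * e) * th (x * f)" for x
  have r': "P (q * y / x) \<noteq> 0 \<and> P (q * x / y) \<noteq> 0" if "th (x / y) \<noteq> 0" "x \<noteq> 0" "y \<noteq> 0" for x y
  proof -
    have "th (y / x) \<noteq> 0" using theta_flip[of x y] that by auto
    then show ?thesis using that(1) unfolding theta_nz_iff by simp
  qed
  have main: "D x * D y * D z * (qsum g y - qsum g x) = P q * (y * th (x / y) * T z)"
    if xyz: "x * y * z = x1 * x2 * x3" "x \<in> {x1, x2, x3}" "y \<in> {x1, x2, x3}" "z \<in> {x1, x2, x3}"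
      and th: "th (x / y) \<noteq> 0" and gz: "\<And>t. P (q * t / x) * P (q * t / y) * P (q * t / z) =
          P (q * t / x1) * P (q * t / x2) * P (q * t / x3)" for x y z
  proof -
    have nn: "x \<noteq> 0" "y \<noteq> 0" "z \<noteq> 0" using xyz nz by auto
    have pr: "x * y * z * d * e * f = q" using prod xyz(1) by metis
    have xy: "x * y * d * e * f = q / z"
      using pr nn by (simp add: field_simps)
    have g: "g = bint x y d e f"
    proof
      fix t
      have "x * y * d * e * f * t = q * t / z" using xy by simp
      then show "g t = bint x y d e f t" by (simp only: g_def bint_def gz[symmetric])
    qed
    have 1: "x * y * d * f = q / (z * e)" "x * y * d * e = q / (z * f)" "x * y * e * f = q / (z * d)"
      using pr nn nz by (simp_all add: field_simps)
    \<comment> \<open>The Saalschuetz products are the factors P (q/(z d)), P (q/(z e)), P (q/(z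
      f)); multiplied by \<open>D z\<close> they complete the three theta functions of
      \<open>T z\<close>.\<close>
    have "D x * D y * (qsum g y - qsum g x) = y * P q * th (x / y) * (P (q / (z * e)) * P (q / (z * f)) * P (q / (z * d)))"
    proof -
      have pz: "P (d * x) \<noteq> 0" "P (e * x) \<noteq> 0" "P (f * x) \<noteq> 0" "P (d * y) \<noteq> 0" "P (e * y) \<noteq> 0" "P (f * y) \<noteq> 0"
        using Pnz xyz(2,3) by auto
      have "D x * D y * (qsum g y - qsum g x) = P (x * d) * P (y * d) * P (x * e) * P (y * e) * P (x * f) * P (y * f) *
          (qsum (bint x y d e f) y - qsum (bint x y d e f) x)"
        by (simp add: D_def g mult_ac)
      also have "\<dots> = y * P q * th (x / y) * P (x * y * d * f) * P (x * y * d * e) * P (x * y * e * f)"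
        using r'[OF th nn(1,2)] by (intro nonterminating_saalschuetz nn pz) auto
      finally show ?thesis unfolding 1 by (simp only: mult_ac)
    qed
    then have "D x * D y * D z * (qsum g y - qsum g x) =
        (y * P q * th (x / y) * (P (q / (z * e)) * P (q / (z * f)) * P (q / (z * d)))) * D z"
      by (simp add: mult_ac)
    then show ?thesis
      by (simp add: D_def T_def theta_eq mult_ac)
  qed
  have "P q * (x2 * th (x1 / x2) * T x3 + x3 * th (x2 / x3) * T x1 + x1 * th (x3 / x1) * T x2) =
      D x1 * D x2 * D x3 * (qsum g x2 - qsum g x1) + D x2 * D x3 * D x1 * (qsum g x3 - qsum g x2) +
      D x3 * D x1 * D x2 * (qsum g x1 - qsum g x3)"
    using main[of x1 x2 x3] main[of x2 x3 x1] main[of x3 x1 x2] r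
    by (simp add: mult_ac distrib_left)
  also have "\<dots> = 0" by (simp add: algebra_simps)
  finally show ?thesis by (simp add: T_def)
qed

end

section \<open>The nonterminating very-well-poised 6-phi-5 sum\<close>

text \<open>Tannery's theorem applied to the partial sums over j, which are dominated in k by
  \<open>suminf A * M k\<close>.\<close>

lemma suminf_swap_dominated:
  fixes U :: "nat \<Rightarrow> nat \<Rightarrow> complex"
  assumes bound: "\<And>j k. norm (U j k) \<le> A j * M k" and A: "summable A" and M: "summable M"
    and A0: "\<And>j. 0 \<le> A j" and M0: "\<And>k. 0 \<le> M k"
  shows "(\<lambda>j. \<Sum>k. U j k) sums (\<Sum>k. \<Sum>j. U j k)"
proof -
  have sk: "summable (\<lambda>k. U j k)" for j
    using bound[of j] by (intro summable_comparison_test'[OF summable_mult[OF M, of "A j"], of 0]) auto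
  have sj: "summable (\<lambda>j. U j k)" for k
    using bound[of _ k] by (intro summable_comparison_test'[OF summable_mult2[OF A, of "M k"], of 0]) auto
  have "\<forall>\<^sub>F (k, N) in sequentially \<times>\<^sub>F sequentially. norm (\<Sum>j<N. U j k) \<le> suminf A * M k"
  proof (intro always_eventually allI, clarify)
    fix k N
    have "norm (\<Sum>j<N. U j k) \<le> (\<Sum>j<N. A j * M k)"
      by (intro sum_norm_le bound)
    also have "\<dots> = (\<Sum>j<N. A j) * M k" by (simp add: sum_distrib_right)
    also have "\<dots> \<le> suminf A * M k"
      by (intro mult_right_mono sum_le_suminf A A0 M0) auto
    finally show "norm (\<Sum>j<N. U j k) \<le> suminf A * M k" .
  qed
  from tannerys_theorem[OF summable_LIMSEQ[OF sj] this summable_mult[OF M]]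
  have "(\<lambda>N. \<Sum>k. \<Sum>j<N. U j k) \<longlonglongrightarrow> (\<Sum>k. \<Sum>j. U j k)" by simp
  moreover have "(\<Sum>k. \<Sum>j<N. U j k) = (\<Sum>j<N. \<Sum>k. U j k)" for N
    by (rule suminf_sum) (rule sk)
  ultimately show ?thesis by (simp add: sums_def)
qed

context qbase
begin

lemma theta_ratio_nz:
  assumes "th (x / y) \<noteq> 0" "x \<noteq> 0" "y \<noteq> 0"
  shows "P (q * y / x) \<noteq> 0" "P (q * x / y) \<noteq> 0"
proof -
  have "th (y / x) \<noteq> 0" using theta_flip[of x y] assms by auto
  then show "P (q * y / x) \<noteq> 0" "P (q * x / y) \<noteq> 0"
    using assms(1) unfolding theta_nz_iff by simp_all
qed

section \<open>The polynomials t^k (1/t;q)_k and their growth\<close>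

text \<open>This is t^k (1/t;q)_k in a form that makes sense at t = 0, the limit point of every
  lattice.\<close>

definition lprod :: "nat \<Rightarrow> complex \<Rightarrow> complex" where
  "lprod k t = (\<Prod>i<k. t - q ^ i)"

lemma lprod_0 [simp]: "lprod 0 t = 1" and lprod_Suc: "lprod (Suc k) t = lprod k t * (t - q ^ k)"
  by (simp_all add: lprod_def)

lemma lprod_q_mult: "lprod (Suc k) (q * t) = q ^ k * (q * t - 1) * lprod k t"
proof (induction k)
  case (Suc k)
  have "lprod (Suc (Suc k)) (q * t) = lprod (Suc k) (q * t) * (q * (t - q ^ k))"
    by (simp add: lprod_Suc[of "Suc k"] algebra_simps)
  then show ?case unfolding Suc.IH by (simp add: lprod_Suc)
qed (simp add: lprod_Suc)

lemma lprod_q_power_eq_0: "j < k \<Longrightarrow> lprod k (q ^ j) = 0"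
  by (auto simp: lprod_def intro!: prod_zero)

text \<open>The polynomial moves the zeros of P (q t) by k lattice steps. This turns the k-th term
  of an expansion in \<open>lprod\<close> into an integrand \<open>bint\<close> with x1 =
  q^k.\<close>

lemma lprod_times_qpoch_inf: "lprod k t * P (q * t) = (- 1) ^ k * (\<Prod>i<k. q ^ i) * P (q * t / q ^ k)"
proof (induction k)
  case (Suc k)
  have "P (q * t / q ^ Suc k) = (1 - t / q ^ k) * P (q * t / q ^ k)"
    using qpoch_inf_Suc[of "t / q ^ k"] by (simp add: mult.commute)
  then have "(- 1) ^ Suc k * (\<Prod>i<Suc k. q ^ i) * P (q * t / q ^ Suc k) =
      (- (q ^ k) * (1 - t / q ^ k)) * ((- 1) ^ k * (\<Prod>i<k. q ^ i) * P (q * t / q ^ k))"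
    by (simp add: mult_ac)
  also have "- (q ^ k) * (1 - t / q ^ k) = t - q ^ k"
    by (simp add: field_simps)
  also have "(t - q ^ k) * ((- 1) ^ k * (\<Prod>i<k. q ^ i) * P (q * t / q ^ k)) = lprod (Suc k) t * P (q * t)"
    unfolding Suc.IH[symmetric] by (simp add: lprod_Suc mult_ac)
  finally show ?case by simp
qed simp

text \<open>With r taken out of each factor the rest is a convergent product. The rate r^k must be
  this sharp, since it competes with |al q/(c d)|^k under the assumption |al q/(c d)| r < 1.\<close>

lemma prod_r_plus_le:
  assumes "r > 0"
  shows "(\<Prod>i<k. r + 2 * norm q ^ i) \<le> r ^ k * pbound (2 / r)"
proof -
  have "(\<Prod>i<k. r + 2 * norm q ^ i) = (\<Prod>i<k. r * (1 + 2 / r * norm q ^ i))"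
    using assms by (intro prod.cong) (auto simp: field_simps)
  also have "\<dots> = r ^ k * (\<Prod>i<k. 1 + 2 / r * norm q ^ i)"
    by (simp add: prod.distrib)
  also have "\<dots> \<le> r ^ k * pbound (2 / r)"
    using assms by (intro mult_left_mono prod_one_plus_le_pbound) auto
  finally show ?thesis .
qed

lemma norm_lprod_le:
  assumes "r > 0" "norm t \<le> r"
  shows "norm (lprod k t) \<le> pbound (2 / r) * r ^ k"
proof -
  have "norm (lprod k t) \<le> (\<Prod>i<k. r + 2 * norm q ^ i)"
    unfolding lprod_def prod_norm[symmetric]
  proof (intro prod_mono conjI norm_ge_zero)
    fix i
    have "norm (t - q ^ i) \<le> norm t + norm (q ^ i)" by (rule norm_triangle_ineq4)
    then show "norm (t - q ^ i) \<le> r + 2 * norm q ^ i"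
      using assms(2) by (simp add: norm_power) (smt (verit) norm_ge_zero zero_le_power)
  qed
  with prod_r_plus_le[OF assms(1)] show ?thesis by (metis mult.commute order_trans)
qed

text \<open>On the lattice q^n every rate r > 0 is possible: the value is 0 for n < k, and otherwise
  each factor is at most 2 |q|^i.\<close>

lemma norm_lprod_q_power_le:
  assumes "r > 0"
  shows "norm (lprod k (q ^ n)) \<le> pbound (2 / r) * r ^ k"
proof (cases "n < k")
  case True
  then show ?thesis using assms by (simp add: lprod_q_power_eq_0)
next
  case False
  have "norm (lprod k (q ^ n)) \<le> (\<Prod>i<k. r + 2 * norm q ^ i)"
    unfolding lprod_def prod_norm[symmetric]
  proof (intro prod_mono conjI norm_ge_zero)
    fix i assume "i \<in> {..<k}"
    have "norm (q ^ n - q ^ i) \<le> norm (q ^ n) + norm (q ^ i)" by (rule norm_triangle_ineq4)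
    also have "norm (q ^ n) \<le> norm (q ^ i)"
      using False \<open>i \<in> {..<k}\<close> q_less_1 by (auto simp: norm_power intro!: power_decreasing)
    finally show "norm (q ^ n - q ^ i) \<le> r + 2 * norm q ^ i"
      using assms by (simp add: norm_power)
  qed
  with prod_r_plus_le[OF assms] show ?thesis by (metis mult.commute order_trans)
qed

section \<open>The recursion of the cleared 6W5 series\<close>

definition wp_coeff :: "complex \<Rightarrow> complex \<Rightarrow> complex \<Rightarrow> nat \<Rightarrow> complex" where
  "wp_coeff al c d k = (1 - al * q ^ (2 * k)) * pn al k * pn c k * pn d k *
     P (q * q ^ k) * P (al * q / c * q ^ k) * P (al * q / d * q ^ k)"

text \<open>This is 6W5(al; 1/t, c, d; q, al q t/(c d)) cleared of denominators. The numerator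
  parameter 1/t becomes the variable t of a q-difference equation.\<close>

definition wp_kernel :: "complex \<Rightarrow> complex \<Rightarrow> complex \<Rightarrow> complex \<Rightarrow> complex" where
  "wp_kernel al c d t = (\<Sum>k. wp_coeff al c d k * (al * q / (c * d)) ^ k * lprod k t * P (al * q * t * q ^ k))"

lemma norm_qpoch_inf_shift_le: "norm (P (y * q ^ k)) \<le> pbound (norm y)"
  using norm_qpoch_inf_lattice_le[of y 1 k] by simp

lemma wp_coeff_bounded: obtains C where "C > 0" "\<And>k. norm (wp_coeff al c d k) \<le> C"
proof
  let ?C = "(1 + norm al) * pbound (norm al) * pbound (norm c) * pbound (norm d) * pbound (norm q) * pbound (norm (al * q / c)) * pbound (norm (al * q / d))"
  have n1: "1 + norm al > 0" using norm_ge_zero[of al] by linarith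
  then show "?C > 0" by (simp add: pbound_pos)
  fix k
  have "norm (1 - al * q ^ (2 * k)) \<le> 1 + norm al"
  proof -
    have "norm (1 - al * q ^ (2 * k)) \<le> 1 + norm (al * q ^ (2 * k))"
      using norm_triangle_ineq4[of 1 "al * q ^ (2 * k)"] by simp
    also have "norm (al * q ^ (2 * k)) \<le> norm al * 1"
      unfolding norm_mult norm_power by (intro mult_left_mono norm_q_power_le_1) auto
    finally show ?thesis by simp
  qed
  then show "norm (wp_coeff al c d k) \<le> ?C"
    unfolding wp_coeff_def norm_mult[of _ "P _"] norm_mult[of _ "pn _ _"]
    using n1 by (intro mult_mono norm_qpoch_inf_shift_le norm_qpoch_le mult_nonneg_nonneg norm_ge_zero order_refl) auto
qed

text \<open>The growth of \<open>lprod\<close> enters as the hypothesis \<open>B\<close>, because it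
  has two sources: lattices t q^n with |t| \<le> r, and the lattice q^n, where r is
  arbitrary.\<close>

lemma wp_kernel_term_bounded:
  assumes B: "\<And>k n. norm (lprod k (t * q ^ n)) \<le> C * r ^ k" and r: "r > 0" and C: "C \<ge> 0"
  obtains D where "D > 0" "\<And>n k. norm (wp_coeff al c d k * (al * q / (c * d)) ^ k * lprod k (t * q ^ n) * P (al * q * (t * q ^ n) * q ^ k))
      \<le> D * (norm (al * q / (c * d)) * r) ^ k"
proof -
  let ?Z = "al * q / (c * d)"
  obtain CV where CV: "CV > 0" "\<And>k. norm (wp_coeff al c d k) \<le> CV" using wp_coeff_bounded by blast
  show ?thesis
  proof (rule that)
    show "CV * (C + 1) * pbound (norm (al * q * t)) > 0" using CV(1) C by simp
    fix n k
    have "norm (wp_coeff al c d k * ?Z ^ k * lprod k (t * q ^ n) * P (al * q * (t * q ^ n) * q ^ k)) \<le>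
       CV * norm ?Z ^ k * ((C + 1) * r ^ k) * pbound (norm (al * q * t))"
      unfolding norm_mult[of _ "P _"] norm_mult[of _ "lprod _ _"] norm_mult[of "wp_coeff _ _ _ _"] norm_power
    proof (intro mult_mono mult_nonneg_nonneg norm_ge_zero CV order_refl)
      have "C * r ^ k \<le> (C + 1) * r ^ k" using r by (intro mult_right_mono) auto
      then show "norm (lprod k (t * q ^ n)) \<le> (C + 1) * r ^ k" using B[of k n] by linarith
      show "norm (P (al * q * (t * q ^ n) * q ^ k)) \<le> pbound (norm (al * q * t))"
        using norm_qpoch_inf_shift_le[of "al * q * t" "n + k"] by (simp add: power_add mult_ac)
    qed (use CV(1) C r in auto)
    then show "norm (wp_coeff al c d k * ?Z ^ k * lprod k (t * q ^ n) * P (al * q * (t * q ^ n) * q ^ k)) \<le>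
      CV * (C + 1) * pbound (norm (al * q * t)) * (norm ?Z * r) ^ k"
      by (simp add: power_mult_distrib mult_ac)
  qed
qed

lemma summable_wp_kernel:
  assumes B: "\<And>k n. norm (lprod k (t * q ^ n)) \<le> C * r ^ k" and r: "r > 0" and C: "C \<ge> 0"
    and Z: "norm (al * q / (c * d)) * r < 1"
  shows "summable (\<lambda>k. wp_coeff al c d k * (al * q / (c * d)) ^ k * lprod k (t * q ^ n) * P (al * q * (t * q ^ n) * q ^ k))"
proof -
  obtain D where D: "\<And>n k. norm (wp_coeff al c d k * (al * q / (c * d)) ^ k * lprod k (t * q ^ n) * P (al * q * (t * q ^ n) * q ^ k))
      \<le> D * (norm (al * q / (c * d)) * r) ^ k" using wp_kernel_term_bounded[OF B r C] by metis
  show ?thesis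
    by (rule summable_comparison_test'[OF summable_mult[OF summable_geometric], of "norm (al * q / (c * d)) * r" 0 _ D])
       (use D Z r in auto)
qed

text \<open>Replacing \<open>t\<close> by \<open>t q\<close> multiplies the sum by an elementary factor: the combined summand telescopes
  with partial sums \<open>G\<close>. Hence the sum is known up to its value at \<open>t = 0\<close>, which is read off at
  \<open>t = 1\<close>, where only the term \<open>k = 0\<close> survives.\<close>

lemma wp_kernel_step:
  assumes B: "\<And>k n. norm (lprod k (t * q ^ n)) \<le> C * r ^ k" and r: "r > 0" and C: "C \<ge> 0"
    and Z: "norm (al * q / (c * d)) * r < 1" and nz: "c \<noteq> 0" "d \<noteq> 0"
  shows "(1 - al * q / (c * d) * t) * wp_kernel al c d t = (1 - al * q * t / c) * (1 - al * q * t / d) * wp_kernel al c d (t * q)"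
proof -
  let ?Z = "al * q / (c * d)"
  define tau where "tau s k = wp_coeff al c d k * ?Z ^ k * lprod k s * P (al * q * s * q ^ k)" for s k
  define U where "U k = pn al k * pn c k * pn d k * P (q * q ^ k) * P (al * q / c * q ^ k) * P (al * q / d * q ^ k)" for k
  have wp_coeff: "wp_coeff al c d k = (1 - al * q ^ (2 * k)) * U k" for k by (simp add: wp_coeff_def U_def)
  define G where "G m = - t * (U m * (1 - al * q ^ m) * (1 - c * q ^ m) * (1 - d * q ^ m)) * ?Z ^ Suc m * lprod m t *
      P (al * q * t * q ^ Suc m)" for m
  \<comment> \<open>Two ways of writing the same factor of \<open>G m\<close>. The left one is kept
    in \<open>G (Suc m)\<close>, the right one expresses \<open>G m\<close> through
    \<open>U (Suc m)\<close>, so that all terms at index m + 1 share one factor.\<close>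
  have U_Suc: "U m * (1 - al * q ^ m) * (1 - c * q ^ m) * (1 - d * q ^ m) =
     U (Suc m) * (1 - q * q ^ m) * (1 - al * q / c * q ^ m) * (1 - al * q / d * q ^ m)" for m
    using qpoch_inf_Suc[of "q * q ^ m"] qpoch_inf_Suc[of "al * q / c * q ^ m"] qpoch_inf_Suc[of "al * q / d * q ^ m"]
    by (simp add: U_def qpoch_Suc mult_ac)
  let ?D = "\<lambda>k. (1 - ?Z * t) * tau t k - (1 - al * q * t / c) * (1 - al * q * t / d) * tau (t * q) k"
  have D0: "?D 0 = G 0"
  proof -
    have e: "P (al * q * t) = (1 - al * q * t) * P (al * q * t * q)" by (rule qpoch_inf_Suc)
    have poly: "(1 - al) * ((1 - ?Z * t) * (1 - al * q * t) - (1 - al * q * t / c) * (1 - al * q * t / d)) =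
        - t * ((1 - al) * (1 - c) * (1 - d)) * ?Z"
      using nz by (simp add: field_simps)
    have "?D 0 = (1 - al) * ((1 - ?Z * t) * (1 - al * q * t) - (1 - al * q * t / c) * (1 - al * q * t / d)) * (U 0 * P (al * q * t * q))"
      unfolding tau_def wp_coeff by (simp add: e mult.assoc[symmetric]) (simp add: algebra_simps)
    then show ?thesis unfolding poly by (simp add: G_def mult_ac)
  qed
  have DS: "?D (Suc m) = G (Suc m) - G m" for m
  proof -
    define x where "x = q ^ m"
    define B where "B = U (Suc m) * ?Z ^ Suc m * lprod m t * P (al * q * t * (q * (q * x)))"
    have e: "P (al * q * t * (q * x)) = (1 - al * q * t * (q * x)) * P (al * q * t * (q * (q * x)))"
      using qpoch_inf_Suc[of "al * q * t * (q * x)"] by (simp add: mult_ac)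
    have q2: "q ^ (2 * Suc m) = (q * x)\<^sup>2"
      by (simp add: x_def power_mult[symmetric] mult.commute power_mult_distrib flip: power_Suc)
    have t1: "tau t (Suc m) = (1 - al * (q * x)\<^sup>2) * ((t - x) * (1 - al * q * t * (q * x))) * B"
      unfolding tau_def wp_coeff q2 lprod_Suc B_def power_Suc[of q m] x_def[symmetric] e by (simp only: mult_ac)
    have Tq: "lprod (Suc m) (t * q) = x * (q * t - 1) * lprod m t"
      using lprod_q_mult[of m t] by (simp add: mult.commute x_def)
    have t2: "tau (t * q) (Suc m) = (1 - al * (q * x)\<^sup>2) * (x * (q * t - 1)) * B"
      unfolding tau_def wp_coeff q2 Tq B_def power_Suc[of q m] x_def[symmetric] by (simp only: mult_ac)
    have g1: "G (Suc m) = - t * ((1 - al * (q * x)) * (1 - c * (q * x)) * (1 - d * (q * x)) * ?Z * (t - x)) * B"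
      unfolding G_def lprod_Suc B_def power_Suc[of q] x_def[symmetric] power_Suc[of ?Z "Suc m"] by (simp only: mult_ac)
    have g2: "G m = - t * ((1 - q * x) * (1 - al * q / c * x) * (1 - al * q / d * x) * (1 - al * q * t * (q * x))) * B"
      unfolding G_def U_Suc unfolding B_def power_Suc[of q m] x_def[symmetric] e by (simp only: mult_ac)
    have poly: "(1 - ?Z * t) * ((1 - al * (q * x)\<^sup>2) * ((t - x) * (1 - al * q * t * (q * x)))) -
        (1 - al * q * t / c) * (1 - al * q * t / d) * ((1 - al * (q * x)\<^sup>2) * (x * (q * t - 1))) =
        - t * ((1 - al * (q * x)) * (1 - c * (q * x)) * (1 - d * (q * x)) * ?Z * (t - x)) +
        t * ((1 - q * x) * (1 - al * q / c * x) * (1 - al * q / d * x) * (1 - al * q * t * (q * x)))"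
      using nz by (simp add: field_simps power2_eq_square)
    have "?D (Suc m) = ((1 - ?Z * t) * ((1 - al * (q * x)\<^sup>2) * ((t - x) * (1 - al * q * t * (q * x)))) -
        (1 - al * q * t / c) * (1 - al * q * t / d) * ((1 - al * (q * x)\<^sup>2) * (x * (q * t - 1)))) * B"
      unfolding t1 t2 by (simp only: left_diff_distrib mult.assoc)
    also have "\<dots> = G (Suc m) - G m"
      unfolding poly g1 g2 by (simp only: distrib_right mult_minus_left mult_minus_right minus_minus diff_conv_add_uminus)
    finally show ?thesis .
  qed
  have part: "(\<Sum>k<Suc n. ?D k) = G n" for n
  proof (induction n)
    case 0 show ?case using D0 by simp
  next
    case (Suc n)
    have "(\<Sum>k<Suc (Suc n). ?D k) = (\<Sum>k<Suc n. ?D k) + ?D (Suc n)" by (rule sum.lessThan_Suc)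
    then show ?case unfolding Suc.IH DS by simp
  qed
  have s1: "tau t sums wp_kernel al c d t"
    using summable_wp_kernel[OF B r C Z, of 0] unfolding wp_kernel_def tau_def by (simp add: summable_sums)
  have s2: "tau (t * q) sums wp_kernel al c d (t * q)"
    using summable_wp_kernel[OF B r C Z, of 1] unfolding wp_kernel_def tau_def by (simp add: summable_sums)
  have sD: "?D sums ((1 - ?Z * t) * wp_kernel al c d t - (1 - al * q * t / c) * (1 - al * q * t / d) * wp_kernel al c d (t * q))"
    by (intro sums_diff sums_mult s1 s2)
  have "G \<longlonglongrightarrow> 0"
  proof (rule tendsto_0_le)
    define M where "M = norm t * (pbound (norm al) * pbound (norm c) * pbound (norm d) * pbound (norm q) * pbound (norm (al * q / c)) * pbound (norm (al * q / d)) *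
       (1 + norm al) * (1 + norm c) * (1 + norm d)) * norm ?Z * C * pbound (norm (al * q * t))"
    have lin: "norm (1 - y * q ^ m) \<le> 1 + norm y" for y m
    proof -
      have "norm (1 - y * q ^ m) \<le> 1 + norm (y * q ^ m)"
        using norm_triangle_ineq4[of 1 "y * q ^ m"] by simp
      also have "norm (y * q ^ m) \<le> norm y * 1"
        unfolding norm_mult norm_power by (intro mult_left_mono norm_q_power_le_1) auto
      finally show ?thesis by simp
    qed
    have "norm (G m) \<le> M * (norm ?Z * r) ^ m" for m
    proof -
      have "norm (G m) \<le> norm t * (pbound (norm al) * pbound (norm c) * pbound (norm d) * pbound (norm q) * pbound (norm (al * q / c)) * pbound (norm (al * q / d)) *
         (1 + norm al) * (1 + norm c) * (1 + norm d)) * norm ?Z ^ Suc m * (C * r ^ m) * pbound (norm (al * q * t))"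
        unfolding G_def U_def norm_mult[of _ "P _"] norm_mult[of _ "pn _ _"] norm_mult[of _ "lprod _ _"] norm_mult[of _ "1 - _"]
          norm_mult[of _ "_ ^ _"] norm_mult[of "- t"] norm_power norm_minus_cancel
        using B[of _ 0] C r
        by (intro mult_mono norm_qpoch_inf_shift_le norm_qpoch_le mult_nonneg_nonneg norm_ge_zero order_refl lin) auto
      then show ?thesis by (simp add: M_def power_mult_distrib mult_ac)
    qed
    then show "\<forall>\<^sub>F m in sequentially. norm (G m) \<le> norm ((norm ?Z * r) ^ m) * M"
      using r by (intro always_eventually allI) (simp add: mult.commute norm_mult power_mult_distrib abs_mult)
    show "(\<lambda>m. (norm ?Z * r) ^ m) \<longlonglongrightarrow> 0"
      using Z r by (intro LIMSEQ_power_zero) auto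
  qed
  then have "(\<lambda>n. \<Sum>k<Suc n. ?D k) \<longlonglongrightarrow> 0" unfolding part .
  moreover have "(\<lambda>n. \<Sum>k<Suc n. ?D k) \<longlonglongrightarrow> (1 - ?Z * t) * wp_kernel al c d t - (1 - al * q * t / c) * (1 - al * q * t / d) * wp_kernel al c d (t * q)"
    using sD unfolding sums_def by (rule LIMSEQ_Suc)
  ultimately show ?thesis
    using LIMSEQ_unique by fastforce
qed

lemma wp_kernel_iterate:
  assumes B: "\<And>k n. norm (lprod k (t * q ^ n)) \<le> C * r ^ k" and r: "r > 0" and C: "C \<ge> 0"
    and Z: "norm (al * q / (c * d)) * r < 1" and nz: "c \<noteq> 0" "d \<noteq> 0"
  shows "pn (al * q / (c * d) * t) n * wp_kernel al c d t = pn (al * q * t / c) n * pn (al * q * t / d) n * wp_kernel al c d (t * q ^ n)"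
proof (induction n)
  case (Suc n)
  have B': "norm (lprod k ((t * q ^ n) * q ^ m)) \<le> C * r ^ k" for k m
    using B[of k "n + m"] by (simp add: power_add mult_ac)
  have step: "(1 - al * q / (c * d) * (t * q ^ n)) * wp_kernel al c d (t * q ^ n) =
      (1 - al * q * (t * q ^ n) / c) * (1 - al * q * (t * q ^ n) / d) * wp_kernel al c d (t * q ^ n * q)"
    by (rule wp_kernel_step[OF B' r C Z nz])
  have "pn (al * q / (c * d) * t) (Suc n) * wp_kernel al c d t =
      (1 - al * q / (c * d) * (t * q ^ n)) * (pn (al * q / (c * d) * t) n * wp_kernel al c d t)"
    by (simp only: qpoch_Suc mult_ac)
  also have "\<dots> = pn (al * q * t / c) n * pn (al * q * t / d) n *
      ((1 - al * q / (c * d) * (t * q ^ n)) * wp_kernel al c d (t * q ^ n))"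
    unfolding Suc.IH by (simp only: mult_ac)
  also have "\<dots> = pn (al * q * t / c) (Suc n) * pn (al * q * t / d) (Suc n) * wp_kernel al c d (t * q ^ Suc n)"
    unfolding step by (simp add: qpoch_Suc mult_ac)
  finally show ?case .
qed simp

lemma wp_kernel_limit:
  assumes B: "\<And>k n. norm (lprod k (t * q ^ n)) \<le> C * r ^ k" and r: "r > 0" and C: "C \<ge> 0"
    and Z: "norm (al * q / (c * d)) * r < 1" and nz: "c \<noteq> 0" "d \<noteq> 0"
  shows "P (al * q / (c * d) * t) * wp_kernel al c d t = P (al * q * t / c) * P (al * q * t / d) * wp_kernel al c d 0"
proof (rule LIMSEQ_unique)
  have tq: "(\<lambda>n. t * q ^ n) \<longlonglongrightarrow> 0"
    using tendsto_mult[OF tendsto_const tendsto_q_power, of t] by simp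
  obtain D where D: "\<And>n k. norm (wp_coeff al c d k * (al * q / (c * d)) ^ k * lprod k (t * q ^ n) * P (al * q * (t * q ^ n) * q ^ k))
      \<le> D * (norm (al * q / (c * d)) * r) ^ k" using wp_kernel_term_bounded[OF B r C] by metis
  have lim: "(\<lambda>n. wp_coeff al c d k * (al * q / (c * d)) ^ k * lprod k (t * q ^ n) * P (al * q * (t * q ^ n) * q ^ k)) \<longlonglongrightarrow>
      wp_coeff al c d k * (al * q / (c * d)) ^ k * lprod k 0 * P (al * q * 0 * q ^ k)" for k
    unfolding lprod_def by (intro tendsto_intros tq)
  have "\<forall>\<^sub>F (k, n) in sequentially \<times>\<^sub>F sequentially.
      norm (wp_coeff al c d k * (al * q / (c * d)) ^ k * lprod k (t * q ^ n) * P (al * q * (t * q ^ n) * q ^ k)) \<le> D * (norm (al * q / (c * d)) * r) ^ k"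
    by (intro always_eventually allI, clarify) (rule D)
  from tannerys_theorem[OF lim this summable_mult[OF summable_geometric]]
  have "(\<lambda>n. wp_kernel al c d (t * q ^ n)) \<longlonglongrightarrow> wp_kernel al c d 0"
    unfolding wp_kernel_def using Z r by simp
  then show "(\<lambda>n. pn (al * q / (c * d) * t) n * wp_kernel al c d t) \<longlonglongrightarrow> P (al * q * t / c) * P (al * q * t / d) * wp_kernel al c d 0"
    unfolding wp_kernel_iterate[OF B r C Z nz] by (intro tendsto_intros qpoch_LIMSEQ)
  show "(\<lambda>n. pn (al * q / (c * d) * t) n * wp_kernel al c d t) \<longlonglongrightarrow> P (al * q / (c * d) * t) * wp_kernel al c d t"
    by (intro tendsto_intros qpoch_LIMSEQ)
qed

lemma wp_kernel_zero:
  assumes nz: "c \<noteq> 0" "d \<noteq> 0" and Pnz: "P (al * q / c) \<noteq> 0" "P (al * q / d) \<noteq> 0"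
  shows "wp_kernel al c d 0 = P q * P al * P (al * q / (c * d))"
proof -
  \<comment> \<open>On the lattice q^n any r > 0 is admissible, so r can be made small enough for
    whatever value |al q/(c d)| has.\<close>
  define r where "r = 1 / (norm (al * q / (c * d)) + 1)"
  have n1: "norm (al * q / (c * d)) + 1 > 0"
    using norm_ge_zero[of "al * q / (c * d)"] by linarith
  have r: "r > 0" "norm (al * q / (c * d)) * r < 1"
    using n1 by (simp_all only: r_def) (simp_all add: divide_simps)
  have "P (al * q / (c * d) * 1) * wp_kernel al c d 1 = P (al * q * 1 / c) * P (al * q * 1 / d) * wp_kernel al c d 0"
    by (rule wp_kernel_limit[OF _ r(1) _ r(2) nz, of _ "pbound (2 / r)"]) (use norm_lprod_q_power_le[OF r(1)] in auto)
  moreover have "wp_kernel al c d 1 = (\<Sum>k\<in>{0}. wp_coeff al c d k * (al * q / (c * d)) ^ k * lprod k 1 * P (al * q * 1 * q ^ k))"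
    unfolding wp_kernel_def using lprod_q_power_eq_0[of 0] by (intro suminf_finite) auto
  then have "wp_kernel al c d 1 = P al * P q * P (al * q / c) * P (al * q / d)"
    using qpoch_inf_Suc[of al] by (simp add: wp_coeff_def)
  ultimately show ?thesis using Pnz by (simp add: mult_ac)
qed

theorem nonterminating_6W5:
  assumes B: "\<And>k n. norm (lprod k (t * q ^ n)) \<le> C * r ^ k" and r: "r > 0" and C: "C \<ge> 0"
    and Z: "norm (al * q / (c * d)) * r < 1" and nz: "c \<noteq> 0" "d \<noteq> 0"
    and Pnz: "P (al * q / c) \<noteq> 0" "P (al * q / d) \<noteq> 0"
  shows "P (al * q / (c * d) * t) * wp_kernel al c d t =
     P (al * q * t / c) * P (al * q * t / d) * (P q * P al * P (al * q / (c * d)))"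
  using wp_kernel_limit[OF B r C Z nz] unfolding wp_kernel_zero[OF nz Pnz] .

end

section \<open>The 8W7 series as a q-integral\<close>

context qbase
begin

text \<open>The quotient of P (al q t/c) P (al q t/d) by P (al q t/(c d)) is the value of a 6W5
  series; the remaining factors are part of a Saalschuetz integrand.\<close>

definition wint :: "complex \<Rightarrow> complex \<Rightarrow> complex \<Rightarrow> complex \<Rightarrow> complex \<Rightarrow> complex \<Rightarrow> complex \<Rightarrow> complex \<Rightarrow> complex" where
  "wint al c d u v w xi t = P (q * t) * P (q * t / xi) * P (al * q * t / c) * P (al * q * t / d) /
     (P (u * t) * P (v * t) * P (w * t) * P (al * q / (c * d) * t))"

text \<open>Term of the double series: t times \<open>wint\<close> at t, with the 6W5 value replaced
  by the k-th term of the series.\<close>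

definition wsum_term :: "complex \<Rightarrow> complex \<Rightarrow> complex \<Rightarrow> complex \<Rightarrow> complex \<Rightarrow> complex \<Rightarrow> complex \<Rightarrow> complex \<Rightarrow> nat \<Rightarrow> complex" where
  "wsum_term al c d u v w xi t k = t * (P (q * t) * P (q * t / xi) / (P (u * t) * P (v * t) * P (w * t))) *
     (wp_coeff al c d k * (al * q / (c * d)) ^ k * lprod k t * P (al * q * t * q ^ k))"

lemma wsum_term_bounded:
  assumes Pnz: "P (u * x) \<noteq> 0" "P (v * x) \<noteq> 0" "P (w * x) \<noteq> 0"
    and B: "\<And>k n. norm (lprod k (x * q ^ n)) \<le> C * r ^ k" and r: "r > 0" and C: "C \<ge> 0"
  obtains D where "D > 0" "\<And>j k. norm (wsum_term al c d u v w xi (x * q ^ j) k) \<le>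
      (D * norm q ^ j) * (norm (al * q / (c * d)) * r) ^ k"
proof -
  obtain Cu where Cu: "Cu > 0" "\<And>n. norm (inverse (P (u * x * q ^ n))) \<le> Cu"
    using qpoch_inf_inverse_bounded[OF Pnz(1)] by blast
  obtain Cv where Cv: "Cv > 0" "\<And>n. norm (inverse (P (v * x * q ^ n))) \<le> Cv"
    using qpoch_inf_inverse_bounded[OF Pnz(2)] by blast
  obtain Cw where Cw: "Cw > 0" "\<And>n. norm (inverse (P (w * x * q ^ n))) \<le> Cw"
    using qpoch_inf_inverse_bounded[OF Pnz(3)] by blast
  obtain D where D: "D > 0" "\<And>n k. norm (wp_coeff al c d k * (al * q / (c * d)) ^ k * lprod k (x * q ^ n) * P (al * q * (x * q ^ n) * q ^ k))
      \<le> D * (norm (al * q / (c * d)) * r) ^ k" using wp_kernel_term_bounded[OF B r C] by metis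
  let ?E = "(norm x + 1) * (pbound (norm (q * x)) * pbound (norm (q / xi * x)) * Cu * Cv * Cw) * D"
  show ?thesis
  proof (rule that)
    have "norm x + 1 > 0" using norm_ge_zero[of x] by linarith
    then show "?E > 0" using Cu Cv Cw D by simp
    fix j k
    let ?t = "x * q ^ j"
    have "norm (wsum_term al c d u v w xi ?t k) = norm ?t * (norm (P (q * ?t)) * norm (P (q / xi * ?t)) *
        norm (inverse (P (u * x * q ^ j))) * norm (inverse (P (v * x * q ^ j))) * norm (inverse (P (w * x * q ^ j)))) *
        norm (wp_coeff al c d k * (al * q / (c * d)) ^ k * lprod k ?t * P (al * q * ?t * q ^ k))"
      by (simp add: wsum_term_def divide_inverse norm_mult mult_ac)
    also have "\<dots> \<le> ((norm x + 1) * norm q ^ j) * (pbound (norm (q * x)) * pbound (norm (q / xi * x)) * Cu * Cv * Cw) *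
        (D * (norm (al * q / (c * d)) * r) ^ k)"
      using Cu(1) Cv(1) Cw(1) r \<open>norm x + 1 > 0\<close>
      by (intro mult_mono norm_qpoch_inf_lattice_le Cu Cv Cw D mult_nonneg_nonneg norm_ge_zero)
         (auto simp: norm_mult norm_power mult_right_mono)
    finally show "norm (wsum_term al c d u v w xi ?t k) \<le> (?E * norm q ^ j) * (norm (al * q / (c * d)) * r) ^ k"
      by (simp only: mult_ac)
  qed
qed

lemma qsum_wint_expand:
  assumes Pnz: "P (u * x) \<noteq> 0" "P (v * x) \<noteq> 0" "P (w * x) \<noteq> 0" "P (al * q / (c * d) * x) \<noteq> 0"
    and B: "\<And>k n. norm (lprod k (x * q ^ n)) \<le> C * r ^ k" and r: "r > 0" and C: "C \<ge> 0"
    and Z: "norm (al * q / (c * d)) * r < 1" and nz: "c \<noteq> 0" "d \<noteq> 0"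
    and Pcd: "P (al * q / c) \<noteq> 0" "P (al * q / d) \<noteq> 0"
  shows "(\<lambda>k. \<Sum>j. wsum_term al c d u v w xi (x * q ^ j) k) sums
     (P q * P al * P (al * q / (c * d)) * qsum (wint al c d u v w xi) x)"
proof -
  let ?U = "\<lambda>j k. wsum_term al c d u v w xi (x * q ^ j) k"
  let ?C0 = "P q * P al * P (al * q / (c * d))"
  obtain D where D: "D > 0" "\<And>j k. norm (?U j k) \<le> (D * norm q ^ j) * (norm (al * q / (c * d)) * r) ^ k"
    using wsum_term_bounded[OF Pnz(1-3) B r C] by metis
  have sA: "summable (\<lambda>j. D * norm q ^ j)" by (intro summable_mult summable_q_power)
  have sM: "summable (\<lambda>k. (norm (al * q / (c * d)) * r) ^ k)"
    using Z r by (intro summable_geometric) auto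
  have nn: "0 \<le> D * norm q ^ j" "0 \<le> (norm (al * q / (c * d)) * r) ^ k" for j k
    using D(1) r by auto
  have 1: "(\<lambda>j. \<Sum>k. ?U j k) sums (\<Sum>k. \<Sum>j. ?U j k)"
    by (rule suminf_swap_dominated[OF D(2) sA sM nn])
  have 2: "(\<lambda>k. \<Sum>j. ?U j k) sums (\<Sum>j. \<Sum>k. ?U j k)"
    by (rule suminf_swap_dominated[OF _ sM sA nn(2,1)]) (use D(2) in \<open>simp add: mult.commute\<close>)
  have row: "(\<Sum>k. ?U j k) = ?C0 * (x * q ^ j * wint al c d u v w xi (x * q ^ j))" for j
  proof -
    let ?t = "x * q ^ j"
    have B': "norm (lprod k (?t * q ^ n)) \<le> C * r ^ k" for k n
      using B[of k "j + n"] by (simp add: power_add mult_ac)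
    have PZ: "P (al * q / (c * d) * ?t) \<noteq> 0"
      using Pnz(4)[THEN qpoch_inf_shift_nz, of j] by (simp add: mult_ac)
    have "(\<Sum>k. ?U j k) = ?t * (P (q * ?t) * P (q * ?t / xi) / (P (u * ?t) * P (v * ?t) * P (w * ?t))) * wp_kernel al c d ?t"
      using summable_wp_kernel[OF B' r C Z, of 0] unfolding wsum_term_def wp_kernel_def by (subst suminf_mult) auto
    also have "wp_kernel al c d ?t = P (al * q * ?t / c) * P (al * q * ?t / d) * ?C0 / P (al * q / (c * d) * ?t)"
      using nonterminating_6W5[OF B' r C Z nz Pcd] PZ by (simp add: field_simps)
    finally show ?thesis by (simp add: wint_def mult_ac)
  qed
  have sw: "summable (\<lambda>j. ?C0 * (x * q ^ j * wint al c d u v w xi (x * q ^ j)))"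
    using 1 unfolding row by (rule sums_summable)
  have "(\<Sum>j. \<Sum>k. ?U j k) = ?C0 * qsum (wint al c d u v w xi) x"
  \<comment> \<open>For \<open>?C0 = 0\<close> the convergence of the sum over \<open>wint\<close>
    cannot be read off from \<open>sw\<close>; both sides are then 0.\<close>
  proof (cases "?C0 = 0")
    case True
    then show ?thesis by (simp only: row mult_zero_left suminf_zero)
  next
    case False
    then have "summable (\<lambda>j. x * q ^ j * wint al c d u v w xi (x * q ^ j))"
      using sw by (simp only: summable_cmult_iff) simp
    then show ?thesis unfolding row qsum_def by (rule suminf_mult)
  qed
  with 2 show ?thesis by simp
qed

text \<open>The condition xi u v w = al q is the balancing condition: it makes P (al q t q^k) the
  third numerator factor of \<open>bint\<close> for x1 = q^k, x2 = xi.\<close>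

lemma wsum_term_eq_bint:
  assumes "xi * u * v * w = al * q"
  shows "wsum_term al c d u v w xi t k =
    wp_coeff al c d k * (al * q / (c * d)) ^ k * ((- 1) ^ k * (\<Prod>i<k. q ^ i)) * (t * bint (q ^ k) xi u v w t)"
proof -
  have arg: "q ^ k * xi * u * v * w * t = al * q * t * q ^ k"
    using arg_cong[OF assms, of "\<lambda>y. q ^ k * y * t"] by (simp add: mult_ac)
  then have bint: "bint (q ^ k) xi u v w t = P (q * t / q ^ k) * P (q * t / xi) * P (al * q * t * q ^ k) / (P (u * t) * P (v * t) * P (w * t))"
    by (simp only: bint_def arg)
  have "wsum_term al c d u v w xi t k = (lprod k t * P (q * t)) * (t * (P (q * t / xi) / (P (u * t) * P (v * t) * P (w * t))) *
     (wp_coeff al c d k * (al * q / (c * d)) ^ k * P (al * q * t * q ^ k)))"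
    by (simp add: wsum_term_def mult_ac)
  then show ?thesis unfolding lprod_times_qpoch_inf bint by (simp add: mult_ac)
qed

text \<open>Each summand of the expansion in \<open>k\<close> is again an integrand of the \<open>q\<close>-Saalschuetz type. On the lattice
  \<open>q\<^sup>j\<close> it vanishes for \<open>j < k\<close>, so that lattice effectively starts at \<open>q\<^sup>k\<close>.\<close>

theorem nonterminating_8W7_qsum:
  assumes nz: "al \<noteq> 0" "c \<noteq> 0" "d \<noteq> 0" "u \<noteq> 0" "v \<noteq> 0" "w \<noteq> 0" "xi \<noteq> 0"
    and xi: "xi * u * v * w = al * q" and th: "th (1 / xi) \<noteq> 0"
    and z: "norm (al * q / (c * d) * xi) < 1"
    and Pnz: "P u \<noteq> 0" "P v \<noteq> 0" "P w \<noteq> 0" "P (u * xi) \<noteq> 0" "P (v * xi) \<noteq> 0" "P (w * xi) \<noteq> 0" "P (al * q / (c * d)) \<noteq> 0"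
    and Pcd: "P (al * q / c) \<noteq> 0" "P (al * q / d) \<noteq> 0"
  shows "xi * th (1 / xi) * (\<Sum>k. wp_coeff al c d k * (pn u k * pn v k * pn w k) *
       (P (al * q / u * q ^ k) * P (al * q / v * q ^ k) * P (al * q / w * q ^ k)) * (al * q / (c * d) * xi) ^ k) =
    P u * P v * P w * P (u * xi) * P (v * xi) * P (w * xi) * P al * P (al * q / (c * d)) *
      (qsum (wint al c d u v w xi) xi - qsum (wint al c d u v w xi) 1)"
proof -
  define r where "r = norm xi"
  let ?Z = "al * q / (c * d)"
  let ?D = "P u * P v * P w * P (u * xi) * P (v * xi) * P (w * xi)"
  let ?S = "\<lambda>k. wp_coeff al c d k * (pn u k * pn v k * pn w k) *
       (P (al * q / u * q ^ k) * P (al * q / v * q ^ k) * P (al * q / w * q ^ k)) * (?Z * xi) ^ k"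
  have r: "r > 0" "norm ?Z * r < 1" using nz z unfolding r_def by (simp, simp only: norm_mult)
  have B1: "norm (lprod k (1 * q ^ n)) \<le> pbound (2 / r) * r ^ k" for k n
    using norm_lprod_q_power_le[OF r(1), of k n] by simp
  have Bxi: "norm (lprod k (xi * q ^ n)) \<le> pbound (2 / r) * r ^ k" for k n
  proof (rule norm_lprod_le[OF r(1)])
    have "norm xi * norm q ^ n \<le> norm xi * 1" by (intro mult_left_mono norm_q_power_le_1) auto
    then show "norm (xi * q ^ n) \<le> r" by (simp add: r_def norm_mult norm_power)
  qed
  have PZ: "P (?Z * xi) \<noteq> 0" by (rule qpoch_inf_small_nz[OF z])
  let ?R = "\<lambda>x k. \<Sum>j. wsum_term al c d u v w xi (x * q ^ j) k"
  let ?C0 = "P q * P al * P ?Z"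
  have s: "(\<lambda>k. ?R xi k - ?R 1 k) sums (?C0 * qsum (wint al c d u v w xi) xi - ?C0 * qsum (wint al c d u v w xi) 1)"
    by (intro sums_diff qsum_wint_expand[where r = r and C = "pbound (2 / r)"]) (use assms Bxi B1 r PZ in auto)
  have key: "?D * (?R xi k - ?R 1 k) = xi * P q * th (1 / xi) * ?S k" for k
  proof -
    let ?c = "wp_coeff al c d k * ?Z ^ k * ((- 1) ^ k * (\<Prod>i<k. q ^ i))"
    have nn: "P (y * q ^ k) \<noteq> 0" if "P y \<noteq> 0" for y using qpoch_inf_shift_nz[OF that] .
    \<comment> \<open>The theta factor of the Saalschuetz sum for the pair q^k, xi meets the power
      q^(k(k-1)/2) from \<open>wsum_term_eq_bint\<close>; together they leave (-xi)^k, which gives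
      the final series its argument al q xi/(c d).\<close>
    have thk: "th (q ^ k / xi) * (\<Prod>i<k. q ^ i) = (- xi) ^ k * th (1 / xi)"
      using theta_q_power_mult[of "1 / xi" k] nz by simp
    have thk_nz: "th (q ^ k / xi) \<noteq> 0"
      using thk th nz by auto
    have Rxi: "?R xi k = ?c * qsum (bint (q ^ k) xi u v w) xi"
      unfolding wsum_term_eq_bint[OF xi] qsum_def
      by (rule suminf_mult) (use Pnz in \<open>auto intro: summable_bint\<close>)
    have sb: "summable (\<lambda>j. q ^ k * q ^ j * bint (q ^ k) xi u v w (q ^ k * q ^ j))"
      using Pnz nn by (intro summable_bint) auto
    have "?R 1 k = (\<Sum>j. wsum_term al c d u v w xi (q ^ (j + k)) k)"
    proof -
      have z: "wsum_term al c d u v w xi (q ^ j) k = 0" if "j < k" for j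
        using lprod_q_power_eq_0[OF that] by (simp add: wsum_term_def)
      have "(\<lambda>j. wsum_term al c d u v w xi (q ^ (j + k)) k) sums (\<Sum>j. wsum_term al c d u v w xi (q ^ (j + k)) k)"
        unfolding wsum_term_eq_bint[OF xi] using summable_mult[OF sb, of ?c]
        by (intro summable_sums) (simp add: power_add mult_ac)
      then have "(\<lambda>j. wsum_term al c d u v w xi (q ^ j) k) sums
          ((\<Sum>j. wsum_term al c d u v w xi (q ^ (j + k)) k) + (\<Sum>j<k. wsum_term al c d u v w xi (q ^ j) k))"
        by (subst (asm) sums_iff_shift) simp
      then show ?thesis by (simp add: sums_iff z)
    qed
    also have "\<dots> = (\<Sum>j. ?c * (q ^ k * q ^ j * bint (q ^ k) xi u v w (q ^ k * q ^ j)))"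
      unfolding wsum_term_eq_bint[OF xi] by (simp add: power_add mult_ac)
    also have "\<dots> = ?c * qsum (bint (q ^ k) xi u v w) (q ^ k)"
      unfolding qsum_def by (rule suminf_mult[OF sb])
    finally have R1: "?R 1 k = ?c * qsum (bint (q ^ k) xi u v w) (q ^ k)" .
    have x3: "q ^ k * xi * u * w = al * q / v * q ^ k" "q ^ k * xi * u * v = al * q / w * q ^ k" "q ^ k * xi * v * w = al * q / u * q ^ k"
      using xi nz by (auto simp: field_simps)
    have saal: "P (q ^ k * u) * P (xi * u) * P (q ^ k * v) * P (xi * v) * P (q ^ k * w) * P (xi * w) *
        (qsum (bint (q ^ k) xi u v w) xi - qsum (bint (q ^ k) xi u v w) (q ^ k)) =
        xi * P q * th (q ^ k / xi) * P (q ^ k * xi * u * w) * P (q ^ k * xi * u * v) * P (q ^ k * xi * v * w)"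
      using Pnz nn theta_ratio_nz[OF thk_nz] nz by (intro nonterminating_saalschuetz) auto
    have sp: "P u = pn u k * P (q ^ k * u)" "P v = pn v k * P (q ^ k * v)" "P w = pn w k * P (q ^ k * w)"
      using qpoch_inf_split[of u k] qpoch_inf_split[of v k] qpoch_inf_split[of w k] by (simp_all add: mult_ac)
    have "?D * (?R xi k - ?R 1 k) = ?c * (pn u k * pn v k * pn w k) *
       (P (q ^ k * u) * P (xi * u) * P (q ^ k * v) * P (xi * v) * P (q ^ k * w) * P (xi * w) *
        (qsum (bint (q ^ k) xi u v w) xi - qsum (bint (q ^ k) xi u v w) (q ^ k)))"
      unfolding Rxi R1 sp right_diff_distrib[symmetric] by (simp only: mult_ac)
    also have "\<dots> = (th (q ^ k / xi) * (\<Prod>i<k. q ^ i)) * (- 1) ^ k * (wp_coeff al c d k * ?Z ^ k * (pn u k * pn v k * pn w k) *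
        (xi * P q * (P (al * q / v * q ^ k) * P (al * q / w * q ^ k) * P (al * q / u * q ^ k))))"
      unfolding saal x3 by (simp only: mult_ac)
    also have "\<dots> = xi * P q * th (1 / xi) * ?S k"
      unfolding thk by (simp add: power_mult_distrib[symmetric] mult_ac)
    finally show ?thesis .
  qed
  have "(\<lambda>k. xi * P q * th (1 / xi) * ?S k) sums (?D * (?C0 * qsum (wint al c d u v w xi) xi - ?C0 * qsum (wint al c d u v w xi) 1))"
    unfolding key[symmetric] by (rule sums_mult[OF s])
  then have s2: "(\<lambda>k. xi * P q * th (1 / xi) * ?S k) sums (?D * ?C0 * (qsum (wint al c d u v w xi) xi - qsum (wint al c d u v w xi) 1))"
    by (simp only: right_diff_distrib mult.assoc)
  have cnz: "xi * P q * th (1 / xi) \<noteq> 0" using th nz by simp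
  then have sS: "summable ?S" using sums_summable[OF s2] by (simp only: summable_cmult_iff) simp
  have "xi * P q * th (1 / xi) * suminf ?S = ?D * ?C0 * (qsum (wint al c d u v w xi) xi - qsum (wint al c d u v w xi) 1)"
    unfolding suminf_mult[OF sS, symmetric] by (rule sums_unique[OF s2, symmetric])
  then have "P q * (xi * th (1 / xi) * suminf ?S) =
      P q * (?D * P al * P ?Z * (qsum (wint al c d u v w xi) xi - qsum (wint al c d u v w xi) 1))"
    by (simp only: mult_ac)
  then show ?thesis
    using mult_left_cancel[OF qpoch_inf_q_nz] by (simp only:)
qed

text \<open>\<open>wp_series a [a, b, c, d, e, f] a z\<close> is \<open>\<^sub>8W\<^sub>7(a; b, c, d, e, f; q, z)\<close> cleared of denominators. The
  six parameters play symmetric roles: replacing the base point \<open>x = a\<close> by \<open>x = d\<close> gives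
  \<open>\<^sub>8W\<^sub>7(d\<^sup>2/a; d, bd/a, cd/a, de/a, df/a; q, z)\<close>.\<close>

definition wp_series :: "complex \<Rightarrow> complex list \<Rightarrow> complex \<Rightarrow> complex \<Rightarrow> complex" where
  "wp_series a ys x z = (\<Sum>k. (1 - x\<^sup>2 * q ^ (2 * k) / a) * (\<Prod>y\<leftarrow>ys. pn (x * y / a) k * P (q * x / y * q ^ k)) * z ^ k)"

text \<open>The integrand \<open>wint\<close> for the base point d after the substitution t -> t/d.
  This scaling makes the symmetry in d, e, f visible, so that one function serves all three base
  points. The factor P (b c t/a) is P (q t/g).\<close>

definition wfun :: "complex \<Rightarrow> complex \<Rightarrow> complex \<Rightarrow> complex \<Rightarrow> complex \<Rightarrow> complex \<Rightarrow> complex \<Rightarrow> complex" where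
  "wfun a b c d e f t = P (q * t / d) * P (q * t / e) * P (q * t / f) * P (b * c * t / a) /
     (P t * P (b * t / a) * P (c * t / a) * P (q * a * t / (d * e * f)))"

lemma summable_wfun:
  assumes Pnz: "P x \<noteq> 0" "P (b * x / a) \<noteq> 0" "P (c * x / a) \<noteq> 0" "P (q * a * x / (d * e * f)) \<noteq> 0"
  shows "summable (\<lambda>j. x * q ^ j * wfun a b c d e f (x * q ^ j))"
proof -
  obtain C1 where C1: "C1 > 0" "\<And>n. norm (inverse (P (x * q ^ n))) \<le> C1"
    using qpoch_inf_inverse_bounded[OF Pnz(1)] by blast
  obtain C2 where C2: "C2 > 0" "\<And>n. norm (inverse (P (b * x / a * q ^ n))) \<le> C2"
    using qpoch_inf_inverse_bounded[OF Pnz(2)] by blast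
  obtain C3 where C3: "C3 > 0" "\<And>n. norm (inverse (P (c * x / a * q ^ n))) \<le> C3"
    using qpoch_inf_inverse_bounded[OF Pnz(3)] by blast
  obtain C4 where C4: "C4 > 0" "\<And>n. norm (inverse (P (q * a * x / (d * e * f) * q ^ n))) \<le> C4"
    using qpoch_inf_inverse_bounded[OF Pnz(4)] by blast
  show ?thesis
  proof (rule summable_qsum)
    fix j
    have "norm (wfun a b c d e f (x * q ^ j)) = norm (P (q * x / d * q ^ j)) * norm (P (q * x / e * q ^ j)) *
        norm (P (q * x / f * q ^ j)) * norm (P (b * c * x / a * q ^ j)) *
        norm (inverse (P (x * q ^ j))) * norm (inverse (P (b * x / a * q ^ j))) *
        norm (inverse (P (c * x / a * q ^ j))) * norm (inverse (P (q * a * x / (d * e * f) * q ^ j)))"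
      by (simp add: wfun_def divide_inverse norm_mult mult_ac)
    also have "\<dots> \<le> pbound (norm (q * x / d)) * pbound (norm (q * x / e)) * pbound (norm (q * x / f)) * pbound (norm (b * c * x / a)) * C1 * C2 * C3 * C4"
      using C1(1) C2(1) C3(1) C4(1)
      by (intro mult_mono norm_qpoch_inf_shift_le C1 C2 C3 C4 mult_nonneg_nonneg norm_ge_zero) auto
    finally show "norm (wfun a b c d e f (x * q ^ j)) \<le>
      pbound (norm (q * x / d)) * pbound (norm (q * x / e)) * pbound (norm (q * x / f)) * pbound (norm (b * c * x / a)) * C1 * C2 * C3 * C4" .
  qed
qed

lemma wp_series_qsum:
  assumes nz: "a \<noteq> 0" "b \<noteq> 0" "c \<noteq> 0" "d \<noteq> 0" "e \<noteq> 0" "f \<noteq> 0"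
    and g: "g = q * a / (b * c)" and z: "z = q\<^sup>2 * a\<^sup>2 / (b * c * d * e * f)"
    and th: "th (d / g) \<noteq> 0" and z1: "norm z < 1"
    and Pnz: "P d \<noteq> 0" "P (b * d / a) \<noteq> 0" "P (c * d / a) \<noteq> 0" "P g \<noteq> 0" "P (q / b) \<noteq> 0" "P (q / c) \<noteq> 0"
      "P (q * a / (e * f)) \<noteq> 0" "P (q * d / e) \<noteq> 0" "P (q * d / f) \<noteq> 0"
  shows "g * th (d / g) * wp_series a [a, b, c, d, e, f] d z =
    P d * P (b * d / a) * P (c * d / a) * P g * P (q / b) * P (q / c) * P (d\<^sup>2 / a) * P (q * a / (e * f)) *
      (qsum (wfun a b c d e f) g - qsum (wfun a b c d e f) d)"
proof -
  \<comment> \<open>The parameters d, b d/a, c d/a, coming from the triple a, b, c, go into the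
    Saalschuetz part, and d e/a, d f/a into the 6W5 part. Balancing then forces xi = al q/(u v w) =
    g/d.\<close>
  let ?al = "d\<^sup>2 / a" and ?u = d and ?v = "b * d / a" and ?w = "c * d / a" and ?c = "d * e / a" and ?d = "d * f / a"
  let ?xi = "g / d"
  have gnz: "g \<noteq> 0" using nz g by simp
  have e: "?al * q / (?c * ?d) = q * a / (e * f)" "?al * q / ?c = q * d / e" "?al * q / ?d = q * d / f"
     "?u * ?xi = g" "?v * ?xi = q / c" "?w * ?xi = q / b" "1 / ?xi = d / g"
     "?al * q / ?u = q * d / a" "?al * q / ?v = q * d / b" "?al * q / ?w = q * d / c"
     "q * a / (e * f) * ?xi = z"
    using nz gnz by (simp_all add: g z field_simps power2_eq_square)
  have xi: "?xi * ?u * ?v * ?w = ?al * q" using nz by (simp add: g field_simps power2_eq_square)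
  have main: "?xi * th (1 / ?xi) * (\<Sum>k. wp_coeff ?al ?c ?d k * (pn ?u k * pn ?v k * pn ?w k) *
       (P (?al * q / ?u * q ^ k) * P (?al * q / ?v * q ^ k) * P (?al * q / ?w * q ^ k)) * (?al * q / (?c * ?d) * ?xi) ^ k) =
    P ?u * P ?v * P ?w * P (?u * ?xi) * P (?v * ?xi) * P (?w * ?xi) * P ?al * P (?al * q / (?c * ?d)) *
      (qsum (wint ?al ?c ?d ?u ?v ?w ?xi) ?xi - qsum (wint ?al ?c ?d ?u ?v ?w ?xi) 1)"
    by (rule nonterminating_8W7_qsum[OF _ _ _ _ _ _ _ xi]) (use nz gnz th z1 Pnz in \<open>simp_all only: e\<close>, use nz gnz in auto)
  have S: "(\<Sum>k. wp_coeff ?al ?c ?d k * (pn ?u k * pn ?v k * pn ?w k) *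
       (P (?al * q / ?u * q ^ k) * P (?al * q / ?v * q ^ k) * P (?al * q / ?w * q ^ k)) * (?al * q / (?c * ?d) * ?xi) ^ k) =
       wp_series a [a, b, c, d, e, f] d z"
    unfolding wp_series_def wp_coeff_def e
    using nz by (intro suminf_cong) (simp add: power2_eq_square mult_ac)
  have w: "wint ?al ?c ?d ?u ?v ?w ?xi (t / d) = wfun a b c d e f t" for t
  proof -
    have e': "?al * q * (t / d) / ?c = q * t / e" "?al * q * (t / d) / ?d = q * t / f"
       "q * (t / d) / ?xi = b * c * t / a" "q * a / (e * f) * (t / d) = q * a * t / (d * e * f)"
       "?u * (t / d) = t" "?v * (t / d) = b * t / a" "?w * (t / d) = c * t / a" "q * (t / d) = q * t / d"
      using nz gnz by (simp_all add: g field_simps power2_eq_square)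
    show ?thesis unfolding wint_def e'(1-3) unfolding e(1) e'(4-8) wfun_def by (simp add: mult_ac)
  qed
  have Q: "qsum (wint ?al ?c ?d ?u ?v ?w ?xi) (x / d) = qsum (wfun a b c d e f) x / d" if "x \<in> {g, d}" for x
  proof -
    have "x / d * q ^ j * wint ?al ?c ?d ?u ?v ?w ?xi (x / d * q ^ j) = (1 / d) * (x * q ^ j * wfun a b c d e f (x * q ^ j))" for j
      using w[of "x * q ^ j"] by simp
    then have "qsum (wint ?al ?c ?d ?u ?v ?w ?xi) (x / d) = (\<Sum>j. (1 / d) * (x * q ^ j * wfun a b c d e f (x * q ^ j)))"
      unfolding qsum_def by (simp only:)
    also have "\<dots> = (1 / d) * qsum (wfun a b c d e f) x"
    proof -
      have "b * g / a = q / c" "c * g / a = q / b" "q * a * g / (d * e * f) = z" "q * a * d / (d * e * f) = q * a / (e * f)"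
        using nz by (simp_all add: g z field_simps power2_eq_square)
      then have "summable (\<lambda>j. x * q ^ j * wfun a b c d e f (x * q ^ j))"
        using that Pnz qpoch_inf_small_nz[OF z1] by (intro summable_wfun) auto
      then show ?thesis unfolding qsum_def by (rule suminf_mult)
    qed
    finally show ?thesis by simp
  qed
  have Qg: "qsum (wint ?al ?c ?d ?u ?v ?w ?xi) ?xi = qsum (wfun a b c d e f) g / d"
    by (rule Q) simp
  have Qd: "qsum (wint ?al ?c ?d ?u ?v ?w ?xi) 1 = qsum (wfun a b c d e f) d / d"
    using Q[of d] nz by simp
  have "d * (g / d * th (d / g) * wp_series a [a, b, c, d, e, f] d z) =
     d * (P ?u * P ?v * P ?w * P g * P (q / c) * P (q / b) * P ?al * P (q * a / (e * f)) *
      (qsum (wfun a b c d e f) g / d - qsum (wfun a b c d e f) d / d))"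
    using main unfolding S unfolding Qg Qd unfolding e by simp
  then show ?thesis using nz by (simp add: diff_divide_distrib[symmetric] mult_ac)
qed

end

section \<open>Linear relations between very-well-poised series by partial fractions\<close>

text \<open>The factor w i - w v cancels against the denominator and kills the summand i = v, so the
  node v disappears.\<close>

lemma sum_divided_difference_drop:
  fixes w :: "'i \<Rightarrow> 'a :: field"
  assumes "finite I" "v \<in> I" "inj_on w I"
  shows "(\<Sum>i\<in>I. (w i - w v) * h i / (\<Prod>l\<in>I - {i}. w i - w l)) =
         (\<Sum>i\<in>I - {v}. h i / (\<Prod>l\<in>I - {v} - {i}. w i - w l))"
proof -
  have "(\<Sum>i\<in>I. (w i - w v) * h i / (\<Prod>l\<in>I - {i}. w i - w l)) =
      (\<Sum>i\<in>I - {v}. (w i - w v) * h i / (\<Prod>l\<in>I - {i}. w i - w l))"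
    using assms by (subst sum.remove[of I v]) auto
  also have "\<dots> = (\<Sum>i\<in>I - {v}. h i / (\<Prod>l\<in>I - {v} - {i}. w i - w l))"
  proof (rule sum.cong[OF refl])
    fix i assume i: "i \<in> I - {v}"
    have "(\<Prod>l\<in>I - {i}. w i - w l) = (w i - w v) * (\<Prod>l\<in>I - {i} - {v}. w i - w l)"
      using assms i by (intro prod.remove) auto
    moreover have "I - {i} - {v} = I - {v} - {i}" by blast
    moreover have "w i - w v \<noteq> 0" using assms i by (auto dest: inj_onD)
    ultimately show "(w i - w v) * h i / (\<Prod>l\<in>I - {i}. w i - w l) = h i / (\<Prod>l\<in>I - {v} - {i}. w i - w l)"
      by simp
  qed
  finally show ?thesis .
qed

text \<open>For nodes u, v, the sum times w v - w u is the sum over I - {u} minus the sum over I -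
  {v}. Both are 0 by induction, except for card I = 2, where both are 1.\<close>

lemma sum_divided_difference_one:
  fixes w :: "'i \<Rightarrow> 'a :: field"
  assumes "finite I" "2 \<le> card I" "inj_on w I"
  shows "(\<Sum>i\<in>I. 1 / (\<Prod>l\<in>I - {i}. w i - w l)) = 0"
  using assms
proof (induction "card I" arbitrary: I rule: less_induct)
  case less
  let ?D = "\<lambda>I. \<Sum>i\<in>I. 1 / (\<Prod>l\<in>I - {i}. w i - w l)"
  obtain u v where uv: "u \<in> I" "v \<in> I" "u \<noteq> v"
    using less.prems card_le_Suc0_iff_eq[of I] by fastforce
  have wuv: "w v - w u \<noteq> 0" using uv less.prems by (auto dest: inj_onD)
  have drop: "(\<Sum>i\<in>I. (w i - w x) / (\<Prod>l\<in>I - {i}. w i - w l)) = ?D (I - {x})" if "x \<in> I" for x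
    using sum_divided_difference_drop[of I x w "\<lambda>_. 1"] less.prems that by simp
  have eq: "?D (I - {u}) = ?D (I - {v})"
  proof (cases "card I = 2")
    case True
    then have "I = {u, v}"
      using uv less.prems card_seteq[of I "{u, v}"] by simp
    then have "I - {u} = {v}" "I - {v} = {u}" using uv by auto
    then show ?thesis by simp
  next
    case False
    have "?D (I - {x}) = 0" if "x \<in> I" for x
      using less.prems that False by (intro less.hyps) (auto intro: inj_on_subset simp: card_gt_0_iff)
    then show ?thesis using uv by simp
  qed
  have "(w v - w u) * ?D I = (\<Sum>i\<in>I. (w i - w u) / (\<Prod>l\<in>I - {i}. w i - w l) - (w i - w v) / (\<Prod>l\<in>I - {i}. w i - w l))"
    by (simp add: sum_distrib_left diff_divide_distrib[symmetric])
  also have "\<dots> = 0"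
    using eq by (simp add: sum_subtractf drop uv)
  finally show ?case using wuv by simp
qed

text \<open>Divided differences annihilate polynomials of degree at most card I - 2. Writing one
  factor as B j (w i - w v) + (A j + B j w v) removes it, at the cost of a node in the first
  part.\<close>

lemma sum_divided_difference_zero:
  fixes w :: "'i \<Rightarrow> 'a :: field"
  assumes "finite J" "finite I" "inj_on w I" "card J + 2 \<le> card I"
  shows "(\<Sum>i\<in>I. (\<Prod>j\<in>J. A j + B j * w i) / (\<Prod>l\<in>I - {i}. w i - w l)) = 0"
  using assms
proof (induction J arbitrary: I rule: finite_induct)
  case empty
  then show ?case using sum_divided_difference_one[of I w] by simp
next
  case (insert j J)
  let ?N = "\<lambda>i. \<Prod>j\<in>J. A j + B j * w i" and ?Q = "\<lambda>i. \<Prod>l\<in>I - {i}. w i - w l"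
  have cJ: "card J + 3 \<le> card I" using insert by simp
  then have "I \<noteq> {}" by auto
  then obtain v where v: "v \<in> I" by blast
  have "(\<Sum>i\<in>I. (\<Prod>j\<in>insert j J. A j + B j * w i) / ?Q i) =
      (\<Sum>i\<in>I. B j * ((w i - w v) * ?N i / ?Q i) + (A j + B j * w v) * (?N i / ?Q i))"
    using insert.hyps by (intro sum.cong refl) (simp add: add_divide_distrib[symmetric] algebra_simps)
  also have "\<dots> = B j * (\<Sum>i\<in>I. (w i - w v) * ?N i / ?Q i) + (A j + B j * w v) * (\<Sum>i\<in>I. ?N i / ?Q i)"
    by (simp add: sum.distrib sum_distrib_left)
  also have "(\<Sum>i\<in>I. ?N i / ?Q i) = 0"
    using insert.prems cJ by (intro insert.IH) auto
  also have "(\<Sum>i\<in>I. (w i - w v) * ?N i / ?Q i) = (\<Sum>i\<in>I - {v}. ?N i / (\<Prod>l\<in>I - {v} - {i}. w i - w l))"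
    using insert.prems v by (intro sum_divided_difference_drop) auto
  also have "\<dots> = 0"
    using insert.prems cJ v by (intro insert.IH) (auto intro: inj_on_subset)
  finally show ?case by simp
qed

section \<open>Bounds uniform in the truncation and the summation index\<close>

definition bdd2 :: "(nat \<Rightarrow> nat \<Rightarrow> complex) \<Rightarrow> bool" where
  "bdd2 f \<longleftrightarrow> (\<exists>C. \<forall>m k. norm (f m k) \<le> C)"

lemma bdd2_I: "(\<And>m k. norm (f m k) \<le> C) \<Longrightarrow> bdd2 f"
  by (auto simp: bdd2_def)

lemma bdd2_mult:
  assumes "bdd2 f" "bdd2 g"
  shows "bdd2 (\<lambda>m k. f m k * g m k)"
proof -
  obtain C D where "\<And>m k. norm (f m k) \<le> C" "\<And>m k. norm (g m k) \<le> D"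
    using assms by (auto simp: bdd2_def)
  then have "norm (f m k * g m k) \<le> C * D" for m k
    unfolding norm_mult by (intro mult_mono norm_ge_zero) (auto intro: order_trans[OF norm_ge_zero])
  then show ?thesis by (rule bdd2_I)
qed

lemma bdd2_prod:
  assumes "finite S" "\<And>i. i \<in> S \<Longrightarrow> bdd2 (f i)"
  shows "bdd2 (\<lambda>m k. \<Prod>i\<in>S. f i m k)"
  using assms
proof (induction S rule: finite_induct)
  case empty
  show ?case by (rule bdd2_I[of _ 1]) simp
next
  case (insert x S)
  then show ?case by (simp add: bdd2_mult)
qed

context qbase
begin

lemma bdd2_qpoch: "bdd2 (\<lambda>m k. pn (y * q ^ h m k) (g m k))"
proof (rule bdd2_I)
  fix m k
  show "norm (pn (y * q ^ h m k) (g m k)) \<le> pbound (norm y)"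
    by (intro norm_qpoch_le) (simp add: norm_mult norm_power mult_left_le norm_q_power_le_1)
qed

lemma bdd2_qpoch_inverse: "P y \<noteq> 0 \<Longrightarrow> bdd2 (\<lambda>m k. inverse (pn y (g m k)))"
  by (rule qpoch_inverse_bounded[of y]) (auto intro: bdd2_I)

section \<open>Nodes on reflected lattices\<close>

lemma qpoch_reverse:
  assumes "h \<noteq> 0"
  shows "pn (h / q ^ k) k * (\<Prod>i<k. q ^ Suc i) = (- h) ^ k * pn (q / h) k"
proof (induction k)
  case (Suc k)
  have "pn (h / q ^ Suc k) (Suc k) * (\<Prod>i<Suc k. q ^ Suc i) =
      (q ^ Suc k * (1 - h / q ^ Suc k)) * (pn (h / q ^ k) k * (\<Prod>i<k. q ^ Suc i))"
    by (simp add: qpoch_Suc_shift mult_ac)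
  also have "q ^ Suc k * (1 - h / q ^ Suc k) = - h * (1 - q / h * q ^ k)"
    using assms by (simp add: field_simps)
  finally show ?case unfolding Suc.IH by (simp add: qpoch_Suc mult_ac)
qed simp

lemma qpoch_reverse_add:
  assumes "h \<noteq> 0"
  shows "pn (h / q ^ k) (k + m) = (- h) ^ k * pn (q / h) k * pn h m / (\<Prod>i<k. q ^ Suc i)"
proof -
  have nz: "(\<Prod>i<k. q ^ Suc i) \<noteq> 0" by simp
  have "pn (h / q ^ k) (k + m) = pn (h / q ^ k) k * pn h m"
    by (simp add: qpoch_add)
  also have "pn (h / q ^ k) k = (- h) ^ k * pn (q / h) k / (\<Prod>i<k. q ^ Suc i)"
    using qpoch_reverse[OF assms, of k] nz by (simp add: eq_divide_eq)
  finally show ?thesis by simp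
qed

text \<open>With \<open>x = y u\<close> and \<open>a = y\<^sup>2\<close> the node is \<open>y (u q\<^sup>k + 1/(u q\<^sup>k))\<close>, in which every product
  \<open>(1 - s u) (1 - s / u)\<close> is affine. A relation between very-well-poised series is therefore the limit of the
  vanishing of a divided difference over such nodes.\<close>

definition node :: "complex \<Rightarrow> complex \<Rightarrow> nat \<Rightarrow> complex" where
  "node a x k = x * q ^ k + a / (x * q ^ k)"

lemma node_diff:
  assumes "a \<noteq> 0" "x \<noteq> 0" "y \<noteq> 0"
  shows "node a x k - node a y l = - (a / (y * q ^ l)) * (1 - y / x / q ^ k * q ^ l) * (1 - x * y / a * q ^ k * q ^ l)"
  using assms by (simp add: node_def field_simps)

text \<open>Up to a constant factor the affine function is the difference of
  \<open>node a x k\<close> and the node of y at the negative index -(l + 1): the numerators have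
  their zeros on the lattice of y continued backwards.\<close>

lemma node_linear:
  assumes "a \<noteq> 0" "x \<noteq> 0" "y \<noteq> 0"
  shows "1 + q ^ (2 * Suc l) * a / y\<^sup>2 + (- (q ^ Suc l / y)) * node a x k =
    (1 - q * x / y * q ^ k * q ^ l) * (1 - q * a / (x * y) / q ^ k * q ^ l)"
  using assms by (simp add: node_def field_simps power2_eq_square power_mult)

text \<open>Of the two halves of the theta function, P (y/x) excludes y q^l = x q^k for l \<ge> k,
  and P (q x/y) excludes it for l < k.\<close>

lemma lattice_point_ne:
  assumes nz: "x \<noteq> 0" "y \<noteq> 0" and th: "th (y / x) \<noteq> 0"
  shows "y / x / q ^ k * q ^ l \<noteq> 1"
proof
  assume e: "y / x / q ^ k * q ^ l = 1"
  have p: "P (y / x) \<noteq> 0" "P (q * x / y) \<noteq> 0" using th nz by (auto simp: theta_nz_iff)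
  show False
  proof (cases "k \<le> l")
    case True
    then have "y / x * q ^ (l - k) = 1" using e by (simp add: power_diff field_simps)
    then show False using p(1) qpoch_inf_eq_0_iff by blast
  next
    case False
    then have "k = Suc (k - Suc l) + l" by simp
    then have "q ^ k = q * q ^ (k - Suc l) * q ^ l" by (metis power_Suc power_add)
    then have "q * x / y * q ^ (k - Suc l) = 1" using e nz by (simp add: field_simps)
    then show False using p(2) qpoch_inf_eq_0_iff by blast
  qed
qed

text \<open>By \<open>node_diff\<close> two nodes agree only for equal lattice points or for points
  exchanged by the reflection x -> a/x. \<open>PX\<close> excludes the reflection, \<open>th\<close>
  a common point of two lattices.\<close>

lemma inj_on_node:
  assumes nz: "a \<noteq> 0" "\<And>i. i \<in> S \<Longrightarrow> X i \<noteq> 0"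
    and PX: "\<And>i j. i \<in> S \<Longrightarrow> j \<in> S \<Longrightarrow> P (X i * X j / a) \<noteq> 0"
    and th: "\<And>i j. i \<in> S \<Longrightarrow> j \<in> S \<Longrightarrow> i \<noteq> j \<Longrightarrow> th (X j / X i) \<noteq> 0"
  shows "inj_on (\<lambda>(i, k). node a (X i) k) (S \<times> UNIV)"
proof (rule inj_onI, clarify)
  fix i k j l assume ij: "i \<in> S" "j \<in> S" and e: "node a (X i) k = node a (X j) l"
  have "X i * X j / a * q ^ (k + l) \<noteq> 1" using PX[OF ij] qpoch_inf_eq_0_iff by blast
  then have "X i * X j / a * q ^ k * q ^ l \<noteq> 1" by (simp add: power_add mult_ac)
  then have 1: "X j / X i / q ^ k * q ^ l = 1"
  proof -
    have "- (a / (X j * q ^ l)) * (1 - X j / X i / q ^ k * q ^ l) * (1 - X i * X j / a * q ^ k * q ^ l) = 0"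
      unfolding node_diff[OF nz(1) nz(2)[OF ij(1)] nz(2)[OF ij(2)], symmetric] e by simp
    moreover have "a / (X j * q ^ l) \<noteq> 0" using nz(1) nz(2)[OF ij(2)] by simp
    ultimately have "1 - X j / X i / q ^ k * q ^ l = 0"
      using \<open>X i * X j / a * q ^ k * q ^ l \<noteq> 1\<close> by (simp only: mult_eq_0_iff neg_equal_0_iff_equal) simp
    then show ?thesis by simp
  qed
  then have eq: "i = j" using lattice_point_ne[OF nz(2)[OF ij(1)] nz(2)[OF ij(2)] th] ij by blast
  then have q: "q ^ l = q ^ k" using 1 nz(2)[OF ij(1)] by (simp add: field_simps)
  have aux: "m = n" if "q ^ m = q ^ n" "m \<le> n" for m n
  proof (rule ccontr)
    assume "m \<noteq> n"
    then have "n = m + Suc (n - Suc m)" using that by simp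
    then have "q ^ n = q ^ m * q ^ Suc (n - Suc m)" by (metis power_add)
    then have "1 - q ^ Suc (n - Suc m) = 0" using that(1) by simp
    then show False using one_minus_q_power_nz by blast
  qed
  have "k = l" using aux[OF q[symmetric]] aux[OF q] by linarith
  then show "i = j \<and> k = l" using eq by simp
qed

section \<open>Lagrange terms of the divided difference and their limit\<close>

text \<open>Contribution of the node (i, k) with M + 1 nodes on each lattice, freed from 1/X i and
  from the constant common to all nodes. For M -> \<infinity> it becomes a multiple of
  \<open>wterm\<close>.\<close>

definition lterm :: "complex \<Rightarrow> ('i \<Rightarrow> complex) \<Rightarrow> 'i set \<Rightarrow> ('j \<Rightarrow> complex) \<Rightarrow> 'j set \<Rightarrow> complex \<Rightarrow> 'i \<Rightarrow> nat \<Rightarrow> nat \<Rightarrow> complex" where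
  "lterm a X S Y R z i M k = z ^ k * (1 - (X i)\<^sup>2 / a * q ^ (2 * k)) *
     (\<Prod>j\<in>R. pn (q * X i / Y j * q ^ k) M * (pn (X i * Y j / a) k * pn (q * a / (X i * Y j)) (M - k))) *
     (\<Prod>i'\<in>S. inverse (pn (X i * X i' / a * q ^ k) (Suc M))) *
     (\<Prod>i'\<in>S - {i}. inverse (pn (q * X i / X i') k) * inverse (pn (X i' / X i) (Suc M - k))) *
     inverse (pn q k) * inverse (pn q (M - k))"

text \<open>Reversing the factorials with negative powers of q produces q^(k(k+1)/2) to the power
  card R above and card S below, so these cancel. The remaining k-th powers form (z q)^k, and the
  q^k is used up by the factor a/(x q^k) of the omitted node.\<close>

lemma lagrange_term:
  fixes X :: "'i \<Rightarrow> complex" and Y :: "'j \<Rightarrow> complex"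
  assumes nz: "a \<noteq> 0" "\<And>i. i \<in> S \<Longrightarrow> X i \<noteq> 0" "\<And>j. j \<in> R \<Longrightarrow> Y j \<noteq> 0"
    and fin: "finite S" "finite R" and card: "card R = card S"
    and z: "z * q * (\<Prod>i\<in>S. X i) * (\<Prod>j\<in>R. Y j) = (q * a) ^ card S"
    and PX: "\<And>i j. i \<in> S \<Longrightarrow> j \<in> S \<Longrightarrow> P (X i * X j / a) \<noteq> 0"
    and i: "i \<in> S" and k: "k \<le> M"
  shows "(\<Prod>(j, l)\<in>R \<times> {..<M}. (1 + q ^ (2 * Suc l) * a / (Y j)\<^sup>2) + (- (q ^ Suc l / Y j)) * node a (X i) k) /
     (\<Prod>(i', l)\<in>S \<times> {..<Suc M} - {(i, k)}. node a (X i) k - node a (X i') l) =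
     - a / (\<Prod>i'\<in>S. \<Prod>l<Suc M. - (a / (X i' * q ^ l))) * (lterm a X S Y R z i M k / X i)"
proof -
  define x where "x = X i"
  define E where "E = (\<Prod>i<k. q ^ Suc i)"
  define n where "n = card S"
  define c where "c i' = (\<Prod>l<Suc M. - (a / (X i' * q ^ l)))" for i'
  have E: "E \<noteq> 0" by (simp add: E_def)
  have x: "x \<noteq> 0" using nz i by (simp add: x_def)
  have nS: "n = Suc (card (S - {i}))" unfolding n_def by (rule card.remove[OF fin(1) i])
  let ?f = "\<lambda>i' l. node a x k - node a (X i') l"
  have num: "(\<Prod>(j, l)\<in>R \<times> {..<M}. (1 + q ^ (2 * Suc l) * a / (Y j)\<^sup>2) + (- (q ^ Suc l / Y j)) * node a x k) =
      (\<Prod>j\<in>R. pn (q * x / Y j * q ^ k) M * (pn (x * Y j / a) k * pn (q * a / (x * Y j)) (M - k))) *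
      (\<Prod>j\<in>R. - (q * a / (x * Y j))) ^ k / E ^ n"
  proof -
    have "(\<Prod>(j, l)\<in>R \<times> {..<M}. (1 + q ^ (2 * Suc l) * a / (Y j)\<^sup>2) + (- (q ^ Suc l / Y j)) * node a x k) =
        (\<Prod>j\<in>R. \<Prod>l<M. (1 + q ^ (2 * Suc l) * a / (Y j)\<^sup>2) + (- (q ^ Suc l / Y j)) * node a x k)"
      by (simp add: prod.cartesian_product)
    also have "\<dots> = (\<Prod>j\<in>R. (pn (q * x / Y j * q ^ k) M * (pn (x * Y j / a) k * pn (q * a / (x * Y j)) (M - k))) *
        (- (q * a / (x * Y j))) ^ k / E)"
    proof (rule prod.cong[OF refl])
      fix j assume j: "j \<in> R"
      have hnz: "q * a / (x * Y j) \<noteq> 0" using nz j x by simp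
      have inv: "q / (q * a / (x * Y j)) = x * Y j / a" using nz j x by (simp add: field_simps)
      have "(\<Prod>l<M. (1 + q ^ (2 * Suc l) * a / (Y j)\<^sup>2) + (- (q ^ Suc l / Y j)) * node a x k) =
          pn (q * x / Y j * q ^ k) M * pn (q * a / (x * Y j) / q ^ k) M"
        unfolding node_linear[OF nz(1) x nz(3)[OF j]] prod.distrib qpoch_def ..
      also have "pn (q * a / (x * Y j) / q ^ k) M = (- (q * a / (x * Y j))) ^ k * pn (x * Y j / a) k * pn (q * a / (x * Y j)) (M - k) / E"
        using qpoch_reverse_add[OF hnz, of k "M - k"] k unfolding inv E_def by simp
      finally show "(\<Prod>l<M. (1 + q ^ (2 * Suc l) * a / (Y j)\<^sup>2) + (- (q ^ Suc l / Y j)) * node a x k) =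
          (pn (q * x / Y j * q ^ k) M * (pn (x * Y j / a) k * pn (q * a / (x * Y j)) (M - k))) * (- (q * a / (x * Y j))) ^ k / E"
        by (simp add: mult_ac)
    qed
    finally show ?thesis
      by (simp only: prod_dividef prod.distrib prod_power_distrib prod_constant card n_def)
  qed
  have others: "(\<Prod>i'\<in>S - {i}. \<Prod>l<Suc M. ?f i' l) =
     (\<Prod>i'\<in>S - {i}. c i') * (\<Prod>i'\<in>S - {i}. pn (q * x / X i') k * pn (X i' / x) (Suc M - k)) *
     (\<Prod>i'\<in>S - {i}. pn (x * X i' / a * q ^ k) (Suc M)) * (\<Prod>i'\<in>S - {i}. - (X i' / x)) ^ k / E ^ (n - 1)"
  proof -
    have "(\<Prod>i'\<in>S - {i}. \<Prod>l<Suc M. ?f i' l) = (\<Prod>i'\<in>S - {i}. c i' * (pn (q * x / X i') k * pn (X i' / x) (Suc M - k)) *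
        pn (x * X i' / a * q ^ k) (Suc M) * (- (X i' / x)) ^ k / E)"
    proof (rule prod.cong[OF refl])
      fix i' assume i': "i' \<in> S - {i}"
      then have xi: "X i' \<noteq> 0" using nz by simp
      have hnz: "X i' / x \<noteq> 0" using xi x by simp
      have inv: "q / (X i' / x) = q * x / X i'" by simp
      have "(\<Prod>l<Suc M. ?f i' l) = c i' * pn (X i' / x / q ^ k) (Suc M) * pn (x * X i' / a * q ^ k) (Suc M)"
        unfolding node_diff[OF nz(1) x xi] prod.distrib qpoch_def c_def ..
      also have "pn (X i' / x / q ^ k) (Suc M) = (- (X i' / x)) ^ k * pn (q * x / X i') k * pn (X i' / x) (Suc M - k) / E"
        using qpoch_reverse_add[OF hnz, of k "Suc M - k"] k unfolding inv E_def by simp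
      finally show "(\<Prod>l<Suc M. ?f i' l) = c i' * (pn (q * x / X i') k * pn (X i' / x) (Suc M - k)) *
        pn (x * X i' / a * q ^ k) (Suc M) * (- (X i' / x)) ^ k / E"
        by (simp only: mult_ac times_divide_eq_left times_divide_eq_right)
    qed
    then show ?thesis
      using nS by (simp only: prod_dividef prod.distrib prod_power_distrib prod_constant diff_Suc_1)
  qed
  \<comment> \<open>The product over the own lattice of the node lacks l = k. Completing it there is
    the origin of the very-well-poised factor 1 - x^2 q^(2k)/a.\<close>
  have self: "(\<Prod>l\<in>{..<Suc M} - {k}. ?f i l) * (- (a / (x * q ^ k))) * (1 - x\<^sup>2 / a * q ^ (2 * k)) =
     c i * pn (x * X i / a * q ^ k) (Suc M) * (pn q k * pn q (M - k)) * (- 1) ^ k / E"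
  proof -
    let ?L = "{..<Suc M} - {k}"
    have kL: "finite {..<Suc M}" "k \<in> {..<Suc M}" using k by auto
    have 1: "c i = - (a / (x * q ^ k)) * (\<Prod>l\<in>?L. - (a / (x * q ^ l)))"
      unfolding c_def x_def[symmetric] by (rule prod.remove[OF kL])
    have 2: "pn (x * X i / a * q ^ k) (Suc M) = (1 - x\<^sup>2 / a * q ^ (2 * k)) * (\<Prod>l\<in>?L. 1 - x * X i / a * q ^ k * q ^ l)"
    proof -
      have "x * X i / a * q ^ k * q ^ k = x\<^sup>2 / a * q ^ (2 * k)"
        by (simp add: x_def power2_eq_square mult_2 power_add)
      then show ?thesis unfolding qpoch_def prod.remove[OF kL] by simp
    qed
    have L: "?L = {..<k} \<union> (\<lambda>l. k + Suc l) ` {..<M - k}"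
    proof (intro equalityI subsetI)
      fix l assume l: "l \<in> ?L"
      show "l \<in> {..<k} \<union> (\<lambda>l. k + Suc l) ` {..<M - k}"
      proof (cases "l < k")
        case False
        then have "l = k + Suc (l - Suc k)" "l - Suc k \<in> {..<M - k}" using l by auto
        then show ?thesis by blast
      qed simp
    qed (use k in auto)
    have "(\<Prod>l\<in>?L. 1 - 1 / q ^ k * q ^ l) = (\<Prod>l<k. 1 - 1 / q ^ k * q ^ l) * (\<Prod>l\<in>(\<lambda>l. k + Suc l) ` {..<M - k}. 1 - 1 / q ^ k * q ^ l)"
      unfolding L by (rule prod.union_disjoint) auto
    also have "(\<Prod>l\<in>(\<lambda>l. k + Suc l) ` {..<M - k}. 1 - 1 / q ^ k * q ^ l) = pn q (M - k)"
      unfolding qpoch_def by (subst prod.reindex) (auto simp: inj_on_def power_add)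
    also have "(\<Prod>l<k. 1 - 1 / q ^ k * q ^ l) = (- 1) ^ k * pn q k / E"
      using qpoch_reverse_add[of 1 k 0] unfolding E_def by (simp add: qpoch_def)
    finally have 3: "(\<Prod>l\<in>?L. 1 - 1 / q ^ k * q ^ l) = (- 1) ^ k * pn q k / E * pn q (M - k)" .
    have nd: "?f i l = - (a / (x * q ^ l)) * (1 - 1 / q ^ k * q ^ l) * (1 - x * X i / a * q ^ k * q ^ l)" for l
      using node_diff[OF nz(1) x x, of k l] x by (simp add: x_def)
    have "(\<Prod>l\<in>?L. ?f i l) = (\<Prod>l\<in>?L. - (a / (x * q ^ l))) * (\<Prod>l\<in>?L. 1 - 1 / q ^ k * q ^ l) * (\<Prod>l\<in>?L. 1 - x * X i / a * q ^ k * q ^ l)"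
      by (simp only: nd prod.distrib)
    then show ?thesis unfolding 1 2 3 by (simp only: mult_ac times_divide_eq_left times_divide_eq_right)
  qed
  have I: "S \<times> {..<Suc M} - {(i, k)} = (S - {i}) \<times> {..<Suc M} \<union> {i} \<times> ({..<Suc M} - {k})"
    using i by auto
  have den: "(\<Prod>(i', l)\<in>S \<times> {..<Suc M} - {(i, k)}. ?f i' l) = (\<Prod>i'\<in>S - {i}. \<Prod>l<Suc M. ?f i' l) * (\<Prod>l\<in>{..<Suc M} - {k}. ?f i l)"
    unfolding I using fin by (subst prod.union_disjoint) (auto simp: prod.cartesian_product[symmetric])
  have F1: "1 - x\<^sup>2 / a * q ^ (2 * k) \<noteq> 0"
  proof
    assume "1 - x\<^sup>2 / a * q ^ (2 * k) = 0"
    then have "X i * X i / a * q ^ (2 * k) = 1" by (simp add: x_def power2_eq_square)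
    then show False using PX[OF i i] qpoch_inf_eq_0_iff by blast
  qed
  have aq: "- (a / (x * q ^ k)) \<noteq> 0" using nz x by simp
  have selfE: "(\<Prod>l\<in>{..<Suc M} - {k}. ?f i l) =
     c i * pn (x * X i / a * q ^ k) (Suc M) * (pn q k * pn q (M - k)) * (- 1) ^ k / E / (- (a / (x * q ^ k)) * (1 - x\<^sup>2 / a * q ^ (2 * k)))"
    unfolding self[symmetric] using F1 aq by simp
  \<comment> \<open>The condition on z enters here: it makes the bases of the k-th powers in
    numerator and denominator differ by z q.\<close>
  have base: "(\<Prod>j\<in>R. - (q * a / (x * Y j))) = z * q * ((\<Prod>i'\<in>S - {i}. - (X i' / x)) * (- 1))"
  proof -
    have "(\<Prod>j\<in>R. - (q * a / (x * Y j))) = (\<Prod>j\<in>R. (- 1 / x) * (q * a) / Y j)" by simp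
    also have "\<dots> = (- 1 / x) ^ n * (q * a) ^ n / (\<Prod>j\<in>R. Y j)"
      by (simp only: prod_dividef prod.distrib prod_constant card n_def power_mult_distrib power_divide)
    also have "\<dots> = (- 1 / x) ^ n * (z * q * (\<Prod>i\<in>S. X i))"
    proof -
      have "(\<Prod>j\<in>R. Y j) \<noteq> 0" using nz fin by simp
      then show ?thesis unfolding z[folded n_def, symmetric] by simp
    qed
    also have "(\<Prod>i\<in>S. X i) = x * (\<Prod>i'\<in>S - {i}. X i')" unfolding x_def by (rule prod.remove[OF fin(1) i])
    finally have 1: "(\<Prod>j\<in>R. - (q * a / (x * Y j))) = (- 1 / x) ^ n * (z * q * (x * (\<Prod>i'\<in>S - {i}. X i')))" .
    have "(\<Prod>i'\<in>S - {i}. - (X i' / x)) = (\<Prod>i'\<in>S - {i}. (- 1 / x) * X i')" by simp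
    also have "\<dots> = (- 1 / x) ^ (n - 1) * (\<Prod>i'\<in>S - {i}. X i')"
      using nS by (simp only: prod.distrib prod_constant diff_Suc_1)
    finally have 2: "(\<Prod>i'\<in>S - {i}. - (X i' / x)) = (- 1 / x) ^ (n - 1) * (\<Prod>i'\<in>S - {i}. X i')" .
    have 3: "(- 1 / x) ^ n = (- 1 / x) * (- 1 / x) ^ (n - 1)" using nS by (metis diff_Suc_1 power_Suc)
    show ?thesis unfolding 1 2 3 using x by simp
  qed
  have znz: "(\<Prod>i'\<in>S - {i}. - (X i' / x)) \<noteq> 0" using nz x fin by simp
  define A where "A = (\<Prod>j\<in>R. pn (q * x / Y j * q ^ k) M * (pn (x * Y j / a) k * pn (q * a / (x * Y j)) (M - k)))"
  define B where "B = (\<Prod>i'\<in>S - {i}. pn (q * x / X i') k * pn (X i' / x) (Suc M - k))"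
  define C where "C = (\<Prod>i'\<in>S - {i}. pn (x * X i' / a * q ^ k) (Suc M))"
  define C1 where "C1 = pn (x * X i / a * q ^ k) (Suc M)"
  define G where "G = (\<Prod>i'\<in>S - {i}. - (X i' / x))"
  define c' where "c' = (\<Prod>i'\<in>S - {i}. c i')"
  define Q where "Q = pn q k * pn q (M - k)"
  have Gnz: "G \<noteq> 0" using znz by (simp add: G_def)
  have lt: "lterm a X S Y R z i M k = z ^ k * (1 - x\<^sup>2 / a * q ^ (2 * k)) * A / (C1 * C) / B / Q"
  proof -
    have iC: "(\<Prod>i'\<in>S - {i}. inverse (pn (x * X i' / a * q ^ k) (Suc M))) = inverse C"
      by (simp add: C_def prod_inversef[symmetric] o_def)
    have iB: "(\<Prod>i'\<in>S - {i}. inverse (pn (q * x / X i') k) * inverse (pn (X i' / x) (Suc M - k))) = inverse B"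
      by (simp add: B_def prod_inversef[symmetric] o_def)
    show ?thesis
      unfolding lterm_def x_def[symmetric] prod.remove[OF fin(1) i] iC iB
      by (simp add: A_def C1_def Q_def x_def divide_inverse mult_ac)
  qed
  have cc: "(\<Prod>i'\<in>S. c i') = c i * c'" unfolding c'_def by (rule prod.remove[OF fin(1) i])
  have En: "E ^ n = E ^ (n - 1) * E" using nS by (metis diff_Suc_1 power_Suc2)
  have "(\<Prod>(j, l)\<in>R \<times> {..<M}. (1 + q ^ (2 * Suc l) * a / (Y j)\<^sup>2) + (- (q ^ Suc l / Y j)) * node a x k) /
     (\<Prod>(i', l)\<in>S \<times> {..<Suc M} - {(i, k)}. ?f i' l) =
     (A * (z * q * (G * (- 1))) ^ k / E ^ n) /
     ((c' * B * C * G ^ k / E ^ (n - 1)) * (c i * C1 * Q * (- 1) ^ k / E / (- (a / (x * q ^ k)) * (1 - x\<^sup>2 / a * q ^ (2 * k)))))"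
    unfolding num den others selfE base A_def B_def C_def C1_def G_def c'_def Q_def ..
  also have "\<dots> = ((z * q * (G * (- 1))) ^ k / (G ^ k * (- 1) ^ k)) * (E ^ (n - 1) * E / E ^ n) *
      (A * (- (a / (x * q ^ k)) * (1 - x\<^sup>2 / a * q ^ (2 * k))) / (c' * B * C * (c i * C1 * Q)))"
    by (simp add: mult_ac)
  also have "(z * q * (G * (- 1))) ^ k / (G ^ k * (- 1) ^ k) = z ^ k * q ^ k"
    using Gnz unfolding power_mult_distrib by simp
  also have "E ^ (n - 1) * E / E ^ n = 1" unfolding En using E by simp
  also have "z ^ k * q ^ k * 1 * (A * (- (a / (x * q ^ k)) * (1 - x\<^sup>2 / a * q ^ (2 * k))) / (c' * B * C * (c i * C1 * Q))) =
     - a / (c i * c') * (z ^ k * (1 - x\<^sup>2 / a * q ^ (2 * k)) * A / (C1 * C) / B / Q / x)"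
    by (simp add: mult_ac)
  finally show ?thesis unfolding lt cc[unfolded c_def, folded c_def] x_def[symmetric] c_def[symmetric] cc by simp
qed

text \<open>Summand of a cleared very-well-poised series whose parameters are split into the base
  points in S and the remaining ones in R.\<close>

definition wterm :: "complex \<Rightarrow> ('i \<Rightarrow> complex) \<Rightarrow> 'i set \<Rightarrow> ('j \<Rightarrow> complex) \<Rightarrow> 'j set \<Rightarrow> complex \<Rightarrow> 'i \<Rightarrow> nat \<Rightarrow> complex" where
  "wterm a X S Y R z i k = (1 - (X i)\<^sup>2 * q ^ (2 * k) / a) *
     ((\<Prod>i'\<in>S. pn (X i * X i' / a) k * P (q * X i / X i' * q ^ k)) *
      (\<Prod>j\<in>R. pn (X i * Y j / a) k * P (q * X i / Y j * q ^ k))) * z ^ k"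

lemma lterm_tendsto:
  assumes fin: "finite S" and i: "i \<in> S" and Xi: "X i \<noteq> 0"
    and PX: "\<And>j. j \<in> S \<Longrightarrow> P (X i * X j / a) \<noteq> 0"
    and th: "\<And>j. j \<in> S \<Longrightarrow> i \<noteq> j \<Longrightarrow> th (X j / X i) \<noteq> 0"
  shows "(\<lambda>M. lterm a X S Y R z i M k) \<longlonglongrightarrow>
    (\<Prod>j\<in>R. P (q * a / (X i * Y j))) / ((\<Prod>j\<in>S. P (X i * X j / a)) * (\<Prod>j\<in>S - {i}. th (X j / X i)) * (P q)\<^sup>2) *
      wterm a X S Y R z i k"
proof -
  have sub: "(\<lambda>M. pn y (M - k)) \<longlonglongrightarrow> P y" "(\<lambda>M. pn y (Suc M - k)) \<longlonglongrightarrow> P y" "(\<lambda>M. pn y (Suc M)) \<longlonglongrightarrow> P y" for y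
  proof -
    show "(\<lambda>M. pn y (M - k)) \<longlonglongrightarrow> P y"
      by (rule LIMSEQ_offset[of _ k]) (simp add: qpoch_LIMSEQ)
    show "(\<lambda>M. pn y (Suc M - k)) \<longlonglongrightarrow> P y"
      by (rule LIMSEQ_offset[of _ k]) (use LIMSEQ_Suc[OF qpoch_LIMSEQ[of y]] in \<open>simp add: Suc_diff_le\<close>)
    show "(\<lambda>M. pn y (Suc M)) \<longlonglongrightarrow> P y"
      by (rule LIMSEQ_Suc[OF qpoch_LIMSEQ])
  qed
  have nz1: "P (X i * X j / a * q ^ k) \<noteq> 0" if "j \<in> S" for j
    using PX[OF that] by (rule qpoch_inf_shift_nz)
  have nz2: "P (X j / X i) \<noteq> 0" "P (q * X i / X j) \<noteq> 0" if "j \<in> S - {i}" for j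
    using th[of j] that by (auto simp: theta_nz_iff)
  let ?lim = "z ^ k * (1 - (X i)\<^sup>2 / a * q ^ (2 * k)) *
     (\<Prod>j\<in>R. P (q * X i / Y j * q ^ k) * (pn (X i * Y j / a) k * P (q * a / (X i * Y j)))) *
     (\<Prod>j\<in>S. inverse (P (X i * X j / a * q ^ k))) *
     (\<Prod>j\<in>S - {i}. inverse (pn (q * X i / X j) k) * inverse (P (X j / X i))) *
     inverse (pn q k) * inverse (P q)"
  have "(\<lambda>M. lterm a X S Y R z i M k) \<longlonglongrightarrow> ?lim"
    unfolding lterm_def by (intro tendsto_intros sub qpoch_LIMSEQ) (use nz1 nz2 in auto)
  also have "?lim = (\<Prod>j\<in>R. P (q * a / (X i * Y j))) / ((\<Prod>j\<in>S. P (X i * X j / a)) * (\<Prod>j\<in>S - {i}. th (X j / X i)) * (P q)\<^sup>2) *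
      wterm a X S Y R z i k"
  proof -
    have inv1: "inverse (P (y * q ^ k)) = pn y k / P y" if "P y \<noteq> 0" for y
      using qpoch_inf_split[of y k] that qpoch_nz[OF that, of k] by (simp add: field_simps)
    have inv2: "inverse (pn y k) = P (y * q ^ k) / P y" if "P y \<noteq> 0" for y
      using qpoch_inf_split[of y k] that qpoch_nz[OF that, of k] by (simp add: field_simps)
    have s1: "(\<Prod>j\<in>S. inverse (P (X i * X j / a * q ^ k))) = (\<Prod>j\<in>S. pn (X i * X j / a) k) / (\<Prod>j\<in>S. P (X i * X j / a))"
      unfolding prod_dividef[symmetric] by (intro prod.cong refl inv1 PX)
    have s2: "(\<Prod>j\<in>S - {i}. inverse (pn (q * X i / X j) k) * inverse (P (X j / X i))) =
        (\<Prod>j\<in>S - {i}. P (q * X i / X j * q ^ k)) / (\<Prod>j\<in>S - {i}. th (X j / X i))"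
      unfolding prod_dividef[symmetric]
    proof (intro prod.cong refl)
      fix j assume j: "j \<in> S - {i}"
      show "inverse (pn (q * X i / X j) k) * inverse (P (X j / X i)) = P (q * X i / X j * q ^ k) / th (X j / X i)"
        unfolding inv2[OF nz2(2)[OF j]] by (simp add: theta_eq field_simps)
    qed
    have s3: "inverse (pn q k) = P (q * q ^ k) / P q" by (rule inv2) simp
    have "X i / X i = 1" using Xi by simp
    then have s4: "(\<Prod>j\<in>S. P (q * X i / X j * q ^ k)) = P (q * q ^ k) * (\<Prod>j\<in>S - {i}. P (q * X i / X j * q ^ k))"
      using prod.remove[OF fin i, of "\<lambda>j. P (q * X i / X j * q ^ k)"] Xi by simp
    show ?thesis
      unfolding s1 s2 s3 unfolding wterm_def prod.distrib s4 by (simp add: power2_eq_square divide_inverse mult_ac)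
  qed
  finally show ?thesis .
qed

lemma lterm_bounded:
  assumes fin: "finite S" "finite R"
    and PX: "\<And>j. j \<in> S \<Longrightarrow> P (X i * X j / a) \<noteq> 0"
    and th: "\<And>j. j \<in> S \<Longrightarrow> i \<noteq> j \<Longrightarrow> th (X j / X i) \<noteq> 0"
  obtains C where "\<And>k M. norm (lterm a X S Y R z i M k) \<le> C * norm z ^ k"
proof -
  let ?b = "\<lambda>M k. (1 - (X i)\<^sup>2 / a * q ^ (2 * k)) *
     (\<Prod>j\<in>R. pn (q * X i / Y j * q ^ k) M * (pn (X i * Y j / a) k * pn (q * a / (X i * Y j)) (M - k))) *
     (\<Prod>i'\<in>S. inverse (pn (X i * X i' / a * q ^ k) (Suc M))) *
     (\<Prod>i'\<in>S - {i}. inverse (pn (q * X i / X i') k) * inverse (pn (X i' / X i) (Suc M - k))) *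
     inverse (pn q k) * inverse (pn q (M - k))"
  have b0: "bdd2 (\<lambda>M k. pn y (g M k))" for y g
    using bdd2_qpoch[of y "\<lambda>_ _. 0" g] by simp
  have b1: "bdd2 (\<lambda>M k. 1 - (X i)\<^sup>2 / a * q ^ (2 * k))"
    using bdd2_qpoch[of "(X i)\<^sup>2 / a" "\<lambda>_ k. 2 * k" "\<lambda>_ _. 1"] by (simp add: qpoch_Suc)
  have b2: "bdd2 (\<lambda>M k. inverse (pn (y * q ^ k) (Suc M)))" if "P y \<noteq> 0" for y
  proof -
    have "inverse (pn (y * q ^ k) (Suc M)) = pn y k * inverse (pn y (k + Suc M))" for k M
      using qpoch_nz[OF that, of k] unfolding qpoch_add by simp
    then show ?thesis using bdd2_mult[OF b0 bdd2_qpoch_inverse[OF that]] by simp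
  qed
  have "bdd2 ?b"
    by (intro bdd2_mult bdd2_prod b0 b1 b2 bdd2_qpoch bdd2_qpoch_inverse)
       (use fin PX th in \<open>auto simp: theta_nz_iff\<close>)
  then obtain C where C: "\<And>M k. norm (?b M k) \<le> C" by (auto simp: bdd2_def)
  show ?thesis
  proof (rule that)
    fix k M
    have "norm (lterm a X S Y R z i M k) = norm (z ^ k * ?b M k)" by (simp only: lterm_def mult.assoc)
    also have "\<dots> = norm z ^ k * norm (?b M k)" unfolding norm_mult[of "z ^ k"] norm_power ..
    also have "\<dots> \<le> norm z ^ k * C" by (intro mult_left_mono C) simp
    finally show "norm (lterm a X S Y R z i M k) \<le> C * norm z ^ k" by (simp only: mult.commute)
  qed
qed

theorem wterm_relation:
  fixes X :: "'i \<Rightarrow> complex" and Y :: "'j \<Rightarrow> complex"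
  assumes nz: "a \<noteq> 0" "\<And>i. i \<in> S \<Longrightarrow> X i \<noteq> 0" "\<And>j. j \<in> R \<Longrightarrow> Y j \<noteq> 0"
    and fin: "finite S" "finite R" and card: "card R = card S" "2 \<le> card S"
    and z: "z * q * (\<Prod>i\<in>S. X i) * (\<Prod>j\<in>R. Y j) = (q * a) ^ card S" and z1: "norm z < 1"
    and PX: "\<And>i j. i \<in> S \<Longrightarrow> j \<in> S \<Longrightarrow> P (X i * X j / a) \<noteq> 0"
    and th: "\<And>i j. i \<in> S \<Longrightarrow> j \<in> S \<Longrightarrow> i \<noteq> j \<Longrightarrow> th (X j / X i) \<noteq> 0"
  shows "(\<Sum>i\<in>S. (\<Prod>j\<in>R. P (q * a / (X i * Y j))) /
      (X i * (\<Prod>j\<in>S. P (X i * X j / a)) * (\<Prod>j\<in>S - {i}. th (X j / X i))) * (\<Sum>k. wterm a X S Y R z i k)) = 0"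
proof -
  let ?L = "\<lambda>i k M. lterm a X S Y R z i M k"
  let ?kap = "\<lambda>i. (\<Prod>j\<in>R. P (q * a / (X i * Y j))) / ((\<Prod>j\<in>S. P (X i * X j / a)) * (\<Prod>j\<in>S - {i}. th (X j / X i)) * (P q)\<^sup>2)"
  have fin_zero: "(\<Sum>i\<in>S. (\<Sum>k<Suc M. ?L i k M) / X i) = 0" for M
  proof -
    \<comment> \<open>With n = card S = card R there are n M affine factors and n (M + 1) nodes. The
      gap is n, and it must be at least 2.\<close>
    let ?I = "S \<times> {..<Suc M}" and ?J = "R \<times> {..<M}"
    let ?w = "\<lambda>(i, k). node a (X i) k"
    let ?A = "\<lambda>(j, l). 1 + q ^ (2 * Suc l) * a / (Y j)\<^sup>2" and ?B = "\<lambda>(j, l). - (q ^ Suc l / Y j)"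
    let ?c = "- a / (\<Prod>i'\<in>S. \<Prod>l<Suc M. - (a / (X i' * q ^ l)))"
    have "inj_on ?w ?I"
      by (rule inj_on_subset[OF inj_on_node[OF nz(1,2) PX th]]) auto
    then have "0 = (\<Sum>p\<in>?I. (\<Prod>j\<in>?J. ?A j + ?B j * ?w p) / (\<Prod>l\<in>?I - {p}. ?w p - ?w l))"
      using fin card by (intro sum_divided_difference_zero[symmetric]) (auto simp: card_cartesian_product)
    also have "\<dots> = (\<Sum>(i, k)\<in>?I. ?c * (?L i k M / X i))"
    proof (rule sum.cong[OF refl])
      fix p assume "p \<in> ?I"
      then obtain i k where p: "p = (i, k)" "i \<in> S" "k \<le> M" by (cases p) auto
      show "(\<Prod>j\<in>?J. ?A j + ?B j * ?w p) / (\<Prod>l\<in>?I - {p}. ?w p - ?w l) = (case p of (i, k) \<Rightarrow> ?c * (?L i k M / X i))"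
        using lagrange_term[OF nz fin card(1) z PX p(2,3)] unfolding p(1) by (simp add: case_prod_beta)
    qed
    also have "\<dots> = ?c * (\<Sum>i\<in>S. (\<Sum>k<Suc M. ?L i k M) / X i)"
      by (simp only: sum.cartesian_product[symmetric] sum_distrib_left[symmetric] sum_divide_distrib[symmetric])
    finally show ?thesis using nz fin by auto
  qed
  have lim: "(\<lambda>M. \<Sum>k<Suc M. ?L i k M) \<longlonglongrightarrow> (\<Sum>k. ?kap i * wterm a X S Y R z i k)"
    and sm: "summable (\<lambda>k. ?kap i * wterm a X S Y R z i k)" if i: "i \<in> S" for i
  proof -
    \<comment> \<open>Continuation by 0 turns sums with a moving upper end into full series, to
      which Tannery's theorem applies.\<close>
    let ?t = "\<lambda>k M. if k < Suc M then ?L i k M else 0"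
    obtain C where C: "\<And>k M. norm (?L i k M) \<le> C * norm z ^ k"
      using lterm_bounded[of S R X i a, OF fin PX[OF i] th[OF i]] by blast
    have C0: "0 \<le> C * norm z ^ k" for k
      using norm_ge_zero[of "?L i k 0"] C[of 0 k] by linarith
    have ev: "\<forall>\<^sub>F M in sequentially. ?t k M = ?L i k M" for k
      using eventually_ge_at_top[of k] by eventually_elim auto
    have lt: "(\<lambda>M. ?L i k M) \<longlonglongrightarrow> ?kap i * wterm a X S Y R z i k" for k
      by (rule lterm_tendsto) (use fin i nz PX th in auto)
    have "(\<lambda>M. ?t k M) \<longlonglongrightarrow> ?kap i * wterm a X S Y R z i k" for k
      by (rule iffD2[OF tendsto_cong[OF ev] lt])
    moreover have "\<forall>\<^sub>F (k, M) in sequentially \<times>\<^sub>F sequentially. norm (?t k M) \<le> C * norm z ^ k"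
      using C C0 by (intro always_eventually) auto
    moreover have "summable (\<lambda>k. C * norm z ^ k)"
      using z1 by (intro summable_mult summable_geometric) auto
    ultimately have T: "summable (\<lambda>k. norm (?kap i * wterm a X S Y R z i k)) \<and>
        (\<lambda>M. \<Sum>k. ?t k M) \<longlonglongrightarrow> (\<Sum>k. ?kap i * wterm a X S Y R z i k)"
      using tannerys_theorem[of ?t "\<lambda>k. ?kap i * wterm a X S Y R z i k" sequentially "\<lambda>k. C * norm z ^ k"] by simp
    have "(\<Sum>k. ?t k M) = (\<Sum>k<Suc M. ?L i k M)" for M
      by (subst suminf_finite[of "{..<Suc M}"]) auto
    then show "(\<lambda>M. \<Sum>k<Suc M. ?L i k M) \<longlonglongrightarrow> (\<Sum>k. ?kap i * wterm a X S Y R z i k)"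
      using T by simp
    show "summable (\<lambda>k. ?kap i * wterm a X S Y R z i k)"
      by (rule summable_norm_cancel[OF conjunct1[OF T]])
  qed
  have "(\<lambda>M. \<Sum>i\<in>S. (\<Sum>k<Suc M. ?L i k M) / X i) \<longlonglongrightarrow> (\<Sum>i\<in>S. (\<Sum>k. ?kap i * wterm a X S Y R z i k) / X i)"
    by (intro tendsto_intros lim nz)
  then have zero: "(\<Sum>i\<in>S. (\<Sum>k. ?kap i * wterm a X S Y R z i k) / X i) = 0"
    unfolding fin_zero LIMSEQ_const_iff by (rule sym)
  have pull: "(\<Sum>k. ?kap i * wterm a X S Y R z i k) = ?kap i * (\<Sum>k. wterm a X S Y R z i k)" if "i \<in> S" for i
  \<comment> \<open>A vanishing coefficient says nothing about the convergence of the series itself,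
    but then both sides are 0.\<close>
  proof (cases "?kap i = 0")
    case True
    then show ?thesis by (simp only: mult_zero_left suminf_zero)
  next
    case False
    then have "summable (wterm a X S Y R z i)"
      using sm[OF that] by (simp only: summable_cmult_iff) simp
    then show ?thesis by (rule suminf_mult)
  qed
  have "(\<Sum>i\<in>S. (\<Prod>j\<in>R. P (q * a / (X i * Y j))) /
      (X i * (\<Prod>j\<in>S. P (X i * X j / a)) * (\<Prod>j\<in>S - {i}. th (X j / X i))) * (\<Sum>k. wterm a X S Y R z i k)) =
      (P q)\<^sup>2 * (\<Sum>i\<in>S. (\<Sum>k. ?kap i * wterm a X S Y R z i k) / X i)"
    unfolding sum_distrib_left
  proof (rule sum.cong[OF refl])
    fix i assume i: "i \<in> S"
    show "(\<Prod>j\<in>R. P (q * a / (X i * Y j))) / (X i * (\<Prod>j\<in>S. P (X i * X j / a)) * (\<Prod>j\<in>S - {i}. th (X j / X i))) *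
        (\<Sum>k. wterm a X S Y R z i k) = (P q)\<^sup>2 * ((\<Sum>k. ?kap i * wterm a X S Y R z i k) / X i)"
      unfolding pull[OF i] by simp
  qed
  then show ?thesis unfolding zero by simp
qed

end

section \<open>The three-term formula\<close>

context qbase
begin

lemma theta_nz_inverse: "x \<noteq> 0 \<Longrightarrow> th (1 / x) \<noteq> 0 \<longleftrightarrow> th x \<noteq> 0"
  by (simp add: theta_inverse)

lemma theta_nz_flip: "x \<noteq> 0 \<Longrightarrow> y \<noteq> 0 \<Longrightarrow> th (x / y) \<noteq> 0 \<Longrightarrow> th (y / x) \<noteq> 0"
  using theta_flip[of x y] by auto

text \<open>Including 1/x in \<open>U x\<close> removes the multipliers x1, x2, x3; in this form the
  identity expands the term of x1 in those of x2 and x3.\<close>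

lemma theta_three_term':
  assumes nz: "x1 \<noteq> 0" "x2 \<noteq> 0" "x3 \<noteq> 0" "d \<noteq> 0" "e \<noteq> 0" "f \<noteq> 0"
    and prod: "x1 * x2 * x3 * d * e * f = q"
    and r: "th (x1 / x2) \<noteq> 0" "th (x2 / x3) \<noteq> 0" "th (x3 / x1) \<noteq> 0"
    and Pnz: "\<And>x y. x \<in> {x1, x2, x3} \<Longrightarrow> y \<in> {d, e, f} \<Longrightarrow> P (y * x) \<noteq> 0"
    and U: "\<And>x. U x = th (x * d) * th (x * e) * th (x * f) / x"
  shows "U x1 / (th (x2 / x1) * th (x3 / x1)) =
    U x3 / (th (x2 / x3) * th (x3 / x1)) + U x2 / (th (x3 / x2) * th (x2 / x1))"
proof -
  let ?T = "\<lambda>x. th (x * d) * th (x * e) * th (x * f)"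
  have T: "?T x = x * U x" if "x \<noteq> 0" for x using that by (simp add: U)
  have f12: "th (x1 / x2) = - (x1 / x2) * th (x2 / x1)" and f23: "th (x3 / x2) = - (x3 / x2) * th (x2 / x3)"
    using theta_flip nz by blast+
  have r': "th (x2 / x1) \<noteq> 0" using theta_nz_flip r(1) nz by blast
  have "x2 * th (x1 / x2) * ?T x3 + x3 * th (x2 / x3) * ?T x1 + x1 * th (x3 / x1) * ?T x2 = 0"
    by (rule theta_three_term[OF nz prod r Pnz])
  then have "x1 * x3 * (th (x2 / x3) * U x1 - th (x2 / x1) * U x3) + x1 * x2 * th (x3 / x1) * U x2 = 0"
    unfolding T[OF nz(1)] T[OF nz(2)] T[OF nz(3)] f12 using nz by (simp add: algebra_simps)
  then have "x1 * (x3 * (th (x2 / x3) * U x1 - th (x2 / x1) * U x3) + x2 * th (x3 / x1) * U x2) = 0"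
    by (simp add: algebra_simps)
  then have "x3 * (th (x2 / x3) * U x1 - th (x2 / x1) * U x3) + x2 * th (x3 / x1) * U x2 = 0"
    using nz by simp
  then have "th (x2 / x3) * U x1 = th (x2 / x1) * U x3 - x2 / x3 * th (x3 / x1) * U x2"
    using nz by (simp add: field_simps)
  then have "U x1 = (th (x2 / x1) * U x3 - x2 / x3 * th (x3 / x1) * U x2) / th (x2 / x3)"
    using r(2) by (simp add: field_simps)
  then show ?thesis
    unfolding f23 using nz r r' by (simp add: divide_simps)
qed

text \<open>Three base points and three remaining parameters in \<open>wterm_relation\<close>. When
  one of the six parameters is a, the condition on z says that z is q^2 a^2 divided by the product
  of the other five.\<close>

lemma wp_series_three_term:
  assumes nz: "a \<noteq> 0" "x1 \<noteq> 0" "x2 \<noteq> 0" "x3 \<noteq> 0" "y1 \<noteq> 0" "y2 \<noteq> 0" "y3 \<noteq> 0"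
    and z: "z * q * (x1 * x2 * x3) * (y1 * y2 * y3) = (q * a) ^ 3" and z1: "norm z < 1"
    and PX: "P (x1 * x1 / a) \<noteq> 0" "P (x2 * x2 / a) \<noteq> 0" "P (x3 * x3 / a) \<noteq> 0"
      "P (x1 * x2 / a) \<noteq> 0" "P (x1 * x3 / a) \<noteq> 0" "P (x2 * x3 / a) \<noteq> 0"
    and th: "th (x1 / x2) \<noteq> 0" "th (x1 / x3) \<noteq> 0" "th (x2 / x3) \<noteq> 0"
  shows
    "P (q * a / (x1 * y1)) * P (q * a / (x1 * y2)) * P (q * a / (x1 * y3)) /
       (x1 * (P (x1 * x1 / a) * P (x1 * x2 / a) * P (x1 * x3 / a)) * (th (x2 / x1) * th (x3 / x1))) *
       wp_series a [x1, x2, x3, y1, y2, y3] x1 z +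
     P (q * a / (x2 * y1)) * P (q * a / (x2 * y2)) * P (q * a / (x2 * y3)) /
       (x2 * (P (x1 * x2 / a) * P (x2 * x2 / a) * P (x2 * x3 / a)) * (th (x1 / x2) * th (x3 / x2))) *
       wp_series a [x1, x2, x3, y1, y2, y3] x2 z +
     P (q * a / (x3 * y1)) * P (q * a / (x3 * y2)) * P (q * a / (x3 * y3)) /
       (x3 * (P (x1 * x3 / a) * P (x2 * x3 / a) * P (x3 * x3 / a)) * (th (x1 / x3) * th (x2 / x3))) *
       wp_series a [x1, x2, x3, y1, y2, y3] x3 z = 0"
proof -
  define X where "X i = [x1, x2, x3] ! i" for i
  define Y where "Y i = [y1, y2, y3] ! i" for i
  let ?S = "{0, 1, 2 :: nat}"
  have thf: "th (x2 / x1) \<noteq> 0" "th (x3 / x1) \<noteq> 0" "th (x3 / x2) \<noteq> 0"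
    using th theta_nz_flip nz by blast+
  have X: "X 0 = x1" "X 1 = x2" "X (Suc 0) = x2" "X 2 = x3" and Y: "Y 0 = y1" "Y 1 = y2" "Y (Suc 0) = y2" "Y 2 = y3"
    by (simp_all add: X_def Y_def)
  have D: "{0, Suc 0, 2} - {0} = {Suc 0, 2}" "{0, Suc 0, 2} - {Suc 0} = {0, 2}" "{0, Suc 0, 2} - {2} = {0, Suc 0}" by auto
  have "(\<Sum>i\<in>?S. (\<Prod>j\<in>?S. P (q * a / (X i * Y j))) /
      (X i * (\<Prod>j\<in>?S. P (X i * X j / a)) * (\<Prod>j\<in>?S - {i}. th (X j / X i))) * (\<Sum>k. wterm a X ?S Y ?S z i k)) = 0"
  proof (rule wterm_relation)
    show "z * q * (\<Prod>i\<in>?S. X i) * (\<Prod>j\<in>?S. Y j) = (q * a) ^ card ?S"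
      using z by (simp add: X Y mult_ac power3_eq_cube)
    show "P (X i * X j / a) \<noteq> 0" if "i \<in> ?S" "j \<in> ?S" for i j
      using that PX by (auto simp: X mult.commute)
    show "th (X j / X i) \<noteq> 0" if "i \<in> ?S" "j \<in> ?S" "i \<noteq> j" for i j
      using that th thf by (auto simp: X)
  qed (use nz z1 in \<open>auto simp: X Y\<close>)
  moreover have "(\<Sum>k. wterm a X ?S Y ?S z i k) = wp_series a [x1, x2, x3, y1, y2, y3] (X i) z" for i
    unfolding wp_series_def wterm_def by (intro suminf_cong) (simp add: X Y mult_ac)
  ultimately show ?thesis
    by (simp add: D X Y mult_ac add_ac)
qed

text \<open>In the relation between the base points a, d, e the last two series are replaced by
  their q-sums. The coefficient \<open>h x\<close> involves x and a, b, c, g only, so the companion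
  relation with f in place of e has the same \<open>h d\<close>.\<close>

lemma wp_series_qsum_pair:
  assumes nz: "a \<noteq> 0" "b \<noteq> 0" "c \<noteq> 0" "d \<noteq> 0" "e \<noteq> 0" "f \<noteq> 0"
    and g: "g = q * a / (b * c)" and z: "z = q\<^sup>2 * a\<^sup>2 / (b * c * d * e * f)" and z1: "norm z < 1"
    and th0: "th a \<noteq> 0" "th b \<noteq> 0" "th (1 / c) \<noteq> 0" "th d \<noteq> 0" "th e \<noteq> 0" "th f \<noteq> 0" "th g \<noteq> 0"
    and thg: "th (d / g) \<noteq> 0" "th (e / g) \<noteq> 0" and tha: "th (a / d) \<noteq> 0" "th (a / e) \<noteq> 0"
    and th2: "th (a / (d * d)) \<noteq> 0" "th (a / (e * e)) \<noteq> 0" "th (a / (d * e)) \<noteq> 0" "th (a / (d * f)) \<noteq> 0" "th (a / (e * f)) \<noteq> 0"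
    and thb: "th (b * d / a) \<noteq> 0" "th (b * e / a) \<noteq> 0" and thc: "th (a / (c * d)) \<noteq> 0" "th (a / (c * e)) \<noteq> 0"
    and thr: "th (d / e) \<noteq> 0" "th (d / f) \<noteq> 0" "th (e / f) \<noteq> 0"
    and h: "\<And>x. h x = th (b * x / a) * th (c * x / a) / (x * th (a / x) * th (x / g))"
  shows "wp_series a [a, b, c, d, e, f] a z * (th f * th (d * e / a) / (a * th (d / a) * th (e / a))) =
    P (q * a / (d * e)) * P (q * a / (d * f)) * P (q * a / (e * f)) * P a * P d * P e * P f * P g / g *
     (h d / th (e / d) * (qsum (wfun a b c d e f) d - qsum (wfun a b c d e f) g) +
      h e / th (d / e) * (qsum (wfun a b c d e f) e - qsum (wfun a b c d e f) g))"
proof -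
  let ?L = "[a, b, c, d, e, f]" and ?Q = "qsum (wfun a b c d e f)"
  have gnz: "g \<noteq> 0" using nz g by simp
  have inv: "P (y / x) \<noteq> 0 \<and> P (q * x / y) \<noteq> 0 \<and> P (x / y) \<noteq> 0 \<and> P (q * y / x) \<noteq> 0 \<and> th (y / x) \<noteq> 0"
    if "th (x / y) \<noteq> 0" "x \<noteq> 0" "y \<noteq> 0" for x y
    using that theta_nz_flip[OF that(2,3,1)] by (auto simp: theta_nz_iff)
  have P0: "P x \<noteq> 0 \<and> P (q / x) \<noteq> 0" if "th x \<noteq> 0" for x using that by (simp add: theta_nz_iff)
  have c0: "P (q / c) \<noteq> 0" using inv[OF th0(3)] nz by simp
  have sd: "P (d * d / a) \<noteq> 0" "P (e * e / a) \<noteq> 0" "P (d * e / a) \<noteq> 0" "P (q * a / (d * e)) \<noteq> 0" "P (q * a / (d * f)) \<noteq> 0" "P (q * a / (e * f)) \<noteq> 0"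
    using inv[OF th2(1)] inv[OF th2(2)] inv[OF th2(3)] inv[OF th2(4)] inv[OF th2(5)] nz by auto
  have sb: "P (b * d / a) \<noteq> 0" "P (b * e / a) \<noteq> 0" "P (c * d / a) \<noteq> 0" "P (c * e / a) \<noteq> 0"
    using inv[OF thb(1)] inv[OF thb(2)] inv[OF thc(1)] inv[OF thc(2)] nz by auto
  have sr: "P (q * d / e) \<noteq> 0" "P (q * e / d) \<noteq> 0" "P (q * d / f) \<noteq> 0" "P (q * e / f) \<noteq> 0"
    using inv[OF thr(1)] inv[OF thr(2)] inv[OF thr(3)] nz by auto
  have Sd: "wp_series a ?L d z = P d * P (b * d / a) * P (c * d / a) * P g * P (q / b) * P (q / c) * P (d * d / a) * P (q * a / (e * f)) / (g * th (d / g)) * (?Q g - ?Q d)"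
  proof -
    have "g * th (d / g) * wp_series a ?L d z =
       P d * P (b * d / a) * P (c * d / a) * P g * P (q / b) * P (q / c) * P (d\<^sup>2 / a) * P (q * a / (e * f)) * (?Q g - ?Q d)"
      using wp_series_qsum[OF nz g z thg(1) z1] P0[OF th0(4)] sb P0[OF th0(7)] P0[OF th0(2)] c0 sd sr by blast
    then show ?thesis using gnz thg(1) by (simp add: field_simps power2_eq_square)
  qed
  have Se: "wp_series a ?L e z = P e * P (b * e / a) * P (c * e / a) * P g * P (q / b) * P (q / c) * P (e * e / a) * P (q * a / (d * f)) / (g * th (e / g)) * (?Q g - ?Q e)"
  proof -
    have z': "z = q\<^sup>2 * a\<^sup>2 / (b * c * e * d * f)" using z by (simp add: mult_ac)
    have L: "wp_series a [a, b, c, e, d, f] e z = wp_series a ?L e z" by (simp add: wp_series_def mult_ac)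
    have w: "wfun a b c e d f = wfun a b c d e f" by (rule ext) (simp add: wfun_def mult_ac)
    have "g * th (e / g) * wp_series a ?L e z =
       P e * P (b * e / a) * P (c * e / a) * P g * P (q / b) * P (q / c) * P (e\<^sup>2 / a) * P (q * a / (d * f)) * (?Q g - ?Q e)"
      using wp_series_qsum[OF nz(1-3) nz(5,4,6) g z' thg(2) z1, unfolded L w] P0[OF th0(5)] sb P0[OF th0(7)] P0[OF th0(2)] c0 sd sr by blast
    then show ?thesis using gnz thg(2) by (simp add: field_simps power2_eq_square)
  qed
  have zz: "z * q * (a * d * e) * (b * c * f) = (q * a) ^ 3"
    using nz by (simp add: z field_simps power2_eq_square power3_eq_cube)
  have L3: "wp_series a [a, d, e, b, c, f] x z = wp_series a ?L x z" for x by (simp add: wp_series_def mult_ac)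
  have sa: "a * a / a = a" "a * d / a = d" "a * e / a = e" "q * a / (a * b) = q / b" "q * a / (a * c) = q / c" "q * a / (a * f) = q / f"
    using nz by simp_all
  have rel: "P (q / b) * P (q / c) * P (q / f) / (a * (P a * P d * P e) * (th (d / a) * th (e / a))) * wp_series a ?L a z +
     P (q * a / (d * b)) * P (q * a / (d * c)) * P (q * a / (d * f)) / (d * (P d * P (d * d / a) * P (d * e / a)) * (th (a / d) * th (e / d))) * wp_series a ?L d z +
     P (q * a / (e * b)) * P (q * a / (e * c)) * P (q * a / (e * f)) / (e * (P e * P (d * e / a) * P (e * e / a)) * (th (a / e) * th (d / e))) * wp_series a ?L e z = 0"
    using wp_series_three_term[OF nz(1) nz(1) nz(4,5) nz(2,3,6) zz z1, unfolded L3 sa]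
      P0[OF th0(1)] P0[OF th0(4)] P0[OF th0(5)] sd tha thr by blast
  \<comment> \<open>This multiplier supplies the missing halves of theta functions, which makes the
    coefficients quotients of theta functions up to the common constant \<open>Kc\<close>.\<close>
  define m where "m = P a * P d * P e * P f * P (q * a / (d * e)) * P (d * e / a) / (P (q / b) * P (q / c))"
  have bc: "P (q / b) \<noteq> 0" "P (q / c) \<noteq> 0" using P0[OF th0(2)] c0 by auto
  define Kc where "Kc = P (q * a / (d * e)) * P (q * a / (d * f)) * P (q * a / (e * f)) * P a * P d * P e * P f * P g / g"
  have te: "th (d * e / a) = P (d * e / a) * P (q * a / (d * e))" "th f = P f * P (q / f)"
    "th (b * d / a) = P (b * d / a) * P (q * a / (d * b))" "th (c * d / a) = P (c * d / a) * P (q * a / (d * c))"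
    "th (b * e / a) = P (b * e / a) * P (q * a / (e * b))" "th (c * e / a) = P (c * e / a) * P (q * a / (e * c))"
    by (simp_all add: theta_eq mult.commute)
  have 1: "m * (P (q / b) * P (q / c) * P (q / f) / (a * (P a * P d * P e) * (th (d / a) * th (e / a))) * wp_series a ?L a z) =
     wp_series a ?L a z * (th f * th (d * e / a) / (a * th (d / a) * th (e / a)))"
    unfolding m_def te using bc P0[OF th0(1)] P0[OF th0(4)] P0[OF th0(5)] by (simp add: mult_ac)
  have 2: "m * (P (q * a / (d * b)) * P (q * a / (d * c)) * P (q * a / (d * f)) / (d * (P d * P (d * d / a) * P (d * e / a)) * (th (a / d) * th (e / d))) * wp_series a ?L d z) =
     Kc * (h d / th (e / d) * (?Q g - ?Q d))"
    unfolding m_def Kc_def h te Sd using bc sd P0[OF th0(4)] by (simp add: mult_ac)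
  have 3: "m * (P (q * a / (e * b)) * P (q * a / (e * c)) * P (q * a / (e * f)) / (e * (P e * P (d * e / a) * P (e * e / a)) * (th (a / e) * th (d / e))) * wp_series a ?L e z) =
     Kc * (h e / th (d / e) * (?Q g - ?Q e))"
    unfolding m_def Kc_def h te Se using bc sd P0[OF th0(5)] by (simp add: mult_ac)
  have "wp_series a ?L a z * (th f * th (d * e / a) / (a * th (d / a) * th (e / a))) +
      Kc * (h d / th (e / d) * (?Q g - ?Q d)) + Kc * (h e / th (d / e) * (?Q g - ?Q e)) = m * 0"
    unfolding rel[symmetric] 1[symmetric] 2[symmetric] 3[symmetric] by (simp only: distrib_left)
  then have "wp_series a ?L a z * (th f * th (d * e / a) / (a * th (d / a) * th (e / a))) =
      - (Kc * (h d / th (e / d) * (?Q g - ?Q d)) + Kc * (h e / th (d / e) * (?Q g - ?Q e)))"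
    by (simp only: mult_zero_right add.assoc eq_neg_iff_add_eq_0)
  then show ?thesis unfolding Kc_def[symmetric] by (simp add: algebra_simps)
qed

text \<open>\<open>phi_reg\<close> is the \<open>\<^sub>4\<phi>\<^sub>3\<close> in \<open>F(d; e, f)\<close> times the infinite factorials of \<open>q\<close> and of the lower
  parameters; \<open>F_reg\<close> is \<open>F(d; e, f)\<close> up to a factor that is the same for all three terms.\<close>

definition phi_reg :: "complex \<Rightarrow> complex \<Rightarrow> complex \<Rightarrow> complex \<Rightarrow> complex \<Rightarrow> complex \<Rightarrow> complex" where
  "phi_reg a b c d e f = (\<Sum>j. (P (q * q ^ j) * P (q * d / e * q ^ j) * P (q * d / f * q ^ j) * P (b * c * d / a * q ^ j)) *
     (pn d j * pn (b * d / a) j * pn (c * d / a) j * pn (q * a / (e * f)) j) * q ^ j)"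

definition F_reg :: "complex \<Rightarrow> complex \<Rightarrow> complex \<Rightarrow> complex \<Rightarrow> complex \<Rightarrow> complex \<Rightarrow> complex \<Rightarrow> complex" where
  "F_reg z a b c d e f = th (z * d) * (P (q * a / (b * d)) * P (q * a / (c * d)) * P (q * a / (d * e)) * P (q * a / (d * f))) *
     (P e * P f) / (th (e / d) * th (f / d)) * phi_reg a b c d e f"

lemma qsum_wfun_eq:
  assumes nz: "d \<noteq> 0" and Pnz: "P d \<noteq> 0" "P (b * d / a) \<noteq> 0" "P (c * d / a) \<noteq> 0" "P (q * a / (e * f)) \<noteq> 0"
  shows "qsum (wfun a b c d e f) d = d * phi_reg a b c d e f / (P d * P (b * d / a) * P (c * d / a) * P (q * a / (e * f)))"
proof -
  let ?D = "P d * P (b * d / a) * P (c * d / a) * P (q * a / (e * f))"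
  have "q * a * d / (d * e * f) = q * a / (e * f)" using nz by simp
  then have sm: "summable (\<lambda>j. d * q ^ j * wfun a b c d e f (d * q ^ j))"
    using Pnz by (intro summable_wfun) auto
  have t: "(P (q * q ^ j) * P (q * d / e * q ^ j) * P (q * d / f * q ^ j) * P (b * c * d / a * q ^ j)) *
     (pn d j * pn (b * d / a) j * pn (c * d / a) j * pn (q * a / (e * f)) j) * q ^ j =
     (?D / d) * (d * q ^ j * wfun a b c d e f (d * q ^ j))" for j
  proof -
    have e: "q * (d * q ^ j) / d = q * q ^ j" "q * (d * q ^ j) / e = q * d / e * q ^ j" "q * (d * q ^ j) / f = q * d / f * q ^ j"
      "b * c * (d * q ^ j) / a = b * c * d / a * q ^ j" "b * (d * q ^ j) / a = b * d / a * q ^ j" "c * (d * q ^ j) / a = c * d / a * q ^ j"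
      "q * a * (d * q ^ j) / (d * e * f) = q * a / (e * f) * q ^ j"
      using nz by simp_all
    have i: "1 / P (y * q ^ j) = pn y j / P y" if "P y \<noteq> 0" for y
      using qpoch_inf_split[of y j] that qpoch_nz[OF that, of j] by (simp add: field_simps)
    have "wfun a b c d e f (d * q ^ j) = P (q * q ^ j) * P (q * d / e * q ^ j) * P (q * d / f * q ^ j) * P (b * c * d / a * q ^ j) *
       (1 / P (d * q ^ j) * (1 / P (b * d / a * q ^ j)) * (1 / P (c * d / a * q ^ j)) * (1 / P (q * a / (e * f) * q ^ j)))"
      unfolding wfun_def e by simp
    then show ?thesis unfolding i[OF Pnz(1)] i[OF Pnz(2)] i[OF Pnz(3)] i[OF Pnz(4)] using nz Pnz by simp
  qed
  have "phi_reg a b c d e f = (?D / d) * qsum (wfun a b c d e f) d"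
    unfolding phi_reg_def t qsum_def by (rule suminf_mult[OF sm])
  then show ?thesis using nz Pnz by simp
qed

text \<open>The multipliers \<open>lam\<close> and \<open>mu\<close> of the two relations have to
  meet two conditions: the series gets the coefficient 1, and the sum over g q^j drops out. Each of
  \<open>id1\<close>, \<open>id2\<close>, \<open>id3\<close> is one instance of the three-term theta
  identity.\<close>

lemma three_term_generic:
  assumes nz: "a \<noteq> 0" "b \<noteq> 0" "c \<noteq> 0" "d \<noteq> 0" "e \<noteq> 0" "f \<noteq> 0"
    and g: "g = q * a / (b * c)" and z: "z = q\<^sup>2 * a\<^sup>2 / (b * c * d * e * f)" and z1: "norm z < 1"
    and tz: "th z \<noteq> 0" and tg: "th g \<noteq> 0" and tr: "th (d / e) \<noteq> 0" "th (d / f) \<noteq> 0" "th (e / f) \<noteq> 0"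
    and tgx: "th (d / g) \<noteq> 0" "th (e / g) \<noteq> 0" "th (f / g) \<noteq> 0"
    and th0: "th a \<noteq> 0" "th b \<noteq> 0" "th (1 / c) \<noteq> 0" "th d \<noteq> 0" "th e \<noteq> 0" "th f \<noteq> 0"
    and ta: "th (a / d) \<noteq> 0" "th (a / e) \<noteq> 0" "th (a / f) \<noteq> 0"
    and th2: "th (a / (d * d)) \<noteq> 0" "th (a / (e * e)) \<noteq> 0" "th (a / (f * f)) \<noteq> 0"
      "th (a / (d * e)) \<noteq> 0" "th (a / (d * f)) \<noteq> 0" "th (a / (e * f)) \<noteq> 0"
    and tb: "th (b * d / a) \<noteq> 0" "th (b * e / a) \<noteq> 0" "th (b * f / a) \<noteq> 0"
    and tc: "th (a / (c * d)) \<noteq> 0" "th (a / (c * e)) \<noteq> 0" "th (a / (c * f)) \<noteq> 0"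
    and tzx: "th (z * d) \<noteq> 0" "th (z * e) \<noteq> 0" "th (z * f) \<noteq> 0"
  shows "wp_series a [a, b, c, d, e, f] a z * (th z * P (b * c / a)) =
    P a * (F_reg z a b c d e f + F_reg z a b c e d f + F_reg z a b c f d e)"
proof -
  let ?L = "[a, b, c, d, e, f]" and ?Q = "qsum (wfun a b c d e f)"
  have gnz: "g \<noteq> 0" and znz: "z \<noteq> 0" using nz g z by simp_all
  have inv: "P (y / x) \<noteq> 0 \<and> P (q * x / y) \<noteq> 0 \<and> P (x / y) \<noteq> 0 \<and> P (q * y / x) \<noteq> 0 \<and> th (y / x) \<noteq> 0"
    if "th (x / y) \<noteq> 0" "x \<noteq> 0" "y \<noteq> 0" for x y
    using that theta_nz_flip[OF that(2,3,1)] by (auto simp: theta_nz_iff)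
  have P0: "P x \<noteq> 0 \<and> P (q / x) \<noteq> 0" if "th x \<noteq> 0" for x using that by (simp add: theta_nz_iff)
  have tr': "th (e / d) \<noteq> 0" "th (f / d) \<noteq> 0" "th (f / e) \<noteq> 0" "th (d / a) \<noteq> 0" "th (e / a) \<noteq> 0" "th (f / a) \<noteq> 0"
    using inv[OF tr(1)] inv[OF tr(2)] inv[OF tr(3)] inv[OF ta(1)] inv[OF ta(2)] inv[OF ta(3)] nz by auto
  define h where "h x = th (b * x / a) * th (c * x / a) / (x * th (a / x) * th (x / g))" for x
  define Kc where "Kc = P (q * a / (d * e)) * P (q * a / (d * f)) * P (q * a / (e * f)) * P a * P d * P e * P f * P g / g"
  define X1 where "X1 = th f * th (d * e / a) / (a * th (d / a) * th (e / a))"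
  define X2 where "X2 = th e * th (d * f / a) / (a * th (d / a) * th (f / a))"
  define D where "D x = ?Q x - ?Q g" for x
  let ?S = "wp_series a ?L a z"
  have R1: "?S * X1 = Kc * (h d / th (e / d) * D d + h e / th (d / e) * D e)"
    unfolding X1_def Kc_def D_def by (rule wp_series_qsum_pair[OF nz g z z1 th0 tg]) (use assms in \<open>auto simp: h_def\<close>)
  have R2: "?S * X2 = Kc * (h d / th (f / d) * D d + h f / th (d / f) * D f)"
  proof -
    have z': "z = q\<^sup>2 * a\<^sup>2 / (b * c * d * f * e)" using z by (simp add: mult_ac)
    have L: "wp_series a [a, b, c, d, f, e] a z = ?S" by (simp add: wp_series_def mult_ac)
    have w: "wfun a b c d f e = wfun a b c d e f" by (rule ext) (simp add: wfun_def mult_ac)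
    have t: "th (f / e) \<noteq> 0" "th (a / (f * e)) \<noteq> 0" using tr' th2 by (simp_all add: mult.commute)
    have "wp_series a [a, b, c, d, f, e] a z * (th e * th (d * f / a) / (a * th (d / a) * th (f / a))) =
      P (q * a / (d * f)) * P (q * a / (d * e)) * P (q * a / (f * e)) * P a * P d * P f * P e * P g / g *
       (h d / th (f / d) * (qsum (wfun a b c d f e) d - qsum (wfun a b c d f e) g) +
        h f / th (d / f) * (qsum (wfun a b c d f e) f - qsum (wfun a b c d f e) g))"
      by (rule wp_series_qsum_pair[OF nz(1-4,6,5) g z' z1 th0(1-4,6,5) tg]) (use assms t in \<open>auto simp: h_def\<close>)
    then show ?thesis unfolding L w X2_def Kc_def D_def by (simp add: mult_ac)
  qed
  \<comment> \<open>The value that makes the coefficient of the series equal to 1 in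
    \<open>id2\<close>; its denominator th z th g appears in the claim.\<close>
  define kap where "kap = g / (th z * th g)"
  define lam where "lam = kap * (th (z * e) * th (a / e) * th (e / g)) / th (f / e)"
  define mu where "mu = kap * (th (z * f) * th (a / f) * th (f / g)) / th (e / f)"
  define tau where "tau x y w = h x * (th (z * x) * th (a / x) * th (x / g)) / (th (y / x) * th (w / x))" for x y w
  \<comment> \<open>The balancing conditions of the three theta identities. In the last one z would
    give q^2, so z/q is taken, and the quasi-period relation leads back to z.\<close>
  have prod1: "d * e * f * z * (1 / g) * (1 / a) = q" "1 * e * f * z * (1 / g) * (d / a) = q" "d * e * f * (z / q) * (b / a) * (c / a) = q"
    using nz by (simp_all add: z g field_simps power2_eq_square)
  have Pg: "P (x / g) \<noteq> 0" if "th (x / g) \<noteq> 0" for x using that by (simp add: theta_nz_iff)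
  have t1g: "th (1 / g) \<noteq> 0" using tg gnz by (simp add: theta_nz_inverse)
  have aflip: "th (a / x) = - (a / x) * th (x / a)" if "x \<noteq> 0" for x using theta_flip nz(1) that by blast

  define U where "U x = th (x * z) * th (x * (1 / g)) * th (x * (1 / a)) / x" for x
  have U: "th (z * x) * th (a / x) * th (x / g) = - a * U x" if "x \<noteq> 0" for x
    using that unfolding U_def aflip[OF that] by (simp add: mult_ac)
  have T1: "U d / (th (e / d) * th (f / d)) = U f / (th (e / f) * th (f / d)) + U e / (th (f / e) * th (e / d))"
  proof (rule theta_three_term'[OF nz(4-6) znz _ _ prod1(1) _ _ _ _ U_def])
    show "P (y * x) \<noteq> 0" if "x \<in> {d, e, f}" "y \<in> {z, 1 / g, 1 / a}" for x y
      using that P0[OF tzx(1)] P0[OF tzx(2)] P0[OF tzx(3)] Pg tgx inv[OF ta(1)] inv[OF ta(2)] inv[OF ta(3)] nz by auto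
  qed (use gnz nz tr tr' in auto)
  \<comment> \<open>Both relations contribute to the sum at d; this gives their joint coefficient
    the shape that those at e and f have by the choice of \<open>lam\<close> and
    \<open>mu\<close>.\<close>
  have id1: "lam / th (e / d) + mu / th (f / d) = kap * (th (z * d) * th (a / d) * th (d / g)) / (th (e / d) * th (f / d))"
  proof -
    have "kap * (th (z * d) * th (a / d) * th (d / g)) / (th (e / d) * th (f / d)) = - a * kap * (U d / (th (e / d) * th (f / d)))"
      unfolding U[OF nz(4)] by simp
    also have "\<dots> = lam / th (e / d) + mu / th (f / d)"
      unfolding T1 lam_def mu_def U[OF nz(5)] U[OF nz(6)] by (simp add: distrib_left mult_ac)
    finally show ?thesis by simp
  qed

  define U2 where "U2 x = th (x * z) * th (x * (1 / g)) * th (x * (d / a)) / x" for x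
  have T2: "U2 1 / (th (e / 1) * th (f / 1)) = U2 f / (th (e / f) * th (f / 1)) + U2 e / (th (f / e) * th (e / 1))"
  proof (rule theta_three_term'[OF _ nz(5,6) znz _ _ prod1(2) _ _ _ _ U2_def])
    show "P (y * x) \<noteq> 0" if "x \<in> {1, e, f}" "y \<in> {z, 1 / g, d / a}" for x y
      using that P0[OF tz] P0[OF tzx(2)] P0[OF tzx(3)] Pg[OF t1g] Pg[OF tgx(2)] Pg[OF tgx(3)] inv[OF ta(1)] inv[OF th2(4)] inv[OF th2(5)] nz by auto
    show "th (1 / e) \<noteq> 0" using th0(5) nz by (simp add: theta_nz_inverse)
  qed (use gnz nz tr tr' th0 in auto)
  \<comment> \<open>Here 1 replaces d among the three points: th f and th e in \<open>X1\<close> and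
    \<open>X2\<close> are the values of theta at f/1 and e/1.\<close>
  have id2: "lam * X1 + mu * X2 = 1"
  proof -
    have l: "lam * X1 = - kap / th (d / a) * (th f * U2 e / th (f / e))"
      unfolding lam_def U[OF nz(5)] U_def U2_def X1_def using nz tr' by (simp add: mult_ac)
    have m: "mu * X2 = - kap / th (d / a) * (th e * U2 f / th (e / f))"
      unfolding mu_def U[OF nz(6)] U_def U2_def X2_def using nz tr' by (simp add: mult_ac)
    have "U2 1 = th f * U2 e / th (f / e) + th e * U2 f / th (e / f)"
      using T2 th0 tr tr' by (simp add: field_simps)
    then have "lam * X1 + mu * X2 = - kap / th (d / a) * U2 1"
      unfolding l m by (simp add: distrib_left)
    also have "U2 1 = - (th z * th g * th (d / a) / g)"
      unfolding U2_def using theta_inverse[OF gnz] by simp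
    finally show ?thesis unfolding kap_def using tz tg tr' gnz by simp
  qed

  define U3 where "U3 x = th (x * (z / q)) * th (x * (b / a)) * th (x * (c / a)) / x" for x
  define N where "N x = th (z * x) * th (b * x / a) * th (c * x / a)" for x
  have zq: "P (z / q * x) \<noteq> 0" "U3 x = - (z / q) * N x" if "th (z * x) \<noteq> 0" "x \<noteq> 0" for x
  proof -
    have e: "th (z * x) = - th (x * (z / q)) / (x * (z / q))"
      using theta_q_mult[of "x * (z / q)"] that znz by (simp add: mult.commute)
    then have "th (x * (z / q)) \<noteq> 0" using that by auto
    then show "P (z / q * x) \<noteq> 0" by (simp add: theta_nz_iff mult.commute)
    have "th (x * (z / q)) = - (x * (z / q)) * th (z * x)" unfolding e using that znz by simp
    then show "U3 x = - (z / q) * N x" unfolding U3_def N_def using that by (simp add: mult_ac)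
  qed
  have T3: "U3 d / (th (e / d) * th (f / d)) = U3 f / (th (e / f) * th (f / d)) + U3 e / (th (f / e) * th (e / d))"
  proof (rule theta_three_term'[OF nz(4-6) _ _ _ prod1(3) _ _ _ _ U3_def])
    show "P (y * x) \<noteq> 0" if "x \<in> {d, e, f}" "y \<in> {z / q, b / a, c / a}" for x y
      using that zq(1)[OF tzx(1) nz(4)] zq(1)[OF tzx(2) nz(5)] zq(1)[OF tzx(3) nz(6)]
        P0[OF tb(1)] P0[OF tb(2)] P0[OF tb(3)] inv[OF tc(1)] inv[OF tc(2)] inv[OF tc(3)] nz by auto
  qed (use znz nz tr tr' in auto)
  have tauN: "tau x y w = N x / (x * (th (y / x) * th (w / x)))" if "x \<noteq> 0" "th (a / x) \<noteq> 0" "th (x / g) \<noteq> 0" for x y w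
    unfolding tau_def h_def N_def using that by (simp add: field_simps)
  \<comment> \<open>The coefficient of the sum over g q^j is minus this total, so the common lattice
    disappears.\<close>
  have id3: "tau d e f + tau e d f + tau f d e = 0"
  proof -
    have zn: "- (z / q) \<noteq> 0" using znz by simp
    have "- (z / q) * (N d / (th (e / d) * th (f / d))) = - (z / q) * (N f / (th (e / f) * th (f / d)) + N e / (th (f / e) * th (e / d)))"
      using T3 unfolding zq(2)[OF tzx(1) nz(4)] zq(2)[OF tzx(2) nz(5)] zq(2)[OF tzx(3) nz(6)] by (simp add: distrib_left)
    then have "N d / (th (e / d) * th (f / d)) = N f / (th (e / f) * th (f / d)) + N e / (th (f / e) * th (e / d))"
      by (rule mult_left_cancel[OF zn, THEN iffD1])
    also have "th (f / d) = - (f / d) * th (d / f)" using theta_flip nz by blast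
    also have "N f / (th (e / f) * (- (f / d) * th (d / f))) = - d * (N f / (f * (th (d / f) * th (e / f))))"
      using nz by (simp add: mult_ac)
    also have "th (e / d) = - (e / d) * th (d / e)" using theta_flip nz by blast
    also have "N e / (th (f / e) * (- (e / d) * th (d / e))) = - d * (N e / (e * (th (d / e) * th (f / e))))"
      using nz by (simp add: mult_ac)
    finally have "N d / (- (e / d) * th (d / e) * (- (f / d) * th (d / f))) = - d * (tau f d e + tau e d f)"
      unfolding tauN[OF nz(5) ta(2) tgx(2)] tauN[OF nz(6) ta(3) tgx(3)] by (simp add: distrib_left)
    moreover have "N d / (- (e / d) * th (d / e) * (- (f / d) * th (d / f))) = d * tau d e f"
      unfolding tauN[OF nz(4) ta(1) tgx(1)] theta_flip[OF nz(5,4)] theta_flip[OF nz(6,4)] using nz by simp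
    ultimately have eq: "d * tau d e f = - d * (tau f d e + tau e d f)" by metis
    have "d * (tau d e f + tau e d f + tau f d e) = d * tau d e f + d * (tau f d e + tau e d f)"
      by (simp only: distrib_left add_ac)
    also have "\<dots> = 0" unfolding eq by simp
    finally show ?thesis using nz by simp
  qed

  have le: "lam * (h e / th (d / e)) = kap * tau e d f" and mf: "mu * (h f / th (d / f)) = kap * tau f d e"
    unfolding lam_def mu_def tau_def by (simp_all add: mult_ac)
  have ld: "lam * (h d / th (e / d)) + mu * (h d / th (f / d)) = kap * tau d e f"
  proof -
    have "lam * (h d / th (e / d)) + mu * (h d / th (f / d)) = h d * (lam / th (e / d) + mu / th (f / d))"
      by (simp add: distrib_left mult_ac)
    then show ?thesis unfolding id1 tau_def by simp
  qed
  have "?S = ?S * (lam * X1 + mu * X2)" unfolding id2 by simp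
  also have "\<dots> = lam * (?S * X1) + mu * (?S * X2)" by (simp add: algebra_simps)
  also have "\<dots> = Kc * ((lam * (h d / th (e / d)) + mu * (h d / th (f / d))) * D d + lam * (h e / th (d / e)) * D e + mu * (h f / th (d / f)) * D f)"
    unfolding R1 R2 by (simp only: distrib_left distrib_right mult_ac add_ac)
  also have "\<dots> = Kc * kap * (tau d e f * D d + tau e d f * D e + tau f d e * D f)"
    unfolding ld le mf by (simp only: distrib_left mult_ac)
  also have "tau d e f * D d + tau e d f * D e + tau f d e * D f =
     tau d e f * ?Q d + tau e d f * ?Q e + tau f d e * ?Q f - (tau d e f + tau e d f + tau f d e) * ?Q g"
    unfolding D_def by (simp add: algebra_simps)
  also have "\<dots> = tau d e f * ?Q d + tau e d f * ?Q e + tau f d e * ?Q f" unfolding id3 by simp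
  finally have S: "?S = Kc * kap * (tau d e f * ?Q d + tau e d f * ?Q e + tau f d e * ?Q f)" .
  have tgP: "th g = P g * P (b * c / a)" using nz by (simp add: theta_eq g)
  have Kk: "Kc * kap * (th z * P (b * c / a)) = P (q * a / (d * e)) * P (q * a / (d * f)) * P (q * a / (e * f)) * P a * P d * P e * P f"
    unfolding Kc_def kap_def using tg tz gnz unfolding tgP by simp
  \<comment> \<open>Stated for a rearrangement x, y, w of d, e, f: \<open>pr1\<close>,
    \<open>pr2\<close>, \<open>pr3\<close> record that the integrand and the common products are
    unchanged by it.\<close>
  have F: "P (q * a / (d * e)) * P (q * a / (d * f)) * P (q * a / (e * f)) * P a * P d * P e * P f * (tau x y w * ?Q x) = P a * F_reg z a b c x y w"
    if x: "x \<noteq> 0" "th (a / x) \<noteq> 0" "th (x / g) \<noteq> 0"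
      and Pn: "P x \<noteq> 0" "P (b * x / a) \<noteq> 0" "P (c * x / a) \<noteq> 0" "P (q * a / (y * w)) \<noteq> 0"
      and pr1: "wfun a b c d e f = wfun a b c x y w"
      and pr2: "P (q * a / (d * e)) * P (q * a / (d * f)) * P (q * a / (e * f)) = P (q * a / (x * y)) * P (q * a / (x * w)) * P (q * a / (y * w))"
      and pr3: "P d * P e * P f = P x * P y * P w" for x y w
  proof -
    have tb: "th (b * x / a) = P (b * x / a) * P (q * a / (b * x))" "th (c * x / a) = P (c * x / a) * P (q * a / (c * x))"
      by (simp_all add: theta_eq)
    have "P (q * a / (d * e)) * P (q * a / (d * f)) * P (q * a / (e * f)) * P a * P d * P e * P f * (tau x y w * ?Q x) =
       (P (q * a / (d * e)) * P (q * a / (d * f)) * P (q * a / (e * f))) * P a * (P d * P e * P f) * (tau x y w * ?Q x)"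
      by (simp only: mult_ac)
    also have "\<dots> = P a * F_reg z a b c x y w"
      unfolding pr1 pr2 pr3 tauN[OF x] qsum_wfun_eq[OF x(1) Pn] N_def tb F_reg_def using x(1) Pn by (simp add: mult_ac)
    finally show ?thesis .
  qed
  have w1: "wfun a b c d e f = wfun a b c e d f" "wfun a b c d e f = wfun a b c f d e"
    by (rule ext, simp add: wfun_def mult_ac)+
  have Pc: "P (c * d / a) \<noteq> 0" "P (c * e / a) \<noteq> 0" "P (c * f / a) \<noteq> 0"
    using inv[OF tc(1)] inv[OF tc(2)] inv[OF tc(3)] nz by auto
  have Pab: "P (q * a / (e * f)) \<noteq> 0" "P (q * a / (d * f)) \<noteq> 0" "P (q * a / (d * e)) \<noteq> 0"
    using inv[OF th2(6)] inv[OF th2(5)] inv[OF th2(4)] nz by auto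
  have Fd: "P (q * a / (d * e)) * P (q * a / (d * f)) * P (q * a / (e * f)) * P a * P d * P e * P f * (tau d e f * ?Q d) = P a * F_reg z a b c d e f"
    using P0[OF th0(4)] P0[OF tb(1)] Pc Pab by (intro F nz ta tgx) auto
  have Fe: "P (q * a / (d * e)) * P (q * a / (d * f)) * P (q * a / (e * f)) * P a * P d * P e * P f * (tau e d f * ?Q e) = P a * F_reg z a b c e d f"
    using P0[OF th0(5)] P0[OF tb(2)] Pc Pab by (intro F nz ta tgx w1) (auto simp: mult_ac)
  have Ff: "P (q * a / (d * e)) * P (q * a / (d * f)) * P (q * a / (e * f)) * P a * P d * P e * P f * (tau f d e * ?Q f) = P a * F_reg z a b c f d e"
    using P0[OF th0(6)] P0[OF tb(3)] Pc Pab by (intro F nz ta tgx w1) (auto simp: mult_ac)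
  have "?S * (th z * P (b * c / a)) = (Kc * kap * (th z * P (b * c / a))) * (tau d e f * ?Q d + tau e d f * ?Q e + tau f d e * ?Q f)"
    unfolding S by (simp only: mult_ac)
  also have "\<dots> = P a * (F_reg z a b c d e f + F_reg z a b c e d f + F_reg z a b c f d e)"
    unfolding Kk distrib_left Fd Fe Ff ..
  finally show ?thesis .
qed

section \<open>Continuity in the parameters and generic perturbations\<close>

lemma tendsto_theta [tendsto_intros]:
  assumes "(f \<longlongrightarrow> x) net" "x \<noteq> 0"
  shows "((\<lambda>n. th (f n)) \<longlongrightarrow> th x) net"
  unfolding theta_eq using assms by (intro tendsto_intros)

lemma series_bounded:
  assumes fin: "finite I" and u: "\<And>i. i \<in> I \<Longrightarrow> (\<lambda>n. u i n) \<longlonglongrightarrow> u' i" and v: "\<And>i. i \<in> I \<Longrightarrow> (\<lambda>n. v i n) \<longlonglongrightarrow> v' i"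
    and w: "w \<longlonglongrightarrow> w'"
  shows "bdd2 (\<lambda>n k. (1 - w n * q ^ (2 * k)) * (\<Prod>i\<in>I. pn (u i n) k * P (v i n * q ^ k)))"
proof -
  have bnd: "\<exists>B. \<forall>n. norm (h n) \<le> B" if "h \<longlonglongrightarrow> h'" for h :: "nat \<Rightarrow> complex" and h'
    using convergent_imp_Bseq[OF convergentI[OF that]] by (auto simp: Bseq_def)
  have b1: "bdd2 (\<lambda>n k. pn (u i n) k)" if i: "i \<in> I" for i
  proof -
    obtain B where "\<And>n. norm (u i n) \<le> B" using bnd[OF u[OF i]] by blast
    then show ?thesis by (intro bdd2_I[of _ "pbound B"] norm_qpoch_le)
  qed
  have b2: "bdd2 (\<lambda>n k. P (v i n * q ^ k))" if i: "i \<in> I" for i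
  proof -
    obtain B where B: "\<And>n. norm (v i n) \<le> B" using bnd[OF v[OF i]] by blast
    show ?thesis
    proof (intro bdd2_I[of _ "pbound B"] norm_qpoch_inf_le)
      fix n k
      have "norm (v i n * q ^ k) \<le> norm (v i n)"
        by (simp add: norm_mult norm_power mult_left_le norm_q_power_le_1)
      then show "norm (v i n * q ^ k) \<le> B" using B[of n] by linarith
    qed
  qed
  have b3: "bdd2 (\<lambda>n k. 1 - w n * q ^ (2 * k))"
  proof -
    obtain B where B: "\<And>n. norm (w n) \<le> B" using bnd[OF w] by blast
    show ?thesis
    proof (rule bdd2_I[of _ "1 + B"])
      fix n k
      have "norm (w n * q ^ (2 * k)) \<le> norm (w n)"
        unfolding norm_mult norm_power by (intro mult_left_le norm_q_power_le_1) auto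
      then show "norm (1 - w n * q ^ (2 * k)) \<le> 1 + B"
        using norm_triangle_ineq4[of 1 "w n * q ^ (2 * k)"] B[of n] by simp
    qed
  qed
  show ?thesis
    by (intro bdd2_mult bdd2_prod fin b1 b2 b3)
qed

text \<open>One shape covers both kinds of series: w = a gives the cleared 8W7 series, w = 0 and z =
  q give \<open>phi_reg\<close>. The argument z is constant because the perturbation used later
  leaves it fixed.\<close>

lemma series_tendsto:
  assumes fin: "finite I" and u: "\<And>i. i \<in> I \<Longrightarrow> (\<lambda>n. u i n) \<longlonglongrightarrow> u' i" and v: "\<And>i. i \<in> I \<Longrightarrow> (\<lambda>n. v i n) \<longlonglongrightarrow> v' i"
    and w: "w \<longlonglongrightarrow> w'" and z: "norm z < 1"
  shows "(\<lambda>n. \<Sum>k. (1 - w n * q ^ (2 * k)) * (\<Prod>i\<in>I. pn (u i n) k * P (v i n * q ^ k)) * z ^ k) \<longlonglongrightarrow>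
    (\<Sum>k. (1 - w' * q ^ (2 * k)) * (\<Prod>i\<in>I. pn (u' i) k * P (v' i * q ^ k)) * z ^ k)"
proof -
  obtain C where C: "\<And>n k. norm ((1 - w n * q ^ (2 * k)) * (\<Prod>i\<in>I. pn (u i n) k * P (v i n * q ^ k))) \<le> C"
    using series_bounded[of I u u' v v' w w', OF fin u v w] by (auto simp: bdd2_def)
  let ?t = "\<lambda>k n. (1 - w n * q ^ (2 * k)) * (\<Prod>i\<in>I. pn (u i n) k * P (v i n * q ^ k)) * z ^ k"
  have lim: "(\<lambda>n. ?t k n) \<longlonglongrightarrow> (1 - w' * q ^ (2 * k)) * (\<Prod>i\<in>I. pn (u' i) k * P (v' i * q ^ k)) * z ^ k" for k
    by (intro tendsto_intros u v w)
  have bound: "\<forall>\<^sub>F (k, n) in sequentially \<times>\<^sub>F sequentially. norm (?t k n) \<le> C * norm z ^ k"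
  proof (intro always_eventually allI, clarify)
    fix k n
    show "norm (?t k n) \<le> C * norm z ^ k"
      unfolding norm_mult[of _ "z ^ k"] norm_power by (intro mult_right_mono C) simp
  qed
  have "summable (\<lambda>k. C * norm z ^ k)" using z by (intro summable_mult summable_geometric) auto
  from tannerys_theorem[OF lim bound this] show ?thesis by simp
qed

lemma series_summable:
  assumes fin: "finite I" and z: "norm z < 1"
  shows "summable (\<lambda>k. (1 - w * q ^ (2 * k)) * (\<Prod>i\<in>I. pn (u i) k * P (v i * q ^ k)) * z ^ k)"
proof -
  have "bdd2 (\<lambda>n k. (1 - w * q ^ (2 * k)) * (\<Prod>i\<in>I. pn (u i) k * P (v i * q ^ k)))"
    using series_bounded[of I "\<lambda>i _. u i" u "\<lambda>i _. v i" v "\<lambda>_. w" w] fin by simp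
  then obtain C where C: "\<And>k. norm ((1 - w * q ^ (2 * k)) * (\<Prod>i\<in>I. pn (u i) k * P (v i * q ^ k))) \<le> C"
    by (auto simp: bdd2_def)
  show ?thesis
  proof (rule summable_comparison_test'[of "\<lambda>k. C * norm z ^ k" 0])
    show "summable (\<lambda>k. C * norm z ^ k)" using z by (intro summable_mult summable_geometric) auto
    show "norm ((1 - w * q ^ (2 * k)) * (\<Prod>i\<in>I. pn (u i) k * P (v i * q ^ k)) * z ^ k) \<le> C * norm z ^ k" for k
      unfolding norm_mult[of _ "z ^ k"] norm_power by (intro mult_right_mono C) simp
  qed
qed

lemma wp_series_tendsto:
  assumes lim: "A \<longlonglongrightarrow> a" "B \<longlonglongrightarrow> b" "C \<longlonglongrightarrow> c" "D \<longlonglongrightarrow> d" "E \<longlonglongrightarrow> e" "F' \<longlonglongrightarrow> f"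
    and nz: "a \<noteq> 0" "b \<noteq> 0" "c \<noteq> 0" "d \<noteq> 0" "e \<noteq> 0" "f \<noteq> 0" and z: "norm z < 1"
  shows "(\<lambda>n. wp_series (A n) [A n, B n, C n, D n, E n, F' n] (A n) z) \<longlonglongrightarrow> wp_series a [a, b, c, d, e, f] a z"
proof -
  let ?I = "{0, 1, 2, 3, 4, 5 :: nat}"
  define Y where "Y i n = [A n, B n, C n, D n, E n, F' n] ! i" for i n
  define y where "y i = [a, b, c, d, e, f] ! i" for i
  have Y: "Y 0 = A" "Y (Suc 0) = B" "Y 2 = C" "Y 3 = D" "Y 4 = E" "Y 5 = F'"
    by (rule ext, simp add: Y_def eval_nat_numeral)+
  have y: "y 0 = a" "y (Suc 0) = b" "y 2 = c" "y 3 = d" "y 4 = e" "y 5 = f"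
    by (simp_all add: y_def eval_nat_numeral)
  have Yl: "(\<lambda>n. Y i n) \<longlonglongrightarrow> y i" "y i \<noteq> 0" if "i \<in> ?I" for i
    using that lim nz by (auto simp: Y y)
  have "(\<lambda>n. \<Sum>k. (1 - (A n)\<^sup>2 / A n * q ^ (2 * k)) * (\<Prod>i\<in>?I. pn (A n * Y i n / A n) k * P (q * A n / Y i n * q ^ k)) * z ^ k) \<longlonglongrightarrow>
      (\<Sum>k. (1 - a\<^sup>2 / a * q ^ (2 * k)) * (\<Prod>i\<in>?I. pn (a * y i / a) k * P (q * a / y i * q ^ k)) * z ^ k)"
    by (intro series_tendsto tendsto_intros lim Yl nz z) auto
  moreover have "wp_series (A n) [A n, B n, C n, D n, E n, F' n] (A n) z =
      (\<Sum>k. (1 - (A n)\<^sup>2 / A n * q ^ (2 * k)) * (\<Prod>i\<in>?I. pn (A n * Y i n / A n) k * P (q * A n / Y i n * q ^ k)) * z ^ k)" for n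
    unfolding wp_series_def by (intro suminf_cong) (simp add: Y mult_ac)
  moreover have "wp_series a [a, b, c, d, e, f] a z =
      (\<Sum>k. (1 - a\<^sup>2 / a * q ^ (2 * k)) * (\<Prod>i\<in>?I. pn (a * y i / a) k * P (q * a / y i * q ^ k)) * z ^ k)"
    unfolding wp_series_def by (intro suminf_cong) (simp add: y mult_ac)
  ultimately show ?thesis by (simp only:)
qed

lemma phi_reg_tendsto:
  assumes lim: "A \<longlonglongrightarrow> a" "B \<longlonglongrightarrow> b" "C \<longlonglongrightarrow> c" "D \<longlonglongrightarrow> d" "E \<longlonglongrightarrow> e" "F' \<longlonglongrightarrow> f"
    and nz: "a \<noteq> 0" "b \<noteq> 0" "c \<noteq> 0" "d \<noteq> 0" "e \<noteq> 0" "f \<noteq> 0"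
  shows "(\<lambda>n. phi_reg (A n) (B n) (C n) (D n) (E n) (F' n)) \<longlonglongrightarrow> phi_reg a b c d e f"
proof -
  let ?I = "{0, 1, 2, 3 :: nat}"
  define u where "u i n = [D n, B n * D n / A n, C n * D n / A n, q * A n / (E n * F' n)] ! i" for i n
  define u' where "u' i = [d, b * d / a, c * d / a, q * a / (e * f)] ! i" for i
  define v where "v i n = [q, q * D n / E n, q * D n / F' n, B n * C n * D n / A n] ! i" for i n
  define v' where "v' i = [q, q * d / e, q * d / f, b * c * d / a] ! i" for i
  have U: "u 0 n = D n" "u (Suc 0) n = B n * D n / A n" "u 2 n = C n * D n / A n" "u 3 n = q * A n / (E n * F' n)"
    "v 0 n = q" "v (Suc 0) n = q * D n / E n" "v 2 n = q * D n / F' n" "v 3 n = B n * C n * D n / A n" for n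
    by (simp_all add: u_def v_def eval_nat_numeral)
  have U': "u' 0 = d" "u' (Suc 0) = b * d / a" "u' 2 = c * d / a" "u' 3 = q * a / (e * f)"
    "v' 0 = q" "v' (Suc 0) = q * d / e" "v' 2 = q * d / f" "v' 3 = b * c * d / a"
    by (simp_all add: u'_def v'_def eval_nat_numeral)
  have ul: "(\<lambda>n. u i n) \<longlonglongrightarrow> u' i" "(\<lambda>n. v i n) \<longlonglongrightarrow> v' i" if "i \<in> ?I" for i
    using that nz by (auto simp: U U' intro!: tendsto_intros lim)
  have "(\<lambda>n. \<Sum>k. (1 - 0 * q ^ (2 * k)) * (\<Prod>i\<in>?I. pn (u i n) k * P (v i n * q ^ k)) * q ^ k) \<longlonglongrightarrow>
      (\<Sum>k. (1 - 0 * q ^ (2 * k)) * (\<Prod>i\<in>?I. pn (u' i) k * P (v' i * q ^ k)) * q ^ k)"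
    by (intro series_tendsto ul tendsto_const q_less_1) auto
  then show ?thesis
    unfolding phi_reg_def by (simp add: U U' mult_ac)
qed

lemma F_reg_tendsto:
  assumes lim: "A \<longlonglongrightarrow> a" "B \<longlonglongrightarrow> b" "C \<longlonglongrightarrow> c" "D \<longlonglongrightarrow> d" "E \<longlonglongrightarrow> e" "F' \<longlonglongrightarrow> f"
    and nz: "a \<noteq> 0" "b \<noteq> 0" "c \<noteq> 0" "d \<noteq> 0" "e \<noteq> 0" "f \<noteq> 0" "z \<noteq> 0"
    and th: "th (e / d) \<noteq> 0" "th (f / d) \<noteq> 0"
  shows "(\<lambda>n. F_reg z (A n) (B n) (C n) (D n) (E n) (F' n)) \<longlonglongrightarrow> F_reg z a b c d e f"
  unfolding F_reg_def by (intro tendsto_intros phi_reg_tendsto lim) (use nz th in auto)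

text \<open>A zero of theta is an integer power of q. Taking norms leaves s^w = |q|^k/|m|, hence at
  most one s > 0 for each integer k.\<close>

lemma countable_theta_zeros:
  assumes "m \<noteq> 0" "0 < w"
  shows "countable {s :: real. 0 < s \<and> th (m * of_real s ^ w) = 0}"
proof (rule countable_subset)
  show "countable (range (\<lambda>k :: int. root w (norm q powi k / norm m)))" by simp
  show "{s :: real. 0 < s \<and> th (m * of_real s ^ w) = 0} \<subseteq> range (\<lambda>k :: int. root w (norm q powi k / norm m))"
  proof clarify
    fix s :: real assume s: "0 < s" and t: "th (m * of_real s ^ w) = 0"
    define y where "y = m * of_real s ^ w"
    have ny: "norm y = norm m * s ^ w" using s by (simp add: y_def norm_mult norm_power)
    have ynz: "y \<noteq> 0" using assms s by (simp add: y_def)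
    obtain k :: int where k: "norm y = norm q powi k"
    proof (cases "P y = 0")
      case True
      then obtain k where "y * q ^ k = 1" using qpoch_inf_eq_0_iff by blast
      then have "norm y * norm q ^ k = 1" by (metis norm_mult norm_one norm_power)
      then have "norm y = norm q powi (- int k)"
        by (simp add: power_int_minus field_simps)
      then show ?thesis using that by blast
    next
      case False
      then have "P (q / y) = 0" using t by (simp add: theta_eq y_def)
      then obtain k where "q / y * q ^ k = 1" using qpoch_inf_eq_0_iff by blast
      then have "y = q ^ Suc k" using ynz by (simp add: field_simps)
      then have "norm y = norm q ^ Suc k" by (simp only: norm_power)
      also have "\<dots> = norm q powi int (Suc k)" by (simp only: power_int_of_nat)
      finally show ?thesis using that by blast
    qed
    have "s ^ w = norm q powi k / norm m" using k ny assms by (simp add: field_simps)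
    then have "s = root w (norm q powi k / norm m)"
      using real_root_power_cancel[of w s] s assms by simp
    then show "s \<in> range (\<lambda>k :: int. root w (norm q powi k / norm m))" by blast
  qed
qed

text \<open>Finitely many countable exceptional sets cannot cover the interval (1, 1 + 1/(n + 1)),
  from which s n is chosen.\<close>

lemma generic_scaling:
  fixes L :: "(complex \<times> nat) list"
  assumes "\<And>m w. (m, w) \<in> set L \<Longrightarrow> m \<noteq> 0 \<and> 0 < w"
  obtains s :: "nat \<Rightarrow> real" where "s \<longlonglongrightarrow> 1" "\<And>n. 0 < s n"
    "\<And>n m w. (m, w) \<in> set L \<Longrightarrow> th (m * of_real (s n) ^ w) \<noteq> 0"
proof -
  define bad where "bad = (\<Union>(m, w)\<in>set L. {s :: real. 0 < s \<and> th (m * of_real s ^ w) = 0})"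
  have "countable bad"
    unfolding bad_def using assms countable_theta_zeros by (intro countable_UN) (auto simp: countable_finite)
  then have "\<exists>s\<in>{1 <..< 1 + 1 / real (Suc n)}. s \<notin> bad" for n
    by (intro open_minus_countable) auto
  then obtain s where s: "\<And>n. s n \<in> {1 <..< 1 + 1 / real (Suc n)}" "\<And>n. s n \<notin> bad" by metis
  show ?thesis
  proof (rule that)
    have "(\<lambda>n. 1 + 1 / real (Suc n)) \<longlonglongrightarrow> 1 + 0"
      by (intro tendsto_intros LIMSEQ_Suc[OF lim_1_over_n])
    then show "s \<longlonglongrightarrow> 1"
      by (intro tendsto_sandwich[of "\<lambda>_. 1" s sequentially "\<lambda>n. 1 + 1 / real (Suc n)" 1])
         (use s(1) in \<open>auto intro!: always_eventually less_imp_le\<close>)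
    show pos: "0 < s n" for n using s(1)[of n] by simp
    show "th (m * of_real (s n) ^ w) \<noteq> 0" if "(m, w) \<in> set L" for n m w
      using s(2)[of n] pos[of n] that by (auto simp: bad_def)
  qed
qed

text \<open>Scaling \<open>(a, b, c, d, e, f)\<close> with weights \<open>(3, 4, -1, 1, 1, 1)\<close> fixes \<open>z\<close>, \<open>g\<close> and the ratios of
  \<open>d, e, f\<close>, but moves every other argument at which \<open>three_term_generic\<close> needs a non-zero theta value.\<close>

theorem three_term_regular:
  assumes nz: "a \<noteq> 0" "b \<noteq> 0" "c \<noteq> 0" "d \<noteq> 0" "e \<noteq> 0" "f \<noteq> 0"
    and g: "g = q * a / (b * c)" and z: "z = q\<^sup>2 * a\<^sup>2 / (b * c * d * e * f)" and z1: "norm z < 1"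
    and tz: "th z \<noteq> 0" and tg: "th g \<noteq> 0" and tr: "th (d / e) \<noteq> 0" "th (d / f) \<noteq> 0" "th (e / f) \<noteq> 0"
  shows "wp_series a [a, b, c, d, e, f] a z * (th z * P (b * c / a)) =
    P a * (F_reg z a b c d e f + F_reg z a b c e d f + F_reg z a b c f d e)"
proof -
  have gnz: "g \<noteq> 0" and znz: "z \<noteq> 0" using nz g z by simp_all
  \<comment> \<open>Each entry pairs a theta argument with its weight under the scaling. The
    reciprocals 1/c and a/(c d) are listed, and used in \<open>three_term_generic\<close>, because
    their weights are positive as \<open>generic_scaling\<close> requires.\<close>
  define L where "L = [(a, 3), (b, 4), (1 / c, 1), (d, 1), (e, 1), (f, 1), (a / d, 2), (a / e, 2), (a / f, 2),
    (a / (d * d), 1), (a / (e * e), 1), (a / (f * f), 1), (a / (d * e), 1), (a / (d * f), 1), (a / (e * f), 1),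
    (b * d / a, 2), (b * e / a, 2), (b * f / a, 2), (a / (c * d), 3), (a / (c * e), 3), (a / (c * f), 3),
    (z * d, 1), (z * e, 1), (z * f, 1), (d / g, 1), (e / g, 1), (f / g, 1 :: nat)]"
  have Lok: "\<And>m w. (m, w) \<in> set L \<Longrightarrow> m \<noteq> 0 \<and> 0 < w"
    using nz gnz znz by (auto simp: L_def)
  obtain s :: "nat \<Rightarrow> real" where s: "s \<longlonglongrightarrow> 1" "\<And>n. 0 < s n"
    "\<And>n m w. (m, w) \<in> set L \<Longrightarrow> th (m * of_real (s n) ^ w) \<noteq> 0"
    using generic_scaling[OF Lok] by metis
  define S where "S n = complex_of_real (s n)" for n
  have Snz: "S n \<noteq> 0" for n using s(2)[of n] by (simp add: S_def)
  have S: "S \<longlonglongrightarrow> 1" unfolding S_def[abs_def] using tendsto_of_real[OF s(1), where 'a = complex] by simp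
  define A where "A n = a * S n ^ 3" for n
  define B where "B n = b * S n ^ 4" for n
  define C where "C n = c / S n" for n
  define D where "D n = d * S n" for n
  define E where "E n = e * S n" for n
  define F' where "F' n = f * S n" for n
  have lim: "A \<longlonglongrightarrow> a" "B \<longlonglongrightarrow> b" "C \<longlonglongrightarrow> c" "D \<longlonglongrightarrow> d" "E \<longlonglongrightarrow> e" "F' \<longlonglongrightarrow> f"
  proof -
    have "A \<longlonglongrightarrow> a * 1 ^ 3" unfolding A_def by (intro tendsto_intros S)
    then show "A \<longlonglongrightarrow> a" by simp
    have "B \<longlonglongrightarrow> b * 1 ^ 4" unfolding B_def by (intro tendsto_intros S)
    then show "B \<longlonglongrightarrow> b" by simp
    have "C \<longlonglongrightarrow> c / 1" unfolding C_def by (intro tendsto_intros S) simp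
    then show "C \<longlonglongrightarrow> c" by simp
    have "D \<longlonglongrightarrow> d * 1" unfolding D_def by (intro tendsto_intros S)
    then show "D \<longlonglongrightarrow> d" by simp
    have "E \<longlonglongrightarrow> e * 1" unfolding E_def by (intro tendsto_intros S)
    then show "E \<longlonglongrightarrow> e" by simp
    have "F' \<longlonglongrightarrow> f * 1" unfolding F'_def by (intro tendsto_intros S)
    then show "F' \<longlonglongrightarrow> f" by simp
  qed
  have eq: "wp_series (A n) [A n, B n, C n, D n, E n, F' n] (A n) z * (th z * P (b * c / a)) =
     P (A n) * (F_reg z (A n) (B n) (C n) (D n) (E n) (F' n) + F_reg z (A n) (B n) (C n) (E n) (D n) (F' n) + F_reg z (A n) (B n) (C n) (F' n) (D n) (E n))" for n
  proof -
    note defs = A_def B_def C_def D_def E_def F'_def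
    have G: "th y \<noteq> 0" if "y = m * S n ^ w" "(m, w) \<in> set L" for y m w
      using s(3)[OF that(2), of n] that(1) by (simp add: S_def)
    have bc: "B n * C n / A n = b * c / a"
      using Snz[of n] nz by (simp add: defs field_simps eval_nat_numeral)
    have "wp_series (A n) [A n, B n, C n, D n, E n, F' n] (A n) z * (th z * P (B n * C n / A n)) =
     P (A n) * (F_reg z (A n) (B n) (C n) (D n) (E n) (F' n) + F_reg z (A n) (B n) (C n) (E n) (D n) (F' n) + F_reg z (A n) (B n) (C n) (F' n) (D n) (E n))"
    proof (rule three_term_generic[where g = g])
      show "g = q * A n / (B n * C n)" "z = q\<^sup>2 * (A n)\<^sup>2 / (B n * C n * D n * E n * F' n)"
        using Snz[of n] nz by (simp_all add: g z defs field_simps eval_nat_numeral)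
      show "th (D n / E n) \<noteq> 0" "th (D n / F' n) \<noteq> 0" "th (E n / F' n) \<noteq> 0"
        using Snz[of n] tr by (simp_all add: defs)
      show "th (D n / g) \<noteq> 0" "th (E n / g) \<noteq> 0" "th (F' n / g) \<noteq> 0"
        by (rule G[of _ "d / g" 1] G[of _ "e / g" 1] G[of _ "f / g" 1]; simp add: defs L_def)+
      show "th (A n) \<noteq> 0" by (rule G[of _ a 3]) (simp_all add: defs L_def)
      show "th (B n) \<noteq> 0" by (rule G[of _ b 4]) (simp_all add: defs L_def)
      show "th (1 / C n) \<noteq> 0" by (rule G[of _ "1 / c" 1]) (simp_all add: defs L_def)
      show "th (D n) \<noteq> 0" by (rule G[of _ d 1]) (simp_all add: defs L_def)
      show "th (E n) \<noteq> 0" by (rule G[of _ e 1]) (simp_all add: defs L_def)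
      show "th (F' n) \<noteq> 0" by (rule G[of _ f 1]) (simp_all add: defs L_def)
      show "th (A n / D n) \<noteq> 0" by (rule G[of _ "a / d" 2]) (use Snz[of n] in \<open>simp_all add: defs L_def eval_nat_numeral\<close>)
      show "th (A n / E n) \<noteq> 0" by (rule G[of _ "a / e" 2]) (use Snz[of n] in \<open>simp_all add: defs L_def eval_nat_numeral\<close>)
      show "th (A n / F' n) \<noteq> 0" by (rule G[of _ "a / f" 2]) (use Snz[of n] in \<open>simp_all add: defs L_def eval_nat_numeral\<close>)
      show "th (A n / (D n * D n)) \<noteq> 0" by (rule G[of _ "a / (d * d)" 1]) (use Snz[of n] in \<open>simp_all add: defs L_def eval_nat_numeral\<close>)
      show "th (A n / (E n * E n)) \<noteq> 0" by (rule G[of _ "a / (e * e)" 1]) (use Snz[of n] in \<open>simp_all add: defs L_def eval_nat_numeral\<close>)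
      show "th (A n / (F' n * F' n)) \<noteq> 0" by (rule G[of _ "a / (f * f)" 1]) (use Snz[of n] in \<open>simp_all add: defs L_def eval_nat_numeral\<close>)
      show "th (A n / (D n * E n)) \<noteq> 0" by (rule G[of _ "a / (d * e)" 1]) (use Snz[of n] in \<open>simp_all add: defs L_def eval_nat_numeral\<close>)
      show "th (A n / (D n * F' n)) \<noteq> 0" by (rule G[of _ "a / (d * f)" 1]) (use Snz[of n] in \<open>simp_all add: defs L_def eval_nat_numeral\<close>)
      show "th (A n / (E n * F' n)) \<noteq> 0" by (rule G[of _ "a / (e * f)" 1]) (use Snz[of n] in \<open>simp_all add: defs L_def eval_nat_numeral\<close>)
      show "th (B n * D n / A n) \<noteq> 0" by (rule G[of _ "b * d / a" 2]) (use Snz[of n] in \<open>simp_all add: defs L_def eval_nat_numeral\<close>)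
      show "th (B n * E n / A n) \<noteq> 0" by (rule G[of _ "b * e / a" 2]) (use Snz[of n] in \<open>simp_all add: defs L_def eval_nat_numeral\<close>)
      show "th (B n * F' n / A n) \<noteq> 0" by (rule G[of _ "b * f / a" 2]) (use Snz[of n] in \<open>simp_all add: defs L_def eval_nat_numeral\<close>)
      show "th (A n / (C n * D n)) \<noteq> 0" by (rule G[of _ "a / (c * d)" 3]) (use Snz[of n] in \<open>simp_all add: defs L_def eval_nat_numeral\<close>)
      show "th (A n / (C n * E n)) \<noteq> 0" by (rule G[of _ "a / (c * e)" 3]) (use Snz[of n] in \<open>simp_all add: defs L_def eval_nat_numeral\<close>)
      show "th (A n / (C n * F' n)) \<noteq> 0" by (rule G[of _ "a / (c * f)" 3]) (use Snz[of n] in \<open>simp_all add: defs L_def eval_nat_numeral\<close>)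
      show "th (z * D n) \<noteq> 0" by (rule G[of _ "z * d" 1]) (simp_all add: defs L_def)
      show "th (z * E n) \<noteq> 0" by (rule G[of _ "z * e" 1]) (simp_all add: defs L_def)
      show "th (z * F' n) \<noteq> 0" by (rule G[of _ "z * f" 1]) (simp_all add: defs L_def)
    qed (use nz Snz tz tg z1 in \<open>auto simp: defs\<close>)
    then show ?thesis unfolding bc .
  qed
  have tr': "th (e / d) \<noteq> 0" "th (f / d) \<noteq> 0" "th (f / e) \<noteq> 0"
    using theta_nz_flip tr nz by blast+
  have "(\<lambda>n. wp_series (A n) [A n, B n, C n, D n, E n, F' n] (A n) z * (th z * P (b * c / a))) \<longlonglongrightarrow>
      wp_series a [a, b, c, d, e, f] a z * (th z * P (b * c / a))"
    by (intro tendsto_mult tendsto_const wp_series_tendsto lim nz z1)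
  moreover have "(\<lambda>n. P (A n) * (F_reg z (A n) (B n) (C n) (D n) (E n) (F' n) + F_reg z (A n) (B n) (C n) (E n) (D n) (F' n) + F_reg z (A n) (B n) (C n) (F' n) (D n) (E n))) \<longlonglongrightarrow>
      P a * (F_reg z a b c d e f + F_reg z a b c e d f + F_reg z a b c f d e)"
    by (intro tendsto_mult tendsto_add tendsto_qpoch_inf F_reg_tendsto lim nz znz tr tr')
  ultimately show ?thesis unfolding eq by (rule LIMSEQ_unique)
qed

section \<open>Return from cleared series to the original ones\<close>

lemma qpoch_inverse_eq: "P x \<noteq> 0 \<Longrightarrow> 1 / pn x k = P (x * q ^ k) / P x"
  using qpoch_inf_split[of x k] qpoch_nz[of x k] by (simp add: field_simps)

text \<open>The parameters q csqrt a, -q csqrt a over csqrt a, -csqrt a collapse to (1 - a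
  q^(2k))/(1 - a). The factors 1 - csqrt a and 1 + csqrt a of 1 - a are non-zero by
  \<open>s\<close>.\<close>

lemma W87_eq_wp_series:
  assumes nz: "a \<noteq> 0" "b \<noteq> 0" "c \<noteq> 0" "d \<noteq> 0" "e \<noteq> 0" "f \<noteq> 0" and z: "norm z < 1"
    and s: "P (csqrt a) \<noteq> 0" "P (- csqrt a) \<noteq> 0"
    and Pnz: "P (q * a / b) \<noteq> 0" "P (q * a / c) \<noteq> 0" "P (q * a / d) \<noteq> 0" "P (q * a / e) \<noteq> 0" "P (q * a / f) \<noteq> 0"
  shows "1 - a \<noteq> 0"
    "W87 a b c d e f q z = wp_series a [a, b, c, d, e, f] a z /
       ((1 - a) * (P q * P (q * a / b) * P (q * a / c) * P (q * a / d) * P (q * a / e) * P (q * a / f)))"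
proof -
  let ?s = "csqrt a"
  let ?D = "(1 - a) * (P q * P (q * a / b) * P (q * a / c) * P (q * a / d) * P (q * a / e) * P (q * a / f))"
  have ss: "?s * ?s = a" by (metis power2_csqrt power2_eq_square)
  have s1: "1 - ?s \<noteq> 0" "1 + ?s \<noteq> 0"
    using s qpoch_inf_Suc[of ?s] qpoch_inf_Suc[of "- ?s"] by auto
  have a1: "1 - a = (1 - ?s) * (1 + ?s)" using ss by (simp add: algebra_simps)
  then show anz: "1 - a \<noteq> 0" using s1 by simp
  have shift: "pn (q * x) k / pn x k = (1 - x * q ^ k) / (1 - x)" if "P x \<noteq> 0" for x k
  proof -
    have "(1 - x) * pn (q * x) k = pn x k * (1 - x * q ^ k)"
      using qpoch_Suc[of x q k] qpoch_Suc_shift[of x q k] by (simp add: mult.commute)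
    moreover have "1 - x \<noteq> 0" using that qpoch_inf_Suc[of x] by auto
    ultimately show ?thesis using qpoch_nz[OF that, of k] by (simp add: field_simps)
  qed
  let ?w = "\<lambda>k. (1 - a\<^sup>2 * q ^ (2 * k) / a) * (\<Prod>y\<leftarrow>[a, b, c, d, e, f]. pn (a * y / a) k * P (q * a / y * q ^ k)) * z ^ k"
  have t: "qpochs [a, q * ?s, - (q * ?s), b, c, d, e, f] q k / qpochs (q # W87_lower a b c d e f q) q k * z ^ k = (1 / ?D) * ?w k" for k
  proof -
    have "qpochs [a, q * ?s, - (q * ?s), b, c, d, e, f] q k / qpochs (q # W87_lower a b c d e f q) q k * z ^ k =
       (pn (q * ?s) k / pn ?s k) * (pn (q * - ?s) k / pn (- ?s) k) * (pn a k * pn b k * pn c k * pn d k * pn e k * pn f k) *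
       ((1 / pn q k) * (1 / pn (q * a / b) k) * (1 / pn (q * a / c) k) * (1 / pn (q * a / d) k) * (1 / pn (q * a / e) k) * (1 / pn (q * a / f) k)) * z ^ k"
      by (simp add: qpochs_def W87_lower_def mult_ac)
    also have "(pn (q * ?s) k / pn ?s k) * (pn (q * - ?s) k / pn (- ?s) k) = (1 - a * q ^ (2 * k)) / (1 - a)"
    proof -
      have "(1 - ?s * q ^ k) * (1 - - ?s * q ^ k) = 1 - ?s * ?s * (q ^ k * q ^ k)" by (simp add: algebra_simps)
      then have "(1 - ?s * q ^ k) * (1 - - ?s * q ^ k) = 1 - a * q ^ (2 * k)"
        by (simp only: ss power_add[symmetric] mult_2)
      then show ?thesis unfolding shift[OF s(1)] shift[OF s(2)] a1 by simp
    qed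
    also have "(1 / pn q k) * (1 / pn (q * a / b) k) * (1 / pn (q * a / c) k) * (1 / pn (q * a / d) k) * (1 / pn (q * a / e) k) * (1 / pn (q * a / f) k) =
      (P (q * q ^ k) / P q) * (P (q * a / b * q ^ k) / P (q * a / b)) * (P (q * a / c * q ^ k) / P (q * a / c)) * (P (q * a / d * q ^ k) / P (q * a / d)) *
      (P (q * a / e * q ^ k) / P (q * a / e)) * (P (q * a / f * q ^ k) / P (q * a / f))"
      by (simp only: qpoch_inverse_eq Pnz qpoch_inf_q_nz not_False_eq_True)
    finally show ?thesis
      using nz by (simp add: power2_eq_square mult_ac)
  qed
  have "summable ?w"
  proof -
    have "?w = (\<lambda>k. (1 - a * q ^ (2 * k)) * (\<Prod>i\<in>{0, 1, 2, 3, 4, 5 :: nat}. pn ([a, b, c, d, e, f] ! i) k * P (q * a / ([a, b, c, d, e, f] ! i) * q ^ k)) * z ^ k)"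
      using nz by (intro ext) (simp add: eval_nat_numeral mult_ac)
    moreover have "summable \<dots>"
      by (rule series_summable) (use z in auto)
    ultimately show ?thesis by (simp only:)
  qed
  then have "(\<Sum>k. (1 / ?D) * ?w k) = (1 / ?D) * suminf ?w" by (rule suminf_mult)
  then show "W87 a b c d e f q z = wp_series a [a, b, c, d, e, f] a z / ?D"
    unfolding W87_def phi_def t wp_series_def by simp
qed

lemma phi_eq_phi_reg:
  assumes Pnz: "P (b * c * d / a) \<noteq> 0" "P (q * d / e) \<noteq> 0" "P (q * d / f) \<noteq> 0"
  shows "phi [q * a / (e * f), b * d / a, c * d / a, d] (F_lower q a b c d e f) q q =
    phi_reg a b c d e f / (P q * P (b * c * d / a) * P (q * d / e) * P (q * d / f))"
proof -
  let ?D = "P q * P (b * c * d / a) * P (q * d / e) * P (q * d / f)"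
  let ?w = "\<lambda>j. (P (q * q ^ j) * P (q * d / e * q ^ j) * P (q * d / f * q ^ j) * P (b * c * d / a * q ^ j)) *
     (pn d j * pn (b * d / a) j * pn (c * d / a) j * pn (q * a / (e * f)) j) * q ^ j"
  have t: "qpochs [q * a / (e * f), b * d / a, c * d / a, d] q k / qpochs (q # F_lower q a b c d e f) q k * q ^ k = (1 / ?D) * ?w k" for k
  proof -
    have "qpochs [q * a / (e * f), b * d / a, c * d / a, d] q k / qpochs (q # F_lower q a b c d e f) q k * q ^ k =
       (pn d k * pn (b * d / a) k * pn (c * d / a) k * pn (q * a / (e * f)) k) *
       ((1 / pn q k) * (1 / pn (b * c * d / a) k) * (1 / pn (q * d / e) k) * (1 / pn (q * d / f) k)) * q ^ k"
      by (simp add: qpochs_def F_lower_def mult_ac)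
    also have "(1 / pn q k) * (1 / pn (b * c * d / a) k) * (1 / pn (q * d / e) k) * (1 / pn (q * d / f) k) =
      (P (q * q ^ k) / P q) * (P (b * c * d / a * q ^ k) / P (b * c * d / a)) * (P (q * d / e * q ^ k) / P (q * d / e)) * (P (q * d / f * q ^ k) / P (q * d / f))"
      by (simp only: qpoch_inverse_eq Pnz qpoch_inf_q_nz not_False_eq_True)
    finally show ?thesis by (simp add: mult_ac)
  qed
  let ?u = "\<lambda>i. [d, b * d / a, c * d / a, q * a / (e * f)] ! i" and ?v = "\<lambda>i. [q, q * d / e, q * d / f, b * c * d / a] ! i"
  have "?w k = (1 - 0 * q ^ (2 * k)) * (\<Prod>i\<in>{0, 1, 2, 3 :: nat}. pn (?u i) k * P (?v i * q ^ k)) * q ^ k" for k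
    by (simp add: eval_nat_numeral mult_ac)
  then have "summable ?w" using series_summable[of "{0, 1, 2, 3 :: nat}" q 0 ?u ?v] q_less_1 by (simp only:) simp
  then have "(\<Sum>k. (1 / ?D) * ?w k) = (1 / ?D) * suminf ?w" by (rule suminf_mult)
  then show ?thesis unfolding phi_def t phi_reg_def by simp
qed

section \<open>The role of the integer n\<close>

lemma theta_powi_nz_iff:
  assumes "x \<noteq> 0"
  shows "th (q powi n * x) \<noteq> 0 \<longleftrightarrow> th x \<noteq> 0"
proof -
  have nat: "th (q ^ k * y) \<noteq> 0 \<longleftrightarrow> th y \<noteq> 0" if "y \<noteq> 0" for k y
  proof -
    have "th (q ^ k * y) * (\<Prod>i<k. q ^ i) = (- 1 / y) ^ k * th y" by (rule theta_q_power_mult[OF that])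
    moreover have "(\<Prod>i<k. q ^ i) \<noteq> 0" "(- 1 / y) ^ k \<noteq> 0" using that by simp_all
    ultimately show ?thesis by (metis mult_eq_0_iff)
  qed
  show ?thesis
  proof (cases "n \<ge> 0")
    case True
    then show ?thesis using nat[OF assms, of "nat n"] by (simp add: power_int_def)
  next
    case False
    have nz: "q powi n * x \<noteq> 0" using assms by simp
    have e: "q ^ nat (- n) * (q powi n * x) = x"
      using False by (simp add: power_int_def field_simps)
    show ?thesis using nat[OF nz, of "nat (- n)", unfolded e] by simp
  qed
qed

text \<open>Under the shift by q^n the product th x1 th x2 acquires a multiplier that depends only
  on n and x1 x2.\<close>

lemma theta_powi_balanced:
  assumes nz: "x1 \<noteq> 0" "x2 \<noteq> 0" "y1 \<noteq> 0" "y2 \<noteq> 0" and eq: "x1 * x2 = y1 * y2"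
  shows "th (q powi n * x1) * th (q powi n * x2) * (th y1 * th y2) = th x1 * th x2 * (th (q powi n * y1) * th (q powi n * y2))"
proof -
  have nat: "th (q ^ k * x1) * th (q ^ k * x2) * (th y1 * th y2) = th x1 * th x2 * (th (q ^ k * y1) * th (q ^ k * y2))"
    if nz: "x1 \<noteq> 0" "x2 \<noteq> 0" "y1 \<noteq> 0" "y2 \<noteq> 0" and eq: "x1 * x2 = y1 * y2" for x1 x2 y1 y2 k
  proof -
    let ?E = "\<Prod>i<k. q ^ i"
    have E: "?E \<noteq> 0" by simp
    have pair: "th (q ^ k * x) * th (q ^ k * y) = (1 / (x * y)) ^ k * (th x * th y) / (?E * ?E)" if "x \<noteq> 0" "y \<noteq> 0" for x y
    proof -
      have "(th (q ^ k * x) * ?E) * (th (q ^ k * y) * ?E) = ((- 1 / x) ^ k * (- 1 / y) ^ k) * (th x * th y)"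
        unfolding theta_q_power_mult[OF that(1)] theta_q_power_mult[OF that(2)] by (simp only: mult_ac)
      also have "(- 1 / x) ^ k * (- 1 / y) ^ k = (1 / (x * y)) ^ k"
        unfolding power_mult_distrib[symmetric] by simp
      finally show ?thesis using E by (simp add: eq_divide_eq mult_ac)
    qed
    show ?thesis unfolding pair[OF nz(1,2)] pair[OF nz(3,4)] eq by simp
  qed
  show ?thesis
  proof (cases "n \<ge> 0")
    case True
    then show ?thesis using nat[OF nz eq, of "nat n"] by (simp add: power_int_def)
  next
    case False
    have qn: "q ^ nat (- n) * (q powi n * x) = x" for x
      using False by (simp add: power_int_def field_simps)
    have e: "(q powi n * x1) * (q powi n * x2) = (q powi n * y1) * (q powi n * y2)"
      using eq by (simp add: mult_ac)
    show ?thesis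
      using nat[OF _ _ _ _ e, of "nat (- n)", unfolded qn] nz by (simp add: mult_ac)
  qed
qed

lemma no_pole_params_nz: "no_pole_params bs q \<Longrightarrow> x \<in> set bs \<Longrightarrow> P x \<noteq> 0"
proof
  assume np: "no_pole_params bs q" and x: "x \<in> set bs" and "P x = 0"
  then obtain k where "x * q ^ k = 1" using qpoch_inf_eq_0_iff by blast
  then have "x = q powi (- int k)" by (simp add: power_int_minus field_simps)
  then show False using np x unfolding no_pole_params_def by blast
qed

text \<open>Since (z d)(g/d) = z g, the balanced shift extracts n from the two theta functions of
  F(d; e, f) in a factor free of d, hence common to all three terms.\<close>

lemma F_eq_F_reg:
  assumes nz: "a \<noteq> 0" "b \<noteq> 0" "c \<noteq> 0" "d \<noteq> 0" "e \<noteq> 0" "f \<noteq> 0"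
    and g: "g = q * a / (b * c)" and z: "z = q\<^sup>2 * a\<^sup>2 / (b * c * d * e * f)"
    and tz: "th z \<noteq> 0" and tg: "th g \<noteq> 0"
    and den: "F_den q a b c d e f \<noteq> 0" and low: "no_pole_params (F_lower q a b c d e f) q"
  shows "F n q a b c d e f = th (q powi n * z) * th (q powi n * g) / (th z * th g * P q) * F_reg z a b c d e f"
proof -
  have gnz: "g \<noteq> 0" and znz: "z \<noteq> 0" using nz g z by simp_all
  have Pl: "P (b * c * d / a) \<noteq> 0" "P (q * d / e) \<noteq> 0" "P (q * d / f) \<noteq> 0"
    using no_pole_params_nz[OF low] by (auto simp: F_lower_def)
  have Pd: "P (q * a / (b * c * d)) \<noteq> 0" "P (e / d) \<noteq> 0" "P (f / d) \<noteq> 0"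
    using den by (simp_all add: F_den_def qpochs_inf_def)
  have a1: "q powi (n + 2) * a\<^sup>2 / (b * c * e * f) = q powi n * (z * d)" "q powi (n + 1) * a / (b * c * d) = q powi n * (g / d)"
    using nz by (simp_all add: z g power_int_add power2_eq_square field_simps)
  have bal: "th (q powi n * (z * d)) * th (q powi n * (g / d)) * (th z * th g) = th (z * d) * th (g / d) * (th (q powi n * z) * th (q powi n * g))"
    using nz znz gnz by (intro theta_powi_balanced) auto
  then have bal': "th (q powi n * (z * d)) * th (q powi n * (g / d)) = th (z * d) * th (g / d) * (th (q powi n * z) * th (q powi n * g) / (th z * th g))"
    using tz tg by (simp add: field_simps)
  \<comment> \<open>One half cancels a factor of \<open>F_den\<close>, the other the normalisation
    by the lower parameter b c d/a. The halves in \<open>te\<close> are shared out between the two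
    in the same way.\<close>
  have tgd: "th (g / d) = P (q * a / (b * c * d)) * P (b * c * d / a)"
    using nz by (simp add: theta_eq g)
  have te: "th (e / d) = P (e / d) * P (q * d / e)" "th (f / d) = P (f / d) * P (q * d / f)"
    by (simp_all add: theta_eq)
  show ?thesis
    unfolding F_def phi_eq_phi_reg[OF Pl] F_den_def thetas_def qpochs_inf_def a1 F_reg_def te
    using bal'[unfolded tgd] Pl Pd by (simp add: mult_ac)
qed

end

theorem theorem6p8:
  fixes n :: int and q a b c d e f :: complex
  assumes "q \<noteq> 0" "a \<noteq> 0" "b \<noteq> 0" "c \<noteq> 0" "d \<noteq> 0" "e \<noteq> 0" "f \<noteq> 0"
    and "norm q < 1"
    and "norm (q\<^sup>2 * a\<^sup>2) < norm (b * c * d * e * f)"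
    and "thetas [q powi (n + 2) * a\<^sup>2 / (b * c * d * e * f), q powi (n + 1) * a / (b * c)] q \<noteq> 0"
    and "qpochs_inf [q * a / b, q * a / c, q * a / d, q * a / e, q * a / f] q \<noteq> 0"
    and "F_den q a b c d e f \<noteq> 0" "F_den q a b c e d f \<noteq> 0" "F_den q a b c f e d \<noteq> 0"
    and "no_pole_params (W87_lower a b c d e f q) q"
    and "no_pole_params (F_lower q a b c d e f) q"
        "no_pole_params (F_lower q a b c e d f) q"
        "no_pole_params (F_lower q a b c f e d) q"
  shows "W87 a b c d e f q (q\<^sup>2 * a\<^sup>2 / (b * c * d * e * f)) =
    qpochs_inf [q * a, q * a / (b * c)] q /
    (thetas [q powi (n + 2) * a\<^sup>2 / (b * c * d * e * f), q powi (n + 1) * a / (b * c)] q *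
     qpochs_inf [q * a / b, q * a / c, q * a / d, q * a / e, q * a / f] q) *
    (F n q a b c d e f + F n q a b c e d f + F n q a b c f e d)"
proof -
  interpret qbase q by standard (use assms in auto)
  define z where "z = q\<^sup>2 * a\<^sup>2 / (b * c * d * e * f)"
  define g where "g = q * a / (b * c)"
  note nz = assms(2-7)
  have gnz: "g \<noteq> 0" and znz: "z \<noteq> 0" using nz by (simp_all add: g_def z_def)
  have z1: "norm z < 1" using assms(9) nz by (simp add: z_def norm_divide)
  have N: "q powi (n + 2) * a\<^sup>2 / (b * c * d * e * f) = q powi n * z" "q powi (n + 1) * a / (b * c) = q powi n * g"
    by (simp_all add: z_def g_def power_int_add power2_eq_square)
  have tN: "th (q powi n * z) \<noteq> 0" "th (q powi n * g) \<noteq> 0"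
    using assms(10) unfolding N by (simp_all add: thetas_def)
  have tz: "th z \<noteq> 0" and tg: "th g \<noteq> 0"
    using tN theta_powi_nz_iff znz gnz by blast+
  have Pq: "P (q * a / b) \<noteq> 0" "P (q * a / c) \<noteq> 0" "P (q * a / d) \<noteq> 0" "P (q * a / e) \<noteq> 0" "P (q * a / f) \<noteq> 0"
    using assms(11) by (simp_all add: qpochs_inf_def)
  have Ps: "P (csqrt a) \<noteq> 0" "P (- csqrt a) \<noteq> 0"
    using no_pole_params_nz[OF assms(15)] by (auto simp: W87_lower_def)
  \<comment> \<open>The two halves come from different hypotheses: P (d/e) is a factor of the
    denominator of F(e; d, f), and q e/d is a lower parameter of its series; the other two ratios
    are treated alike.\<close>
  have tr: "th (d / e) \<noteq> 0" "th (d / f) \<noteq> 0" "th (e / f) \<noteq> 0"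
    using assms(12-14) no_pole_params_nz[OF assms(16)] no_pole_params_nz[OF assms(17)] no_pole_params_nz[OF assms(18)]
    by (auto simp: theta_eq F_den_def F_lower_def qpochs_inf_def)
  define r where "r = th (q powi n * z) * th (q powi n * g) / (th z * th g * P q)"
  have z2: "z = q\<^sup>2 * a\<^sup>2 / (b * c * e * d * f)" "z = q\<^sup>2 * a\<^sup>2 / (b * c * f * e * d)"
    by (simp_all add: z_def mult_ac)
  \<comment> \<open>The claim uses F(f; e, d), whereas the cleared identity lists d before e; the
    term is symmetric in its last two arguments.\<close>
  have sw: "F_reg z a b c f e d = F_reg z a b c f d e"
    by (simp add: F_reg_def phi_reg_def mult_ac)
  have F1: "F n q a b c d e f = r * F_reg z a b c d e f"
    unfolding r_def by (rule F_eq_F_reg[OF nz g_def z_def tz tg assms(12,16)])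
  have F2: "F n q a b c e d f = r * F_reg z a b c e d f"
    unfolding r_def by (rule F_eq_F_reg[OF nz(1-3,5,4,6) g_def z2(1) tz tg assms(13,17)])
  have F3: "F n q a b c f e d = r * F_reg z a b c f d e"
    unfolding r_def sw[symmetric] by (rule F_eq_F_reg[OF nz(1-3,6,5,4) g_def z2(2) tz tg assms(14,18)])
  let ?F = "F_reg z a b c d e f + F_reg z a b c e d f + F_reg z a b c f d e"
  let ?D = "P (q * a / b) * P (q * a / c) * P (q * a / d) * P (q * a / e) * P (q * a / f)"
  have reg: "wp_series a [a, b, c, d, e, f] a z * (th z * P (b * c / a)) = P a * ?F"
    by (rule three_term_regular[OF nz g_def z_def z1 tz tg tr])
  have tgP: "th g = P g * P (b * c / a)" using nz by (simp add: theta_eq g_def)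
  have Pbc: "P g \<noteq> 0" "P (b * c / a) \<noteq> 0" using tg tgP by auto
  have a1: "1 - a \<noteq> 0" and W: "W87 a b c d e f q z = wp_series a [a, b, c, d, e, f] a z / ((1 - a) * (P q * ?D))"
    using W87_eq_wp_series[OF nz z1 Ps Pq] by (simp_all add: mult_ac)
  have "wp_series a [a, b, c, d, e, f] a z = P a * ?F / (th z * P (b * c / a))"
    using reg tz Pbc by (simp add: eq_divide_eq)
  also have "P a = (1 - a) * P (q * a)" using qpoch_inf_Suc[of a] by (simp add: mult.commute)
  finally have S: "wp_series a [a, b, c, d, e, f] a z = (1 - a) * P (q * a) * ?F / (th z * P (b * c / a))" .
  have "W87 a b c d e f q z = P (q * a) * P g / (th (q powi n * z) * th (q powi n * g) * ?D) * (r * ?F)"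
    unfolding W S r_def tgP using a1 tN tz Pbc by simp
  then show ?thesis
    unfolding N z_def[symmetric] F1 F2 F3 distrib_left[symmetric]
    by (simp add: qpochs_inf_def thetas_def g_def mult_ac)
qed

end
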